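(* Let $G=(V,E,s)$ be a reducible flow graph with $n$ vertices and initially $m$ edges. The dominator tree of $G$ can be maintained through any sequence of edge deletions in $O(mn)$ total time.
   Context: A flow graph $G=(V,E,s)$ is a directed graph with a distinguished start vertex $s$. A vertex $w$ dominates $v$ if every path from $s$ to $v$ contains $w$; the dominator tree is the tree rooted at $s$ on the vertices reachable from $s$ in which the parent of each $v\neq s$ is its immediate dominator (the dominator of $v$ other than $v$ that is dominated by all other dominators of $v$ other than $v$). A flow graph is reducible if every strongly connected subgraph $S$ has a single entry vertex $v$ such that every path from $s$ to a vertex of $S$ contains $v$. *)

theory Defs
  imports "Graph_Theory.Graph_Theory"
begin

section \<open>Flow graphs and dominators\<close>

locale flow_graph = pair_fin_digraph G for G :: "'a pair_pre_digraph" +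
  fixes s :: 'a
  assumes start_in_verts: "s \<in> pverts G"

definition dominates :: "'a pair_pre_digraph \<Rightarrow> 'a \<Rightarrow> 'a \<Rightarrow> 'a \<Rightarrow> bool" where
  "dominates G s w v \<longleftrightarrow>
     (\<forall>p. pre_digraph.awalk (with_proj G) s p v \<longrightarrow>
          w \<in> set (pre_digraph.awalk_verts (with_proj G) s p))"

definition immediate_dominator :: "'a pair_pre_digraph \<Rightarrow> 'a \<Rightarrow> 'a \<Rightarrow> 'a \<Rightarrow> bool" where
  "immediate_dominator G s d v \<longleftrightarrow>
     dominates G s d v \<and> d \<noteq> v \<and>
     (\<forall>w. dominates G s w v \<and> w \<noteq> v \<and> w \<noteq> d \<longrightarrow> dominates G s w d)"

text \<open>Arcs of the dominator tree point from the parent to the child.\<close>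

definition dominator_tree :: "'a pair_pre_digraph \<Rightarrow> 'a \<Rightarrow> 'a pair_pre_digraph" where
  "dominator_tree G s =
     \<lparr> pverts = {v. s \<rightarrow>\<^sup>*\<^bsub>with_proj G\<^esub> v},
       parcs = {(d, v). s \<rightarrow>\<^sup>*\<^bsub>with_proj G\<^esub> v \<and> v \<noteq> s \<and> immediate_dominator G s d v} \<rparr>"

text \<open>The entry vertex has to belong to \<open>S\<close>; otherwise \<open>s\<close> would always qualify.\<close>

definition reducible :: "'a pair_pre_digraph \<Rightarrow> 'a \<Rightarrow> bool" where
  "reducible G s \<longleftrightarrow>
     (\<forall>S. subgraph S (with_proj G) \<and> strongly_connected S \<longrightarrow>
       (\<exists>v \<in> verts S. \<forall>u \<in> verts S. \<forall>p. pre_digraph.awalk (with_proj G) s p u \<longrightarrow>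
          v \<in> set (pre_digraph.awalk_verts (with_proj G) s p)))"

definition delete_edge :: "'a pair_pre_digraph \<Rightarrow> 'a \<times> 'a \<Rightarrow> 'a pair_pre_digraph" where
  "delete_edge G e = G\<lparr> parcs := parcs G - {e} \<rparr>"


section \<open>Random access machine\<close>

text \<open>
  A structured presentation of the word RAM. The memory consists of named, unbounded arrays of
  natural numbers, of which a program mentions only finitely many; a scalar variable is
  cell \<open>0\<close> of an array. Subtraction is truncated at \<open>0\<close>, and \<open>x div 0 = 0\<close>, \<open>x mod 0 = x\<close>.
\<close>

type_synonym vname = string
type_synonym state = "vname \<Rightarrow> nat \<Rightarrow> nat"

datatype binop = Plus | Minus | Times | Quot | Rem

datatype expr = Const nat | Cell vname expr | Bin binop expr expr

datatype cond = Less expr expr | Equal expr expr | Neg cond | Conj cond cond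

datatype com =
    Skip
  | Assign vname expr expr  \<comment> \<open>array, index, new value\<close>
  | Seq com com
  | If cond com com
  | While cond com

fun binop_val :: "binop \<Rightarrow> nat \<Rightarrow> nat \<Rightarrow> nat" where
  "binop_val Plus a b = a + b"
| "binop_val Minus a b = a - b"
| "binop_val Times a b = a * b"
| "binop_val Quot a b = a div b"
| "binop_val Rem a b = a mod b"

fun expr_val :: "expr \<Rightarrow> state \<Rightarrow> nat" where
  "expr_val (Const k) \<sigma> = k"
| "expr_val (Cell x e) \<sigma> = \<sigma> x (expr_val e \<sigma>)"
| "expr_val (Bin f a b) \<sigma> = binop_val f (expr_val a \<sigma>) (expr_val b \<sigma>)"

fun cond_val :: "cond \<Rightarrow> state \<Rightarrow> bool" where
  "cond_val (Less a b) \<sigma> \<longleftrightarrow> expr_val a \<sigma> < expr_val b \<sigma>"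
| "cond_val (Equal a b) \<sigma> \<longleftrightarrow> expr_val a \<sigma> = expr_val b \<sigma>"
| "cond_val (Neg b) \<sigma> \<longleftrightarrow> \<not> cond_val b \<sigma>"
| "cond_val (Conj b c) \<sigma> \<longleftrightarrow> cond_val b \<sigma> \<and> cond_val c \<sigma>"

text \<open>
  Every value that occurs during an evaluation, addresses included, has to fit into a machine
  word, that is, has to be smaller than \<open>W\<close>. An overflowing computation is stuck.
\<close>

fun expr_fits :: "nat \<Rightarrow> expr \<Rightarrow> state \<Rightarrow> bool" where
  "expr_fits W (Const k) \<sigma> \<longleftrightarrow> k < W"
| "expr_fits W (Cell x e) \<sigma> \<longleftrightarrow> expr_fits W e \<sigma> \<and> \<sigma> x (expr_val e \<sigma>) < W"
| "expr_fits W (Bin f a b) \<sigma> \<longleftrightarrow>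
     expr_fits W a \<sigma> \<and> expr_fits W b \<sigma> \<and> expr_val (Bin f a b) \<sigma> < W"

fun cond_fits :: "nat \<Rightarrow> cond \<Rightarrow> state \<Rightarrow> bool" where
  "cond_fits W (Less a b) \<sigma> \<longleftrightarrow> expr_fits W a \<sigma> \<and> expr_fits W b \<sigma>"
| "cond_fits W (Equal a b) \<sigma> \<longleftrightarrow> expr_fits W a \<sigma> \<and> expr_fits W b \<sigma>"
| "cond_fits W (Neg b) \<sigma> \<longleftrightarrow> cond_fits W b \<sigma>"
| "cond_fits W (Conj b c) \<sigma> \<longleftrightarrow> cond_fits W b \<sigma> \<and> cond_fits W c \<sigma>"

fun expr_cost :: "expr \<Rightarrow> nat" where
  "expr_cost (Const k) = 1"
| "expr_cost (Cell x e) = 1 + expr_cost e"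
| "expr_cost (Bin f a b) = 1 + expr_cost a + expr_cost b"

fun cond_cost :: "cond \<Rightarrow> nat" where
  "cond_cost (Less a b) = 1 + expr_cost a + expr_cost b"
| "cond_cost (Equal a b) = 1 + expr_cost a + expr_cost b"
| "cond_cost (Neg b) = 1 + cond_cost b"
| "cond_cost (Conj b c) = 1 + cond_cost b + cond_cost c"

definition store :: "state \<Rightarrow> vname \<Rightarrow> nat \<Rightarrow> nat \<Rightarrow> state" where
  "store \<sigma> x i k = \<sigma>(x := (\<sigma> x)(i := k))"

text \<open>\<open>exec W c \<sigma> t \<sigma>'\<close>: with word bound \<open>W\<close>, started in \<open>\<sigma>\<close>, \<open>c\<close> halts after \<open>t\<close> steps in \<open>\<sigma>'\<close>.\<close>

inductive exec :: "nat \<Rightarrow> com \<Rightarrow> state \<Rightarrow> nat \<Rightarrow> state \<Rightarrow> bool" for W :: nat where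
  Skip: "exec W Skip \<sigma> 1 \<sigma>"
| Assign: "\<lbrakk> expr_fits W i \<sigma>; expr_fits W e \<sigma> \<rbrakk> \<Longrightarrow>
    exec W (Assign x i e) \<sigma> (1 + expr_cost i + expr_cost e)
      (store \<sigma> x (expr_val i \<sigma>) (expr_val e \<sigma>))"
| Seq: "\<lbrakk> exec W c1 \<sigma> t1 \<sigma>1; exec W c2 \<sigma>1 t2 \<sigma>2 \<rbrakk> \<Longrightarrow> exec W (Seq c1 c2) \<sigma> (t1 + t2) \<sigma>2"
| IfTrue: "\<lbrakk> cond_fits W b \<sigma>; cond_val b \<sigma>; exec W c1 \<sigma> t \<sigma>' \<rbrakk> \<Longrightarrow>
    exec W (If b c1 c2) \<sigma> (1 + cond_cost b + t) \<sigma>'"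
| IfFalse: "\<lbrakk> cond_fits W b \<sigma>; \<not> cond_val b \<sigma>; exec W c2 \<sigma> t \<sigma>' \<rbrakk> \<Longrightarrow>
    exec W (If b c1 c2) \<sigma> (1 + cond_cost b + t) \<sigma>'"
| WhileFalse: "\<lbrakk> cond_fits W b \<sigma>; \<not> cond_val b \<sigma> \<rbrakk> \<Longrightarrow>
    exec W (While b c) \<sigma> (1 + cond_cost b) \<sigma>"
| WhileTrue: "\<lbrakk> cond_fits W b \<sigma>; cond_val b \<sigma>; exec W c \<sigma> t1 \<sigma>1; exec W (While b c) \<sigma>1 t2 \<sigma>2 \<rbrakk> \<Longrightarrow>
    exec W (While b c) \<sigma> (1 + cond_cost b + t1 + t2) \<sigma>2"

inductive_cases exec_elims:
  "exec W Skip \<sigma> t \<sigma>'"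
  "exec W (Assign x i e) \<sigma> t \<sigma>'"
  "exec W (Seq c1 c2) \<sigma> t \<sigma>'"
  "exec W (If b c1 c2) \<sigma> t \<sigma>'"

inductive_cases exec_WhileE: "exec W (While b c) \<sigma> t \<sigma>'"

lemma exec_deterministic:
  assumes "exec W c \<sigma> t \<sigma>'" and "exec W c \<sigma> u \<tau>"
  shows "u = t \<and> \<tau> = \<sigma>'"
  using assms
proof (induction arbitrary: u \<tau> rule: exec.induct)
  case (Seq c1 \<sigma> t1 \<sigma>1 c2 t2 \<sigma>2)
  then show ?case by (blast elim: exec_elims)
next
  case (WhileFalse b \<sigma> c)
  from WhileFalse.prems show ?case
    by (rule exec_WhileE) (use WhileFalse.hyps in auto)
next
  case (WhileTrue b \<sigma> c t1 \<sigma>1 t2 \<sigma>2)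
  from WhileTrue.prems obtain v1 \<tau>1 v2 where *: "u = 1 + cond_cost b + v1 + v2"
    "exec W c \<sigma> v1 \<tau>1" "exec W (While b c) \<tau>1 v2 \<tau>"
    by (rule exec_WhileE) (use WhileTrue.hyps in auto)
  with WhileTrue.IH(1) have "v1 = t1" "\<tau>1 = \<sigma>1" by blast+
  with * WhileTrue.IH(2) show ?case by blast
next
  case (IfTrue b \<sigma> c1 t \<sigma>' c2)
  from IfTrue.prems show ?case
    by (rule exec_elims(4)) (use IfTrue.hyps IfTrue.IH in \<open>metis plus_1_eq_Suc add_Suc\<close>)+
next
  case (IfFalse b \<sigma> c2 t \<sigma>' c1)
  from IfFalse.prems show ?case
    by (rule exec_elims(4)) (use IfFalse.hyps IfFalse.IH in \<open>metis plus_1_eq_Suc add_Suc\<close>)+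
next
  case (Skip \<sigma>)
  then show ?case by (rule exec_elims(1)) simp
next
  case (Assign i \<sigma> e x)
  from Assign.prems show ?case by (rule exec_elims(2)) simp
qed


section \<open>Maintaining a dominator tree under edge deletions\<close>

text \<open>
  The input graph is given on the vertices \<open>0, \<dots>, n - 1\<close> as a list of its edges. All cells that
  do not hold input are initially \<open>0\<close>.
\<close>

definition input_state :: "nat \<Rightarrow> nat \<Rightarrow> (nat \<times> nat) list \<Rightarrow> state" where
  "input_state n s as = (\<lambda>_ _. 0)
     (''n'' := (\<lambda>_. 0)(0 := n),
      ''m'' := (\<lambda>_. 0)(0 := length as),
      ''s'' := (\<lambda>_. 0)(0 := s),
      ''tail'' := (\<lambda>i. if i < length as then fst (as ! i) else 0),
      ''head'' := (\<lambda>i. if i < length as then snd (as ! i) else 0))"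

definition request :: "nat \<times> nat \<Rightarrow> state \<Rightarrow> state" where
  "request e \<sigma> = store (store \<sigma> ''del_tail'' 0 (fst e)) ''del_head'' 0 (snd e)"

definition stored_tree :: "nat \<Rightarrow> nat \<Rightarrow> state \<Rightarrow> nat pair_pre_digraph" where
  "stored_tree n s \<sigma> =
     \<lparr> pverts = {v. v < n \<and> \<sigma> ''in_tree'' v \<noteq> 0},
       parcs = {(\<sigma> ''parent'' v, v) |v. v < n \<and> \<sigma> ''in_tree'' v \<noteq> 0 \<and> v \<noteq> s} \<rparr>"

text \<open>
  \<open>maintains W upd n G s \<sigma> es t\<close>: in state \<open>\<sigma>\<close> the dominator tree of \<open>G\<close> is stored, and serving the
  deletions \<open>es\<close> one by one with \<open>upd\<close> takes \<open>t\<close> steps in total, the dominator tree of the current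
  graph being stored after each of them. The program sees a deletion only when its turn comes.
\<close>

fun maintains ::
  "nat \<Rightarrow> com \<Rightarrow> nat \<Rightarrow> nat pair_pre_digraph \<Rightarrow> nat \<Rightarrow> state \<Rightarrow> (nat \<times> nat) list \<Rightarrow> nat \<Rightarrow> bool"
where
  "maintains W upd n G s \<sigma> [] t \<longleftrightarrow> stored_tree n s \<sigma> = dominator_tree G s \<and> t = 0"
| "maintains W upd n G s \<sigma> (e # es) t \<longleftrightarrow>
     stored_tree n s \<sigma> = dominator_tree G s \<and>
     (\<exists>t1 \<sigma>' t2. exec W upd (request e \<sigma>) t1 \<sigma>' \<and>
        maintains W upd n (delete_edge G e) s \<sigma>' es t2 \<and> t = t1 + t2)"

end

theory Submission
  imports Defs
begin

text \<open>
  A vertex \<open>w\<close> dominates \<open>v\<close> iff \<open>v\<close> cannot be reached from \<open>s\<close> once \<open>w\<close> is removed, so it suffices to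
  maintain, for each of the \<open>n\<close> vertices \<open>w\<close>, the set of vertices reachable in \<open>G - w\<close>, each within
  \<open>O(m)\<close> total time.

  Call an edge \<open>(u, v)\<close> forward if \<open>v\<close> does not dominate \<open>u\<close> in the initial graph. The other edges never
  matter for reachability in any \<open>G - w\<close>, now or after deletions, because a simple path from \<open>s\<close> cannot
  use them; and in a reducible graph the forward edges are acyclic. On an acyclic graph decremental
  reachability is easy: a vertex stays reachable as long as the number of its reachable predecessors,
  kept in a counter, is positive, and a vertex whose counter drops to \<open>0\<close> decrements the counters of its
  successors. Every vertex dies at most once per \<open>w\<close>, which pays for scanning its outgoing edges.

  Deletions only enlarge the sets of dominators. The new parent of \<open>v\<close> is the deepest among the old parent
  and the vertices \<open>w\<close> in whose copy \<open>v\<close> has just died; depths are compared by asking whether the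
  current candidate dominates \<open>w\<close>.
\<close>


section \<open>Loop rules for the machine\<close>

text \<open>All copies share one work list, and during the deletions a pair \<open>(w, x)\<close>
  enters it at most once. The time bound is amortised accordingly: every pair still alive carries
  the cost of scanning the outgoing edges of \<open>x\<close> and of one later parent test, which
  sums to O(m) per copy. Not covered by this potential is one look at every copy per deletion, that
  is O(n) for each of at most m deletions.

  Reducibility enters once, for the initial graph. Forward edges are classified there and never
  again; after deletions they are merely a subset of an acyclic set. Acyclicity is what makes the
  counters trustworthy: on a cycle, unreachable vertices could keep each other's counters positive.

  The bound is O(mn) even if m is much smaller than n. There is no time to clear an n by n matrix,
  so all of them rely on the memory being zero at the start, and work of order n per vertex is done
  for reachable vertices only, of which there are at most m + 1.\<close>

fun writes :: "com \<Rightarrow> vname set" where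
  "writes Skip = {}"
| "writes (Assign x i e) = {x}"
| "writes (Seq c1 c2) = writes c1 \<union> writes c2"
| "writes (If b c1 c2) = writes c1 \<union> writes c2"
| "writes (While b c) = writes c"

definition agree :: "vname set \<Rightarrow> state \<Rightarrow> state \<Rightarrow> bool" where
  "agree X \<sigma> \<tau> \<longleftrightarrow> (\<forall>x. x \<notin> X \<longrightarrow> \<tau> x = \<sigma> x)"

text \<open>A bound on all cells at once. Every execution preserves it, so reading a cell at a valid
  address never gets stuck and only newly computed values need an argument.\<close>

definition bounded_state :: "nat \<Rightarrow> state \<Rightarrow> bool" where
  "bounded_state W \<sigma> \<longleftrightarrow> (\<forall>x i. \<sigma> x i < W)"

lemma store_apply: "store \<sigma> x i k y = (if y = x then (\<sigma> x)(i := k) else \<sigma> y)"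
  by (simp add: store_def)

lemma agree_refl [simp]: "agree X \<sigma> \<sigma>"
  by (simp add: agree_def)

lemma agree_trans: "agree X \<rho> \<sigma> \<Longrightarrow> agree Y \<sigma> \<tau> \<Longrightarrow> X \<subseteq> Z \<Longrightarrow> Y \<subseteq> Z \<Longrightarrow> agree Z \<rho> \<tau>"
  unfolding agree_def by (metis subsetD)

lemma agree_mono: "agree X \<sigma> \<tau> \<Longrightarrow> X \<subseteq> Z \<Longrightarrow> agree Z \<sigma> \<tau>"
  by (auto simp: agree_def)

lemma agreeD: "agree X \<sigma> \<tau> \<Longrightarrow> x \<notin> X \<Longrightarrow> \<tau> x = \<sigma> x"
  by (simp add: agree_def)

lemma exec_agree: "exec W c \<sigma> t \<tau> \<Longrightarrow> agree (writes c) \<sigma> \<tau>"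
  by (induction rule: exec.induct) (auto simp: agree_def store_apply)

lemma expr_fits_val: "expr_fits W e \<sigma> \<Longrightarrow> expr_val e \<sigma> < W"
  by (cases e) auto

lemma bounded_stateD: "bounded_state W \<sigma> \<Longrightarrow> \<sigma> x i < W"
  by (simp add: bounded_state_def)

lemma bounded_state_store: "bounded_state W \<sigma> \<Longrightarrow> k < W \<Longrightarrow> bounded_state W (store \<sigma> x i k)"
  by (simp add: bounded_state_def store_apply)

lemma exec_bounded: "exec W c \<sigma> t \<tau> \<Longrightarrow> bounded_state W \<sigma> \<Longrightarrow> bounded_state W \<tau>"
  by (induction rule: exec.induct) (auto intro: bounded_state_store expr_fits_val)

section \<open>Symbolic execution of loop-free programs\<close>

fun eff :: "com \<Rightarrow> state \<Rightarrow> state" where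
  "eff Skip \<sigma> = \<sigma>"
| "eff (Assign x i e) \<sigma> = store \<sigma> x (expr_val i \<sigma>) (expr_val e \<sigma>)"
| "eff (Seq c1 c2) \<sigma> = eff c2 (eff c1 \<sigma>)"
| "eff (If b c1 c2) \<sigma> = (if cond_val b \<sigma> then eff c1 \<sigma> else eff c2 \<sigma>)"
| "eff (While b c) \<sigma> = \<sigma>"

text \<open>Rejecting \<open>While\<close> makes the dummy value of \<open>eff\<close> on loops
  harmless. For a loop-free program the run is thus reduced to simplification with
  \<open>eff\<close> and \<open>safe\<close>.\<close>

fun safe :: "nat \<Rightarrow> com \<Rightarrow> state \<Rightarrow> bool" where
  "safe W Skip \<sigma> \<longleftrightarrow> True"
| "safe W (Assign x i e) \<sigma> \<longleftrightarrow> expr_fits W i \<sigma> \<and> expr_fits W e \<sigma>"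
| "safe W (Seq c1 c2) \<sigma> \<longleftrightarrow> safe W c1 \<sigma> \<and> safe W c2 (eff c1 \<sigma>)"
| "safe W (If b c1 c2) \<sigma> \<longleftrightarrow>
     cond_fits W b \<sigma> \<and> (if cond_val b \<sigma> then safe W c1 \<sigma> else safe W c2 \<sigma>)"
| "safe W (While b c) \<sigma> \<longleftrightarrow> False"

text \<open>Both branches of an \<open>If\<close> are added instead of taking their maximum: the
  bound stays independent of the state, and only constants suffer.\<close>

fun cost_bound :: "com \<Rightarrow> nat" where
  "cost_bound Skip = 1"
| "cost_bound (Assign x i e) = 1 + expr_cost i + expr_cost e"
| "cost_bound (Seq c1 c2) = cost_bound c1 + cost_bound c2"
| "cost_bound (If b c1 c2) = 1 + cond_cost b + cost_bound c1 + cost_bound c2"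
| "cost_bound (While b c) = 0"

lemma safe_exec: "safe W c \<sigma> \<Longrightarrow> \<exists>t. exec W c \<sigma> t (eff c \<sigma>) \<and> t \<le> cost_bound c"
proof (induction c arbitrary: \<sigma>)
  case (Seq c1 c2)
  then obtain t1 t2 where "exec W c1 \<sigma> t1 (eff c1 \<sigma>)" "t1 \<le> cost_bound c1"
    "exec W c2 (eff c1 \<sigma>) t2 (eff c2 (eff c1 \<sigma>))" "t2 \<le> cost_bound c2"
    by fastforce
  then show ?case
    by (intro exI[of _ "t1 + t2"]) (auto intro: exec.Seq)
next
  case (If b c1 c2)
  show ?case
  proof (cases "cond_val b \<sigma>")
    case True
    with If obtain t where "exec W c1 \<sigma> t (eff c1 \<sigma>)" "t \<le> cost_bound c1" by fastforce
    with If.prems True show ?thesis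
      by (intro exI[of _ "1 + cond_cost b + t"]) (use exec.IfTrue in \<open>force simp del: add_Suc\<close>)
  next
    case False
    with If obtain t where "exec W c2 \<sigma> t (eff c2 \<sigma>)" "t \<le> cost_bound c2" by fastforce
    with If.prems False show ?thesis
      by (intro exI[of _ "1 + cond_cost b + t"]) (use exec.IfFalse in \<open>force simp del: add_Suc\<close>)
  qed
next
  case Skip
  then show ?case using exec.Skip[of W \<sigma>] by auto
next
  case (Assign x i e)
  then show ?case using exec.Assign[of W i \<sigma> e x] by auto
qed auto

lemma While_rule:
  fixes \<Phi> :: "state \<Rightarrow> nat"
  assumes bounded: "bounded_state W \<sigma>0" and init: "I \<sigma>0"
    and fits: "\<And>\<sigma>. I \<sigma> \<Longrightarrow> agree (writes c) \<sigma>0 \<sigma> \<Longrightarrow> bounded_state W \<sigma> \<Longrightarrow> cond_fits W b \<sigma>"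
    and step: "\<And>\<sigma>. I \<sigma> \<Longrightarrow> agree (writes c) \<sigma>0 \<sigma> \<Longrightarrow> bounded_state W \<sigma> \<Longrightarrow> cond_val b \<sigma> \<Longrightarrow>
      \<exists>t \<tau>. exec W c \<sigma> t \<tau> \<and> I \<tau> \<and> 1 + cond_cost b + t + \<Phi> \<tau> \<le> \<Phi> \<sigma>"
  shows "\<exists>t \<tau>. exec W (While b c) \<sigma>0 t \<tau> \<and> I \<tau> \<and> \<not> cond_val b \<tau> \<and>
    t + \<Phi> \<tau> \<le> 1 + cond_cost b + \<Phi> \<sigma>0"
proof -
  have "\<exists>t \<tau>. exec W (While b c) \<sigma> t \<tau> \<and> I \<tau> \<and> \<not> cond_val b \<tau> \<and>
      t + \<Phi> \<tau> \<le> 1 + cond_cost b + \<Phi> \<sigma>"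
    if "I \<sigma>" "agree (writes c) \<sigma>0 \<sigma>" "bounded_state W \<sigma>" for \<sigma>
    using that
  proof (induction "\<Phi> \<sigma>" arbitrary: \<sigma> rule: less_induct)
    case less
    show ?case
    proof (cases "cond_val b \<sigma>")
      case True
      obtain t1 \<sigma>1 where 1: "exec W c \<sigma> t1 \<sigma>1" "I \<sigma>1" "1 + cond_cost b + t1 + \<Phi> \<sigma>1 \<le> \<Phi> \<sigma>"
        using step[OF less.prems True] by blast
      have a: "agree (writes c) \<sigma>0 \<sigma>1"
        using less.prems(2) exec_agree[OF 1(1)] by (rule agree_trans) auto
      have b: "bounded_state W \<sigma>1" using exec_bounded[OF 1(1) less.prems(3)] .
      have "\<Phi> \<sigma>1 < \<Phi> \<sigma>" using 1(3) by linarith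
      then obtain t2 \<tau> where 2: "exec W (While b c) \<sigma>1 t2 \<tau>" "I \<tau>" "\<not> cond_val b \<tau>"
        "t2 + \<Phi> \<tau> \<le> 1 + cond_cost b + \<Phi> \<sigma>1"
        using less.hyps[OF _ 1(2) a b] by blast
      have "exec W (While b c) \<sigma> (1 + cond_cost b + t1 + t2) \<tau>"
        using exec.WhileTrue[OF fits[OF less.prems] True 1(1) 2(1)] .
      moreover have "1 + cond_cost b + t1 + t2 + \<Phi> \<tau> \<le> 1 + cond_cost b + \<Phi> \<sigma>"
        using 1(3) 2(4) by linarith
      ultimately show ?thesis using 2(2,3) by blast
    next
      case False
      then show ?thesis using exec.WhileFalse[OF fits[OF less.prems] False] less.prems(1)
        by blast
    qed
  qed
  from this[OF init agree_refl bounded] show ?thesis .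
qed

abbreviation Var :: "vname \<Rightarrow> expr" where
  "Var x \<equiv> Cell x (Const 0)"

abbreviation Put :: "vname \<Rightarrow> expr \<Rightarrow> com" where
  "Put x e \<equiv> Assign x (Const 0) e"

abbreviation Inc :: "vname \<Rightarrow> com" where
  "Inc x \<equiv> Put x (Bin Plus (Var x) (Const 1))"

definition For :: "vname \<Rightarrow> expr \<Rightarrow> com \<Rightarrow> com" where
  "For i e c = Seq (Put i (Const 0)) (While (Less (Var i) e) (Seq c (Inc i)))"

lemma writes_For [simp]: "writes (For i e c) = insert i (writes c)"
  by (simp add: For_def)

text \<open>\<open>I (Suc k)\<close> is established before the counter is incremented, and
  \<open>I 0\<close> before it is set to 0; \<open>indep\<close> carries the invariant over these
  two assignments. The limit \<open>e\<close> is evaluated anew in every round, so its value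
  \<open>N\<close> has to be known for all \<open>k \<le> N\<close>.\<close>

lemma For_rule:
  fixes B :: "nat \<Rightarrow> nat"
  assumes bounded: "bounded_state W \<sigma>0" and W: "N < W" "1 < W" and i: "i \<notin> writes c"
    and init: "I 0 \<sigma>0"
    and indep: "\<And>k \<sigma> l. I k \<sigma> \<Longrightarrow> I k (store \<sigma> i 0 l)"
    and limit: "\<And>k \<sigma>. k \<le> N \<Longrightarrow> I k \<sigma> \<Longrightarrow> agree (insert i (writes c)) \<sigma>0 \<sigma> \<Longrightarrow> bounded_state W \<sigma> \<Longrightarrow>
      expr_fits W e \<sigma> \<and> expr_val e \<sigma> = N"
    and step: "\<And>k \<sigma>. k < N \<Longrightarrow> I k \<sigma> \<Longrightarrow> \<sigma> i 0 = k \<Longrightarrow> agree (insert i (writes c)) \<sigma>0 \<sigma> \<Longrightarrow>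
      bounded_state W \<sigma> \<Longrightarrow> \<exists>t \<tau>. exec W c \<sigma> t \<tau> \<and> t \<le> B k \<and> I (Suc k) \<tau>"
  shows "\<exists>t \<tau>. exec W (For i e c) \<sigma>0 t \<tau> \<and> I N \<tau> \<and>
    t \<le> (\<Sum>k<N. B k + (expr_cost e + 10)) + (expr_cost e + 10)"
proof -
  define body where "body = Seq c (Inc i)"
  define b where "b = Less (Var i) e"
  \<comment> \<open>The budget of the remaining rounds. A round costs \<open>B k\<close>, plus
    \<open>4 + expr_cost e\<close> for the test and \<open>6\<close> for the increment, whence the
    \<open>10\<close>.\<close>
  define \<Phi> where "\<Phi> \<sigma> = (\<Sum>k\<in>{\<sigma> i 0..<N}. B k + (expr_cost e + 10))" for \<sigma> :: state
  define J where "J \<sigma> \<longleftrightarrow> \<sigma> i 0 \<le> N \<and> I (\<sigma> i 0) \<sigma>" for \<sigma>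
  define \<sigma>1 where "\<sigma>1 = store \<sigma>0 i 0 0"
  have wb: "writes body = insert i (writes c)" by (simp add: body_def)
  have e1: "exec W (Put i (Const 0)) \<sigma>0 3 \<sigma>1"
    using exec.Assign[of W "Const 0" \<sigma>0 "Const 0" i] W by (simp add: \<sigma>1_def numeral_3_eq_3)
  have a1: "agree (writes body) \<sigma>0 \<sigma>1"
    using exec_agree[OF e1] by (rule agree_mono) (simp add: wb)
  have b1: "bounded_state W \<sigma>1" using exec_bounded[OF e1 bounded] .
  have lim: "expr_fits W e \<sigma> \<and> expr_val e \<sigma> = N"
    if "J \<sigma>" "agree (writes body) \<sigma>1 \<sigma>" "bounded_state W \<sigma>" for \<sigma>
    using that limit[of "\<sigma> i 0" \<sigma>] agree_trans[OF a1 that(2)] by (auto simp: J_def wb)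
  have "\<exists>t \<tau>. exec W (While b body) \<sigma>1 t \<tau> \<and> J \<tau> \<and> \<not> cond_val b \<tau> \<and>
    t + \<Phi> \<tau> \<le> 1 + cond_cost b + \<Phi> \<sigma>1"
  proof (rule While_rule)
    show "bounded_state W \<sigma>1" using b1 .
    show "J \<sigma>1" using indep[OF init] by (simp add: J_def \<sigma>1_def store_apply)
  next
    fix \<sigma> assume a: "J \<sigma>" "agree (writes body) \<sigma>1 \<sigma>" "bounded_state W \<sigma>"
    show "cond_fits W b \<sigma>" using lim[OF a] a(3) W by (auto simp: b_def bounded_stateD)
    assume "cond_val b \<sigma>"
    with lim[OF a] have lt: "\<sigma> i 0 < N" by (simp add: b_def)
    have ag: "agree (insert i (writes c)) \<sigma>0 \<sigma>"
      using agree_trans[OF a1 a(2)] wb by blast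
    obtain t \<tau> where t: "exec W c \<sigma> t \<tau>" "t \<le> B (\<sigma> i 0)" "I (Suc (\<sigma> i 0)) \<tau>"
      using step[OF lt _ refl ag a(3)] a(1) by (auto simp: J_def)
    have ti: "\<tau> i = \<sigma> i" using exec_agree[OF t(1)] i by (simp add: agree_def)
    have e: "exec W (Inc i) \<tau> 6 (store \<tau> i 0 (Suc (\<sigma> i 0)))"
      using exec.Assign[of W "Const 0" \<tau> "Bin Plus (Var i) (Const 1)" i] W lt ti by (simp add: eval_nat_numeral)
    have "exec W body \<sigma> (t + 6) (store \<tau> i 0 (Suc (\<sigma> i 0)))"
      unfolding body_def by (rule exec.Seq[OF t(1) e])
    moreover have "J (store \<tau> i 0 (Suc (\<sigma> i 0)))"
      using lt indep[OF t(3)] by (simp add: J_def store_apply)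
    moreover have "{\<sigma> i 0..<N} = insert (\<sigma> i 0) {Suc (\<sigma> i 0)..<N}" using lt by auto
    then have "1 + cond_cost b + (t + 6) + \<Phi> (store \<tau> i 0 (Suc (\<sigma> i 0))) \<le> \<Phi> \<sigma>"
      using t(2) by (simp add: \<Phi>_def store_apply b_def)
    ultimately show "\<exists>t \<tau>. exec W body \<sigma> t \<tau> \<and> J \<tau> \<and> 1 + cond_cost b + t + \<Phi> \<tau> \<le> \<Phi> \<sigma>"
      by blast
  qed
  then obtain t \<tau> where t: "exec W (While b body) \<sigma>1 t \<tau>" "J \<tau>" "\<not> cond_val b \<tau>"
    "t + \<Phi> \<tau> \<le> 1 + cond_cost b + \<Phi> \<sigma>1" by blast
  have "\<tau> i 0 = N"
    using t(2,3) lim[OF t(2)] exec_agree[OF t(1)] exec_bounded[OF t(1) b1]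
    by (auto simp: J_def b_def)
  then have "I N \<tau>" using t(2) by (simp add: J_def)
  moreover have "exec W (For i e c) \<sigma>0 (3 + t) \<tau>"
    using exec.Seq[OF e1 t(1)] by (simp add: For_def b_def body_def)
  moreover have "\<Phi> \<sigma>1 = (\<Sum>k<N. B k + (expr_cost e + 10))"
    by (simp add: \<Phi>_def \<sigma>1_def store_apply atLeast0LessThan)
  then have "3 + t \<le> (\<Sum>k<N. B k + (expr_cost e + 10)) + (expr_cost e + 10)"
    using t(4) by (simp add: b_def)
  ultimately show ?thesis by blast
qed


section \<open>Dominators and reachability avoiding a vertex\<close>

text \<open>False for all \<open>v\<close> if \<open>w = s\<close>.\<close>

definition avoids :: "nat \<Rightarrow> nat rel \<Rightarrow> nat \<Rightarrow> nat \<Rightarrow> bool" where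
  "avoids s E w v \<longleftrightarrow> w \<noteq> s \<and> (s, v) \<in> {e \<in> E. snd e \<noteq> w}\<^sup>*"

lemma avoids_start [simp]: "avoids s E w s \<longleftrightarrow> w \<noteq> s"
  by (simp add: avoids_def)

lemma avoids_step: "avoids s E w x \<Longrightarrow> (x, y) \<in> E \<Longrightarrow> y \<noteq> w \<Longrightarrow> avoids s E w y"
  unfolding avoids_def by (auto intro: rtrancl_into_rtrancl)

lemma avoids_induct [consumes 1, case_names start step]:
  assumes "avoids s E w v"
    and "w \<noteq> s \<Longrightarrow> P s"
    and "\<And>x y. avoids s E w x \<Longrightarrow> P x \<Longrightarrow> (x, y) \<in> E \<Longrightarrow> y \<noteq> w \<Longrightarrow> P y"
  shows "P v"
proof -
  from assms(1) have w: "w \<noteq> s" and "(s, v) \<in> {e \<in> E. snd e \<noteq> w}\<^sup>*"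
    by (auto simp: avoids_def)
  from this(2) show ?thesis
  proof (induction rule: rtrancl_induct)
    case (step x y)
    then show ?case using assms(3)[of x y] w by (simp add: avoids_def)
  qed (use assms(2) w in simp)
qed

lemma avoids_last:
  assumes "avoids s E w v" "v \<noteq> s"
  obtains x where "avoids s E w x" "(x, v) \<in> E" "v \<noteq> w"
  using assms by (induction rule: avoids_induct) auto

lemma avoids_mono: "avoids s E w v \<Longrightarrow> E \<subseteq> E' \<Longrightarrow> avoids s E' w v"
  by (induction rule: avoids_induct) (auto intro: avoids_step)

lemma not_avoids_self [simp]: "\<not> avoids s E w w"
proof
  assume a: "avoids s E w w"
  then have "w \<noteq> s" by (simp add: avoids_def)
  with a show False by (auto elim: avoids_last)
qed

text \<open>A path to \<open>c\<close> that avoids \<open>a\<close> either meets \<open>b\<close>,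
  and then its prefix reaches \<open>b\<close> without \<open>a\<close>, or it avoids
  \<open>b\<close> as well. Read contrapositively, this is transitivity of dominance.\<close>

lemma avoids_split: "avoids s E a c \<Longrightarrow> avoids s E a b \<or> avoids s E b c"
  by (induction rule: avoids_induct) (auto intro: avoids_step)

lemma avoids_fresh:
  assumes "w \<noteq> s" "w \<notin> Range E"
  shows "avoids s E w v \<longleftrightarrow> (s, v) \<in> E\<^sup>*"
proof -
  have "{e \<in> E. snd e \<noteq> w} = E" using assms(2) by (auto simp: Range_iff)
  then show ?thesis using assms(1) by (simp add: avoids_def)
qed

text \<open>Follow a path to \<open>v\<close> and maintain that the current vertex is reached
  without \<open>a\<close> or without \<open>b\<close>. This can only break on entering the very
  vertex that is avoided, and there the last two assumptions switch to the other alternative. As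
  \<open>a \<noteq> b\<close>, one of them holds at \<open>s\<close>.\<close>

lemma reach_induct_avoids:
  assumes "(s, v) \<in> E\<^sup>*" "a \<noteq> b"
    and "\<And>x. avoids s E a x \<Longrightarrow> (x, a) \<in> E \<Longrightarrow> avoids s E b a"
    and "\<And>x. avoids s E b x \<Longrightarrow> (x, b) \<in> E \<Longrightarrow> avoids s E a b"
  shows "avoids s E a v \<or> avoids s E b v"
  using assms(1)
proof (induction rule: rtrancl_induct)
  case base
  show ?case using assms(2) by auto
next
  case (step x y)
  then show ?case using assms(3,4) by (metis avoids_step)
qed

text \<open>If distinct \<open>a\<close> and \<open>b\<close> dominated each other, no path could be
  the first to enter either of them. Formally, the premises of both switching assumptions are
  contradictory.\<close>

lemma dominators_antisym:
  assumes "(s, b) \<in> E\<^sup>*" "\<not> avoids s E a b" "\<not> avoids s E b a"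
  shows "a = b"
proof (rule ccontr)
  assume ne: "a \<noteq> b"
  have "avoids s E b a" if "avoids s E a x" "(x, a) \<in> E" for x
    using that assms(2) ne by (metis avoids_split avoids_step)
  moreover have "avoids s E a b" if "avoids s E b x" "(x, b) \<in> E" for x
    using that assms(3) ne by (metis avoids_split avoids_step)
  ultimately have "avoids s E a b \<or> avoids s E b b"
    using reach_induct_avoids[OF assms(1) ne] by blast
  with assms(2) show False by simp
qed

text \<open>If neither dominates the other, then on entering one of them one switches to a path to
  it that avoids the other, and arrives at \<open>v\<close> without one of the two. This chain
  property gives the deepest dominator its meaning.\<close>

lemma dominators_chain:
  assumes "(s, v) \<in> E\<^sup>*" "\<not> avoids s E a v" "\<not> avoids s E b v"
  shows "\<not> avoids s E a b \<or> \<not> avoids s E b a"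
proof (rule ccontr)
  assume "\<not> ?thesis"
  then have "avoids s E a b" "avoids s E b a" by auto
  moreover from this have "a \<noteq> b" by auto
  ultimately have "avoids s E a v \<or> avoids s E b v"
    using reach_induct_avoids[OF assms(1)] by blast
  with assms(2,3) show False by simp
qed

text \<open>Since \<open>avoids\<close> also requires \<open>u\<close> to be reachable and
  \<open>v \<noteq> s\<close>, edges with an unreachable tail, edges into the start and loops drop
  out as well.\<close>

definition forward_edges :: "nat \<Rightarrow> nat rel \<Rightarrow> nat rel" where
  "forward_edges s E = {(u, v) \<in> E. avoids s E v u}"

text \<open>If \<open>(x, y)\<close> is not forward in \<open>E0\<close>, then \<open>y\<close>
  dominates \<open>x\<close> there and in every subgraph, so by \<open>avoids_split\<close> whoever
  has reached \<open>x\<close> without \<open>w\<close> has been at \<open>y\<close> already. As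
  \<open>E\<close> is any subset of \<open>E0\<close>, the classification never has to be
  revised.\<close>

lemma avoids_forward_edges:
  assumes "E \<subseteq> E0"
  shows "avoids s (E \<inter> forward_edges s E0) w v \<longleftrightarrow> avoids s E w v"
proof
  assume "avoids s E w v"
  then show "avoids s (E \<inter> forward_edges s E0) w v"
  proof (induction rule: avoids_induct)
    case (step x y)
    show ?case
    proof (cases "avoids s E0 y x")
      case True
      with step assms show ?thesis
        by (auto simp: forward_edges_def intro: avoids_step)
    next
      case False
      then have "\<not> avoids s (E \<inter> forward_edges s E0) y x"
        using assms avoids_mono[of s "E \<inter> forward_edges s E0" y x E0] by blast
      with step.IH show ?thesis using avoids_split by blast
    qed
  qed simp
qed (blast intro: avoids_mono)

lemma forward_edges_no_start: "(u, s) \<notin> forward_edges s E"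
  by (simp add: forward_edges_def avoids_def)

text \<open>\<open>p\<close> is the immediate dominator of \<open>v\<close> as far as competitors in \<open>S\<close> are concerned.\<close>

definition idom :: "nat \<Rightarrow> nat rel \<Rightarrow> nat set \<Rightarrow> nat \<Rightarrow> nat \<Rightarrow> bool" where
  "idom s E S p v \<longleftrightarrow> p \<noteq> v \<and> \<not> avoids s E p v \<and>
     (\<forall>w\<in>S. w \<noteq> v \<and> \<not> avoids s E w v \<longrightarrow> \<not> avoids s E w p)"

text \<open>Both \<open>p\<close> and \<open>w\<close> dominate \<open>v\<close>, hence they are
  comparable. If \<open>p\<close> does not dominate \<open>w\<close>, then \<open>w\<close>
  dominates \<open>p\<close> and \<open>p\<close> stays. Otherwise whatever dominates
  \<open>p\<close> dominates \<open>w\<close> by transitivity. The single query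
  \<open>avoids s E p w\<close> decides.\<close>

lemma idom_insert:
  assumes p: "idom s E S p v" and v: "(s, v) \<in> E\<^sup>*" and w: "w \<noteq> v" "\<not> avoids s E w v"
  shows "idom s E (insert w S) (if avoids s E p w then p else w) v"
proof (cases "avoids s E p w")
  case True
  then have "\<not> avoids s E w p"
    using dominators_chain[OF v w(2), of p] p by (auto simp: idom_def)
  with p True show ?thesis by (auto simp: idom_def)
next
  case False
  have "\<not> avoids s E u w" if "u \<in> S" "u \<noteq> v" "\<not> avoids s E u v" for u
    using that p False avoids_split[of s E u w p] by (auto simp: idom_def)
  with False w show ?thesis by (auto simp: idom_def)
qed

text \<open>Deletions preserve dominance, so the old parent still wins against the old dominators of
  \<open>v\<close>. Competitors that become dominators only through the deletion are excluded from
  \<open>S'\<close> and have to be inserted one by one.\<close>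

lemma idom_antimono:
  "idom s E S p v \<Longrightarrow> E' \<subseteq> E \<Longrightarrow> S' \<subseteq> S \<inter> {w. w = v \<or> \<not> avoids s E w v} \<Longrightarrow> idom s E' S' p v"
  unfolding idom_def using avoids_mono by blast

lemma idom_start: "v \<noteq> s \<Longrightarrow> idom s E {} s v"
  by (simp add: idom_def avoids_def)

lemma idom_skip: "idom s E S p v \<Longrightarrow> w = v \<or> avoids s E w v \<Longrightarrow> idom s E (insert w S) p v"
  by (auto simp: idom_def)

text \<open>The bridge from walks of the graph library to a relation closed under single edges. The
  degenerate cases agree: both sides hold for all \<open>w\<close> if \<open>v\<close> is
  unreachable, and for all \<open>v\<close> if \<open>w = s\<close>.\<close>

lemma dominates_iff_avoids:
  assumes "flow_graph G s"
  shows "dominates G s w v \<longleftrightarrow> \<not> avoids s (parcs G) w v"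
proof -
  interpret flow_graph G s by fact
  have 1: "avoids s (parcs G) w v" if "awalk s p v" "w \<notin> set (awalk_verts s p)" for p
    using that
  proof (induction p arbitrary: v rule: rev_induct)
    case Nil
    then show ?case by (auto simp: awalk_Nil_iff)
  next
    case (snoc e p)
    then obtain x where x: "awalk s p x" "e = (x, v)" "e \<in> parcs G"
      by (cases e) (auto simp: awalk_append_iff awalk_Cons_iff awalk_Nil_iff)
    then have "w \<notin> set (awalk_verts s p)" "v \<noteq> w"
      using snoc.prems by (auto simp: awalk_verts_append awalk_Cons_iff)
    with snoc.IH[OF x(1)] x show ?case by (auto intro: avoids_step)
  qed
  have 2: "\<exists>p. awalk s p v \<and> w \<notin> set (awalk_verts s p)" if "avoids s (parcs G) w v"
    using that
  proof (induction rule: avoids_induct)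
    case start
    then show ?case using start_in_verts by (intro exI[of _ "[]"]) (auto simp: awalk_Nil_iff)
  next
    case (step x y)
    then obtain p where p: "awalk s p x" "w \<notin> set (awalk_verts s p)" by blast
    have a: "awalk x [(x, y)] y" using step.hyps by (simp add: awalk_Cons_iff awalk_Nil_iff in_arcsD2)
    have "awalk s (p @ [(x, y)]) y" using awalk_appendI[OF p(1) a] .
    moreover have "w \<notin> set (awalk_verts s (p @ [(x, y)]))"
      using p step.hyps awalk_verts_append[OF calculation] a by auto
    ultimately show ?case by blast
  qed
  show ?thesis unfolding dominates_def awalk_verts_with_proj_eq using 1 2 by blast
qed

text \<open>A cycle of forward edges would lie in a strong component whose entry \<open>v\<close>
  dominates all of it, in particular a predecessor \<open>u\<close> of \<open>v\<close> inside the
  component. But then \<open>(u, v)\<close> is not forward.\<close>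

lemma acyclic_forward_edges:
  assumes G: "flow_graph G s" and red: "reducible G s"
  shows "acyclic (forward_edges s (parcs G))"
proof (rule acyclicI, rule allI, rule notI)
  interpret flow_graph G s by fact
  define F where "F = forward_edges s (parcs G)"
  fix x assume "(x, x) \<in> (forward_edges s (parcs G))\<^sup>+"
  then have x: "(x, x) \<in> F\<^sup>+" by (simp add: F_def)
  \<comment> \<open>The strong component of \<open>x\<close> with respect to \<open>F\<close>. The
    arcs of \<open>S\<close> are the forward edges inside \<open>C\<close>, so strong connectivity
    needs paths that never leave \<open>C\<close>.\<close>
  define C where "C = {y. (x, y) \<in> F\<^sup>* \<and> (y, x) \<in> F\<^sup>*}"
  define S where "S = \<lparr>verts = C, arcs = F \<inter> C \<times> C, tail = fst, head = snd\<rparr>"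
  have F: "F \<subseteq> parcs G" by (auto simp: F_def forward_edges_def)
  \<comment> \<open>\<open>x\<close> lies on a cycle, so even a component with a single vertex has
    an incoming edge from itself.\<close>
  have pred: "\<exists>u\<in>C. (u, v) \<in> F" if "v \<in> C" for v
  proof -
    have "(v, v) \<in> F\<^sup>+" using that x unfolding C_def
      by (metis (mono_tags, lifting) mem_Collect_eq rtrancl_trancl_trancl trancl_rtrancl_trancl)
    then obtain u where "(v, u) \<in> F\<^sup>*" "(u, v) \<in> F" by (meson tranclD2)
    then show ?thesis using that unfolding C_def
      by (intro bexI[of _ u]) (auto intro: rtrancl_trans converse_rtrancl_into_rtrancl)
  qed
  have CV: "C \<subseteq> pverts G"
  proof
    fix v assume "v \<in> C"
    with pred F obtain u where "(u, v) \<in> parcs G" by blast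
    then show "v \<in> pverts G" by (auto dest: in_arcsD2)
  qed
  have to: "(a, b) \<in> (F \<inter> C \<times> C)\<^sup>*" if "(a, b) \<in> F\<^sup>*" "a \<in> C" "(b, x) \<in> F\<^sup>*" for a b
    using that
  proof (induction rule: rtrancl_induct)
    case (step y z)
    have yx: "(y, x) \<in> F\<^sup>*" using step.hyps(2) step.prems(2) by (rule converse_rtrancl_into_rtrancl)
    have xy: "(x, y) \<in> F\<^sup>*" using step.hyps(1) step.prems(1) unfolding C_def
      by (metis (mono_tags, lifting) mem_Collect_eq rtrancl_trans)
    then have "(x, z) \<in> F\<^sup>*" using step.hyps(2) by (rule rtrancl_into_rtrancl)
    with yx xy step.hyps(2) step.prems(2) have "(y, z) \<in> F \<inter> C \<times> C" by (simp add: C_def)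
    with step.IH[OF step.prems(1) yx] show ?case by (rule rtrancl_into_rtrancl)
  qed simp
  interpret S: wf_digraph S by unfold_locales (auto simp: S_def)
  have arcs: "arcs_ends S = F \<inter> C \<times> C"
    unfolding S_def arcs_ends_def arc_to_ends_def by simp
  have sub: "subgraph S (with_proj G)"
  proof (rule subgraphI)
    show "wf_digraph S" by (rule S.wf_digraph_axioms)
    show "wf_digraph (with_proj G)" by (rule wf_digraph_axioms)
  qed (use CV F in \<open>auto simp: S_def compatible_def\<close>)
  have reach: "a \<rightarrow>\<^sup>*\<^bsub>S\<^esub> b" if "(a, b) \<in> (F \<inter> C \<times> C)\<^sup>*" "a \<in> C" for a b
    using that
  proof (induction rule: rtrancl_induct)
    case base
    then show ?case using S.reachable_refl by (simp add: S_def)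
  next
    case (step y z)
    then show ?case using S.reachable_adj_trans[of a y z] arcs by simp
  qed
  have sc: "strongly_connected S"
    unfolding strongly_connected_def
  proof (intro conjI ballI)
    have "x \<in> C" by (simp add: C_def)
    then show "verts S \<noteq> {}" by (auto simp: S_def)
    fix a b assume "a \<in> verts S" "b \<in> verts S"
    then have ab: "a \<in> C" "b \<in> C" by (simp_all add: S_def)
    then have "(a, b) \<in> F\<^sup>*" "(b, x) \<in> F\<^sup>*" unfolding C_def by (auto intro: rtrancl_trans)
    with to ab have "(a, b) \<in> (F \<inter> C \<times> C)\<^sup>*" by blast
    then show "a \<rightarrow>\<^sup>*\<^bsub>S\<^esub> b" using reach ab by blast
  qed
  have "\<exists>v\<in>verts S. \<forall>u\<in>verts S. dominates G s v u"
    using red sub sc unfolding reducible_def dominates_def by blast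
  then obtain v where v: "v \<in> C" "\<forall>u\<in>C. dominates G s v u" by (auto simp: S_def)
  obtain u where u: "u \<in> C" "(u, v) \<in> F" using pred v(1) by blast
  then have "dominates G s v u" using v(2) by blast
  with u(2) show False
    using dominates_iff_avoids[OF G] by (simp add: F_def forward_edges_def)
qed


section \<open>A work list over pairs of vertices\<close>

text \<open>An entry \<open>(w, x)\<close> says that the status of \<open>x\<close> in the copy \<open>G - w\<close> has changed.\<close>

definition queue :: "state \<Rightarrow> (nat \<times> nat) list" where
  "queue \<sigma> = map (\<lambda>i. (\<sigma> ''qw'' i, \<sigma> ''qx'' i)) [0..<\<sigma> ''t'' 0]"

definition push :: com where
  "push = Seq (Assign ''qw'' (Var ''t'') (Var ''w'')) (Seq (Assign ''qx'' (Var ''t'') (Var ''y'')) (Inc ''t''))"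

abbreviation index :: "expr \<Rightarrow> expr \<Rightarrow> expr" where
  "index a b \<equiv> Bin Plus (Bin Times a (Var ''n'')) b"

text \<open>Entries are never removed: only the head index \<open>h\<close> advances. After the run
  the arrays still list every entry, and the update program reads them back as its list of
  events.\<close>

definition worklist :: "com \<Rightarrow> com" where
  "worklist body =
     Seq (Put ''h'' (Const 0))
       (While (Less (Var ''h'') (Var ''t''))
         (Seq (Seq (Put ''w'' (Cell ''qw'' (Var ''h'')))
              (Seq (Put ''x'' (Cell ''qx'' (Var ''h''))) (Inc ''h'')))
           (For ''j'' (Cell ''deg'' (Var ''x''))
             (Seq (Put ''y'' (Cell ''adj'' (Bin Plus (Bin Times (Var ''x'') (Var ''m'')) (Var ''j''))))
               body))))"

lemma length_queue [simp]: "length (queue \<sigma>) = \<sigma> ''t'' 0"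
  by (simp add: queue_def)

lemma nth_queue: "i < \<sigma> ''t'' 0 \<Longrightarrow> queue \<sigma> ! i = (\<sigma> ''qw'' i, \<sigma> ''qx'' i)"
  by (simp add: queue_def)

lemma queue_agree: "agree X \<sigma> \<tau> \<Longrightarrow> X \<inter> {''qw'', ''qx'', ''t''} = {} \<Longrightarrow> queue \<tau> = queue \<sigma>"
  by (auto simp: agree_def queue_def)

lemma queue_push: "queue (eff push \<sigma>) = queue \<sigma> @ [(\<sigma> ''w'' 0, \<sigma> ''y'' 0)]"
  by (simp add: queue_def push_def store_apply)

lemma writes_push [simp]: "writes push = {''qw'', ''qx'', ''t''}"
  by (auto simp: push_def)

lemma agree_push: "agree {''qw'', ''qx'', ''t''} \<sigma> (eff push \<sigma>)"
  by (simp add: push_def agree_def store_apply)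

lemma safe_push: "bounded_state W \<sigma> \<Longrightarrow> \<sigma> ''t'' 0 + 1 < W \<Longrightarrow> safe W push \<sigma>"
  by (simp add: push_def store_apply bounded_stateD)

lemma pair_code_inj:
  fixes u v u' v' n :: nat
  assumes "v < n" "v' < n"
  shows "u * n + v = u' * n + v' \<longleftrightarrow> u = u' \<and> v = v'"
proof
  assume a: "u * n + v = u' * n + v'"
  have "(u * n + v) div n = u" "(u' * n + v') div n = u'" using assms by auto
  then show "u = u' \<and> v = v'" using a by auto
qed simp

text \<open>What is kept of reducibility is \<open>forward_acyclic\<close>. The list
  \<open>as\<close> is the initial edge set and stays fixed under deletions. The bound
  \<open>word\<close> covers all addresses: matrix cells \<open>u * n + v\<close> with
  \<open>u \<le> n\<close>, adjacency cells \<open>u * m + j\<close>, and the queue length, at most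
  \<open>(n + 1) * n\<close>.\<close>

locale problem =
  fixes n m s W :: nat and as :: "(nat \<times> nat) list"
  assumes start: "s < n" and len: "length as = m"
    and edges: "set as \<subseteq> {..<n} \<times> {..<n}" and dist: "distinct as"
    and forward_acyclic: "acyclic (forward_edges s (set as))"
    and word: "(n + 2) * (n + m + 2) < W"
begin

lemma fits [simp]:
  "1 < W" "n < W" "m < W"
  "u \<le> n \<Longrightarrow> v \<le> n \<Longrightarrow> u * n + v < W"
  "u \<le> n \<Longrightarrow> u * n < W"
  "u \<le> n \<Longrightarrow> j \<le> m \<Longrightarrow> u * m + j < W"
  "u \<le> n \<Longrightarrow> u * m < W"
  "n + 1 < W" "(n + 1) * n + 1 < W"
proof -
  have w: "n * n + n * m + 4 * n + 2 * m + 4 < W"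
    using word by (simp add: algebra_simps)
  show "1 < W" "n < W" "m < W" "n + 1 < W" "(n + 1) * n + 1 < W" using w by simp_all
  have 1: "u * n \<le> n * n" "u * m \<le> n * m" if "u \<le> n"
    using that by simp_all
  show "u * n + v < W" if "u \<le> n" "v \<le> n" using w 1(1)[OF that(1)] that(2) by linarith
  show "u * n < W" if "u \<le> n" using w 1(1)[OF that] by linarith
  show "u * m + j < W" if "u \<le> n" "j \<le> m" using w 1(2)[OF that(1)] that(2) by linarith
  show "u * m < W" if "u \<le> n" using w 1(2)[OF that] by linarith
qed

lemma fits_Suc [simp]: "0 < W" "Suc 0 < W" "Suc n < W"
  using fits(1,8) by simp_all

text \<open>The adjacency lists are those of the initial graph with all its edges. Deleted and
  non-forward edges are skipped when a list is scanned, which the amortised bound allows.\<close>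

definition adj_list :: "nat \<Rightarrow> nat list" where
  "adj_list u = map snd (filter (\<lambda>e. fst e = u) as)"

lemma set_adj_list: "set (adj_list u) = {v. (u, v) \<in> set as}"
  by (force simp: adj_list_def)

lemma distinct_adj_list: "distinct (adj_list u)"
  using dist by (auto simp: adj_list_def distinct_map inj_on_def)

lemma length_adj_list: "length (adj_list u) \<le> m"
  using length_filter_le[of "\<lambda>e. fst e = u" as] by (simp add: adj_list_def len)

definition layout :: "state \<Rightarrow> bool" where
  "layout \<sigma> \<longleftrightarrow> \<sigma> ''n'' 0 = n \<and> \<sigma> ''m'' 0 = m \<and> \<sigma> ''s'' 0 = s \<and>
     (\<forall>u<n. \<sigma> ''deg'' u = length (adj_list u) \<and>
       (\<forall>j<length (adj_list u). \<sigma> ''adj'' (u * m + j) = adj_list u ! j))"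

lemma layout_agree:
  "layout \<sigma> \<Longrightarrow> agree X \<sigma> \<tau> \<Longrightarrow> X \<inter> {''n'', ''m'', ''s'', ''deg'', ''adj''} = {} \<Longrightarrow> layout \<tau>"
  by (auto simp: agree_def layout_def)

text \<open>A token \<open>(w, x, y)\<close> stands for the edge \<open>(x, y)\<close> in the copy \<open>G - w\<close>.\<close>

definition tokens :: "(nat \<times> nat) set \<Rightarrow> (nat \<times> nat \<times> nat) set" where
  "tokens Q = {(w, x, y). (w, x) \<in> Q \<and> y \<in> set (adj_list x)}"

lemma tokens_empty [simp]: "tokens {} = {}"
  by (simp add: tokens_def)

text \<open>Upper bounds with some slack: \<open>60\<close> pays for popping an entry and setting up
  the inner loop, \<open>B + 40\<close> for one outgoing edge when the body costs
  \<open>B\<close>.\<close>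

definition weight :: "nat \<Rightarrow> nat \<times> nat \<Rightarrow> nat" where
  "weight B p = 60 + (B + 40) * length (adj_list (snd p))"

text \<open>The argument of \<open>Inv\<close> collects the processed tokens; on exit every outgoing
  edge of every queued entry has been handled. \<open>U\<close> is an a priori bound that ensures
  termination, whereas the time is charged to the entries really queued. This distinction is what
  permits amortisation over many runs.\<close>

lemma worklist_rule:
  fixes Inv :: "(nat \<times> nat \<times> nat) set \<Rightarrow> state \<Rightarrow> bool"
  defines "L \<equiv> {''h'', ''j'', ''w'', ''x'', ''y''}"
  assumes wr: "writes body \<inter> ({''n'', ''m'', ''s'', ''deg'', ''adj''} \<union> L) = {}"
    and U: "U \<subseteq> {..n} \<times> {..<n}"
    and \<sigma>0: "bounded_state W \<sigma>0" "layout \<sigma>0" "Inv {} \<sigma>0"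
    and Inv_queue: "\<And>D \<sigma>. Inv D \<sigma> \<Longrightarrow> distinct (queue \<sigma>) \<and> set (queue \<sigma>) \<subseteq> U"
    and Inv_agree: "\<And>D \<sigma> \<tau>. Inv D \<sigma> \<Longrightarrow> agree L \<sigma> \<tau> \<Longrightarrow> Inv D \<tau>"
    and body: "\<And>D \<sigma> w x y. Inv D \<sigma> \<Longrightarrow> bounded_state W \<sigma> \<Longrightarrow> layout \<sigma> \<Longrightarrow>
        agree (L \<union> writes body) \<sigma>0 \<sigma> \<Longrightarrow> (w, x) \<in> set (queue \<sigma>) \<Longrightarrow> (x, y) \<in> set as \<Longrightarrow>
        (w, x, y) \<notin> D \<Longrightarrow> \<sigma> ''w'' 0 = w \<Longrightarrow> \<sigma> ''x'' 0 = x \<Longrightarrow> \<sigma> ''y'' 0 = y \<Longrightarrow>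
        \<exists>t \<tau> r. exec W body \<sigma> t \<tau> \<and> t \<le> B \<and> queue \<tau> = queue \<sigma> @ r \<and> Inv (insert (w, x, y) D) \<tau>"
  shows "\<exists>t \<tau>. exec W (worklist body) \<sigma>0 t \<tau> \<and> Inv (tokens (set (queue \<tau>))) \<tau> \<and>
    t \<le> 9 + (\<Sum>p\<in>set (queue \<tau>). weight B p)"
proof -
  define inner where "inner = Seq (Put ''y'' (Cell ''adj''
    (Bin Plus (Bin Times (Var ''x'') (Var ''m'')) (Var ''j'')))) body"
  define pop where "pop = Seq (Put ''w'' (Cell ''qw'' (Var ''h'')))
    (Seq (Put ''x'' (Cell ''qx'' (Var ''h''))) (Inc ''h''))"
  define outer where "outer = Seq pop (For ''j'' (Cell ''deg'' (Var ''x'')) inner)"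
  define b where "b = Less (Var ''h'') (Var ''t'')"
  define finished where "finished \<sigma> = set (take (\<sigma> ''h'' 0) (queue \<sigma>))" for \<sigma>
  define I where "I \<sigma> \<longleftrightarrow> \<sigma> ''h'' 0 \<le> \<sigma> ''t'' 0 \<and> layout \<sigma> \<and> Inv (tokens (finished \<sigma>)) \<sigma>" for \<sigma>
  \<comment> \<open>The credit of all pairs not yet processed, including those that will never be
    queued; their share is left over at the end and cancels.\<close>
  define \<Phi> where "\<Phi> \<sigma> = sum (weight B) (U - finished \<sigma>)" for \<sigma>
  define \<sigma>1 where "\<sigma>1 = store \<sigma>0 ''h'' 0 0"
  have finU: "finite U" using U by (rule finite_subset) simp
  have wi: "writes inner = insert ''y'' (writes body)" by (simp add: inner_def)
  have wo: "writes outer = L \<union> writes body"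
    by (auto simp: outer_def pop_def wi L_def)
  have frame: "''h'' \<notin> writes body" "''j'' \<notin> writes body" "''w'' \<notin> writes body"
    "''x'' \<notin> writes body" "''y'' \<notin> writes body" "''n'' \<notin> writes body" "''m'' \<notin> writes body"
    "''s'' \<notin> writes body" "''deg'' \<notin> writes body" "''adj'' \<notin> writes body"
    using wr by (auto simp: L_def)
  have e1: "exec W (Put ''h'' (Const 0)) \<sigma>0 3 \<sigma>1"
    using exec.Assign[of W "Const 0" \<sigma>0 "Const 0" "''h''"] fits(1)
    by (simp add: \<sigma>1_def eval_nat_numeral)
  have a1: "agree {''h''} \<sigma>0 \<sigma>1" using exec_agree[OF e1] by simp
  have b1: "bounded_state W \<sigma>1" using exec_bounded[OF e1 \<sigma>0(1)] .
  have "\<exists>t \<tau>. exec W (While b outer) \<sigma>1 t \<tau> \<and> I \<tau> \<and> \<not> cond_val b \<tau> \<and>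
    t + \<Phi> \<tau> \<le> 1 + cond_cost b + \<Phi> \<sigma>1"
  proof (rule While_rule)
    show "bounded_state W \<sigma>1" using b1 .
    have "layout \<sigma>1" using \<sigma>0(2) a1 by (rule layout_agree) simp
    moreover have "Inv {} \<sigma>1" using \<sigma>0(3) agree_mono[OF a1] Inv_agree by (simp add: L_def)
    ultimately show "I \<sigma>1" by (simp add: I_def finished_def \<sigma>1_def store_apply)
  next
    fix \<sigma> assume I: "I \<sigma>" and ag: "agree (writes outer) \<sigma>1 \<sigma>" and bd: "bounded_state W \<sigma>"
    show "cond_fits W b \<sigma>" using bd fits(1) by (simp add: b_def bounded_stateD)
    assume "cond_val b \<sigma>"
    then have ht: "\<sigma> ''h'' 0 < \<sigma> ''t'' 0" by (simp add: b_def)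
    define k where "k = \<sigma> ''h'' 0"
    define w where "w = \<sigma> ''qw'' k"
    define x where "x = \<sigma> ''qx'' k"
    define \<sigma>2 where "\<sigma>2 = eff pop \<sigma>"
    have q: "distinct (queue \<sigma>)" "set (queue \<sigma>) \<subseteq> U" using I Inv_queue by (auto simp: I_def)
    have wx: "queue \<sigma> ! k = (w, x)" using ht by (simp add: nth_queue w_def x_def k_def)
    then have wxq: "(w, x) \<in> set (queue \<sigma>)" using ht k_def by (metis length_queue nth_mem)
    then have wxU: "w \<le> n" "x < n" "(w, x) \<in> U" using q(2) U by auto
    have "Suc (\<sigma> ''h'' 0) < W" using ht bd bounded_stateD[OF bd, of "''t''" 0] by simp
    then have "safe W pop \<sigma>"
      using bd by (simp add: pop_def store_apply bounded_stateD)
    then obtain tp where tp: "exec W pop \<sigma> tp \<sigma>2" "tp \<le> cost_bound pop"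
      using safe_exec \<sigma>2_def by blast
    have s2: "\<sigma>2 ''w'' 0 = w" "\<sigma>2 ''x'' 0 = x" "\<sigma>2 ''h'' 0 = Suc k"
      by (simp_all add: \<sigma>2_def pop_def store_apply w_def x_def k_def)
    have a2: "agree {''w'', ''x'', ''h''} \<sigma> \<sigma>2"
      by (simp add: \<sigma>2_def pop_def store_apply agree_def)
    have q2: "queue \<sigma>2 = queue \<sigma>" using a2 by (rule queue_agree) simp
    have bd2: "bounded_state W \<sigma>2" using exec_bounded[OF tp(1) bd] .
    define D where "D j = tokens (finished \<sigma>) \<union> {(w, x, y) |y. y \<in> set (take j (adj_list x))}" for j
    define J where "J j \<tau> \<longleftrightarrow> layout \<tau> \<and> \<tau> ''w'' 0 = w \<and> \<tau> ''x'' 0 = x \<and>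
      (\<exists>r. queue \<tau> = queue \<sigma> @ r) \<and> Inv (D j) \<tau>" for j \<tau>
    \<comment> \<open>The queue has no repetitions, so the popped entry was not processed before:
      its tokens are new and its weight is still contained in
      \<open>\<Phi> \<sigma>\<close>.\<close>
    have fresh: "(w, x) \<notin> finished \<sigma>"
    proof
      assume "(w, x) \<in> finished \<sigma>"
      then obtain i where "i < k" "queue \<sigma> ! i = (w, x)"
        by (auto simp: finished_def in_set_conv_nth k_def)
      with wx ht show False using nth_eq_iff_index_eq[OF q(1), of i k] by (simp add: k_def)
    qed
    have "\<exists>t \<tau>. exec W (For ''j'' (Cell ''deg'' (Var ''x'')) inner) \<sigma>2 t \<tau> \<and>
        J (length (adj_list x)) \<tau> \<and>
        t \<le> (\<Sum>j<length (adj_list x). (B + 20) + (expr_cost (Cell ''deg'' (Var ''x'')) + 10)) +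
          (expr_cost (Cell ''deg'' (Var ''x'')) + 10)"
    proof (rule For_rule[where I = J])
      show "bounded_state W \<sigma>2" "1 < W" using bd2 by simp_all
      show "length (adj_list x) < W" using length_adj_list[of x] fits(3) by linarith
      show "''j'' \<notin> writes inner" using frame by (simp add: wi)
      have "layout \<sigma>2" using I by (intro layout_agree[OF _ a2]) (auto simp: I_def)
      moreover have "Inv (D 0) \<sigma>2"
        using I by (intro Inv_agree[OF _ agree_mono[OF a2]]) (auto simp: I_def D_def L_def)
      ultimately show "J 0 \<sigma>2" using s2 q2 by (simp add: J_def)
    next
      fix j \<tau> l assume "J j \<tau>"
      moreover have aj: "agree {''j''} \<tau> (store \<tau> ''j'' 0 l)" by (simp add: agree_def store_apply)
      then have "queue (store \<tau> ''j'' 0 l) = queue \<tau>" by (rule queue_agree) simp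
      ultimately show "J j (store \<tau> ''j'' 0 l)"
        using layout_agree[OF _ aj] Inv_agree[OF _ agree_mono[OF aj]]
        by (auto simp: J_def L_def store_apply)
    next
      fix j \<tau> assume "J j \<tau>" "bounded_state W \<tau>"
      then show "expr_fits W (Cell ''deg'' (Var ''x'')) \<tau> \<and>
          expr_val (Cell ''deg'' (Var ''x'')) \<tau> = length (adj_list x)"
        using wxU le_less_trans[OF length_adj_list[of x] fits(3)]
        by (auto simp: J_def layout_def bounded_stateD)
    next
      fix j \<tau> assume j: "j < length (adj_list x)" "J j \<tau>" "\<tau> ''j'' 0 = j"
        and agt: "agree (insert ''j'' (writes inner)) \<sigma>2 \<tau>" and bdt: "bounded_state W \<tau>"
      define y where "y = adj_list x ! j"
      define \<tau>1 where "\<tau>1 = store \<tau> ''y'' 0 y"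
      have jm: "j \<le> m" using j(1) length_adj_list[of x] by simp
      have ly: "\<tau> ''m'' 0 = m" "\<tau> ''adj'' (x * m + j) = y" "layout \<tau>" "\<tau> ''w'' 0 = w" "\<tau> ''x'' 0 = x"
        using j wxU by (auto simp: J_def layout_def y_def)
      have ltW: "x < W" "j < W" "y < W"
        using bounded_stateD[OF bdt, of "''x''" 0] bounded_stateD[OF bdt, of "''j''" 0]
          bounded_stateD[OF bdt, of "''adj''" "x * m + j"] ly j(3) by simp_all
      have "exec W (Put ''y'' (Cell ''adj'' (Bin Plus (Bin Times (Var ''x'') (Var ''m'')) (Var ''j''))))
          \<tau> 11 \<tau>1"
        using exec.Assign[of W "Const 0" \<tau>
            "Cell ''adj'' (Bin Plus (Bin Times (Var ''x'') (Var ''m'')) (Var ''j''))" "''y''"]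
          ly j(3) jm wxU ltW
        by (simp add: \<tau>1_def eval_nat_numeral)
      note ey = this
      have ay: "agree {''y''} \<tau> \<tau>1" by (simp add: \<tau>1_def agree_def store_apply)
      have qy: "queue \<tau>1 = queue \<tau>" using ay by (rule queue_agree) simp
      have bdy: "bounded_state W \<tau>1" using exec_bounded[OF ey bdt] .
      have Dy: "(w, x, y) \<notin> D j"
      proof -
        have "y \<notin> set (take j (adj_list x))"
          using j(1) distinct_adj_list[of x] nth_eq_iff_index_eq[of "adj_list x"]
          by (auto simp: y_def in_set_conv_nth)
        then show ?thesis using fresh by (auto simp: D_def tokens_def)
      qed
      have "\<exists>t \<tau>' r. exec W body \<tau>1 t \<tau>' \<and> t \<le> B \<and> queue \<tau>' = queue \<tau>1 @ r \<and>
          Inv (insert (w, x, y) (D j)) \<tau>'"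
      proof (rule body)
        show "Inv (D j) \<tau>1" using j(2) Inv_agree[OF _ agree_mono[OF ay]] by (auto simp: J_def L_def)
        show "bounded_state W \<tau>1" using bdy .
        show "layout \<tau>1" using ly(3) ay by (rule layout_agree) simp
        have "agree (L \<union> writes body) \<sigma>0 \<sigma>"
          using a1 ag by (rule agree_trans) (auto simp: wo L_def)
        then have "agree (L \<union> writes body) \<sigma>0 \<sigma>2"
          using a2 by (rule agree_trans) (auto simp: L_def)
        then have "agree (L \<union> writes body) \<sigma>0 \<tau>"
          using agt by (rule agree_trans) (auto simp: L_def wi)
        then show "agree (L \<union> writes body) \<sigma>0 \<tau>1"
          using ay by (rule agree_trans) (auto simp: L_def)
        show "(w, x) \<in> set (queue \<tau>1)" using j(2) wxq qy by (auto simp: J_def)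
        have "y \<in> set (adj_list x)" using j(1) by (simp add: y_def)
        then show "(x, y) \<in> set as" by (simp add: set_adj_list)
        show "(w, x, y) \<notin> D j" using Dy .
      qed (simp_all add: \<tau>1_def store_apply ly)
      then obtain t \<tau>' r where t: "exec W body \<tau>1 t \<tau>'" "t \<le> B" "queue \<tau>' = queue \<tau>1 @ r"
        "Inv (insert (w, x, y) (D j)) \<tau>'" by blast
      have "layout \<tau>1" using ly(3) ay by (rule layout_agree) simp
      then have "layout \<tau>'" using exec_agree[OF t(1)] by (rule layout_agree) (use wr in auto)
      moreover have "insert (w, x, y) (D j) = D (Suc j)"
        using j(1) by (auto simp: D_def y_def take_Suc_conv_app_nth)
      moreover have "\<tau>' ''w'' = \<tau> ''w''" "\<tau>' ''x'' = \<tau> ''x''"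
        using exec_agree[OF t(1)] frame by (auto simp: agree_def \<tau>1_def store_apply)
      ultimately have "J (Suc j) \<tau>'"
        using j(2) t(3,4) qy by (auto simp: J_def)
      moreover have "exec W inner \<tau> (11 + t) \<tau>'"
        unfolding inner_def by (rule exec.Seq[OF ey t(1)])
      ultimately show "\<exists>t \<tau>'. exec W inner \<tau> t \<tau>' \<and> t \<le> B + 20 \<and> J (Suc j) \<tau>'"
        using t(2) by (intro exI[of _ "11 + t"] exI[of _ \<tau>']) auto
    qed
    then obtain t \<tau> where t: "exec W (For ''j'' (Cell ''deg'' (Var ''x'')) inner) \<sigma>2 t \<tau>"
      "J (length (adj_list x)) \<tau>" "t \<le> (B + 40) * length (adj_list x) + 13"
      by (auto simp: algebra_simps)
    have ex: "exec W outer \<sigma> (tp + t) \<tau>" unfolding outer_def by (rule exec.Seq[OF tp(1) t(1)])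
    obtain r where r: "queue \<tau> = queue \<sigma> @ r" using t(2) by (auto simp: J_def)
    have h: "\<tau> ''h'' 0 = Suc k"
      using agreeD[OF exec_agree[OF t(1)], of "''h''"] frame s2 by (simp add: wi)
    have "take (Suc k) (queue \<tau>) = take k (queue \<sigma>) @ [(w, x)]"
      using wx ht r by (simp add: take_Suc_conv_app_nth k_def)
    then have dn: "finished \<tau> = insert (w, x) (finished \<sigma>)" by (simp add: finished_def h k_def)
    have "tokens (finished \<tau>) = D (length (adj_list x))"
      by (auto simp: dn tokens_def D_def)
    moreover have "Suc k \<le> \<tau> ''t'' 0"
      using ht r by (metis Suc_leI k_def length_append length_queue trans_le_add1)
    ultimately have I\<tau>: "I \<tau>" using t(2) h by (simp add: I_def J_def)
    have "U - finished \<sigma> = insert (w, x) (U - finished \<tau>)" using wxU fresh by (auto simp: dn)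
    moreover have "finite (U - finished \<tau>)" "(w, x) \<notin> U - finished \<tau>" using finU dn by auto
    ultimately have "\<Phi> \<sigma> = weight B (w, x) + \<Phi> \<tau>" unfolding \<Phi>_def by simp
    then have "1 + cond_cost b + (tp + t) + \<Phi> \<tau> \<le> \<Phi> \<sigma>"
      using tp(2) t(3) by (simp add: weight_def b_def pop_def)
    with ex I\<tau> show "\<exists>t \<tau>. exec W outer \<sigma> t \<tau> \<and> I \<tau> \<and> 1 + cond_cost b + t + \<Phi> \<tau> \<le> \<Phi> \<sigma>"
      by blast
  qed
  then obtain t \<tau> where t: "exec W (While b outer) \<sigma>1 t \<tau>" "I \<tau>" "\<not> cond_val b \<tau>"
    "t + \<Phi> \<tau> \<le> 1 + cond_cost b + \<Phi> \<sigma>1" by blast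
  have "\<tau> ''h'' 0 = \<tau> ''t'' 0" using t(2,3) by (simp add: I_def b_def)
  then have dn: "finished \<tau> = set (queue \<tau>)" by (simp add: finished_def)
  have Inv: "Inv (tokens (set (queue \<tau>))) \<tau>" using t(2) dn by (simp add: I_def)
  have "set (queue \<tau>) \<subseteq> U" using Inv Inv_queue by blast
  then have "sum (weight B) U = sum (weight B) (U - set (queue \<tau>)) + sum (weight B) (set (queue \<tau>))"
    by (rule sum.subset_diff[OF _ finU])
  moreover have "finished \<sigma>1 = {}" by (simp add: finished_def \<sigma>1_def store_apply)
  ultimately have "3 + t \<le> 9 + (\<Sum>p\<in>set (queue \<tau>). weight B p)"
    using t(4) by (simp add: \<Phi>_def dn b_def)
  moreover have "exec W (worklist body) \<sigma>0 (3 + t) \<tau>"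
    using exec.Seq[OF e1 t(1)] by (simp add: worklist_def b_def outer_def inner_def pop_def)
  ultimately show ?thesis using Inv by blast
qed

end


section \<open>Deleting an edge\<close>

text \<open>The outer test does the work of comparing \<open>y\<close> with \<open>w\<close>: as
  long as a token for \<open>(w, y)\<close> is counted, a counter can be 0 only if
  \<open>y = w\<close>.\<close>

definition decrement :: com where
  "decrement =
     If (Neg (Equal (Cell ''K'' (index (Var ''w'') (Var ''y''))) (Const 0)))
       (Seq (Assign ''K'' (index (Var ''w'') (Var ''y''))
              (Bin Minus (Cell ''K'' (index (Var ''w'') (Var ''y''))) (Const 1)))
         (If (Equal (Cell ''K'' (index (Var ''w'') (Var ''y''))) (Const 0)) push Skip))
       Skip"

text \<open>The deleted edge contributed to a counter of copy \<open>w\<close> only if its tail was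
  reachable there.\<close>

definition seed_step :: com where
  "seed_step = If (Neg (Equal (Cell ''K'' (index (Var ''w'') (Var ''del_tail''))) (Const 0))) decrement Skip"

definition cascade_step :: com where
  "cascade_step = If (Equal (Cell ''F'' (index (Var ''x'') (Var ''y''))) (Const 1)) decrement Skip"

text \<open>An entry with \<open>w = n\<close> reports that \<open>x\<close> has become unreachable
  in the graph itself. For the other entries, a zero counter of \<open>w\<close> in the copy of the
  current parent means that the parent dominates \<open>w\<close>, so \<open>w\<close> is
  deeper.\<close>

definition event_step :: com where
  "event_step =
     Seq (Put ''w'' (Cell ''qw'' (Var ''i'')))
    (Seq (Put ''x'' (Cell ''qx'' (Var ''i'')))
         (If (Equal (Var ''w'') (Var ''n''))
           (Assign ''in_tree'' (Var ''x'') (Const 0))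
           (If (Equal (Cell ''K'' (index (Cell ''parent'' (Var ''x'')) (Var ''w''))) (Const 0))
             (Assign ''parent'' (Var ''x'') (Var ''w''))
             Skip)))"

text \<open>The bit in \<open>F\<close> tells at once whether the edge is present and forward; if
  not, nothing has to be done. Clearing the bit is the only trace that a deletion leaves in the
  representation of the graph.\<close>

definition upd_prog :: com where
  "upd_prog =
     Seq (Put ''t'' (Const 0))
       (If (Equal (Cell ''F'' (index (Var ''del_tail'') (Var ''del_head''))) (Const 1))
         (Seq (Seq (Assign ''F'' (index (Var ''del_tail'') (Var ''del_head'')) (Const 0))
                   (Put ''y'' (Var ''del_head'')))
         (Seq (For ''w'' (Bin Plus (Var ''n'') (Const 1)) seed_step)
         (Seq (worklist cascade_step)
              (For ''i'' (Var ''t'') event_step))))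
         Skip)"

context problem
begin

abbreviation F0 :: "nat rel" where
  "F0 \<equiv> forward_edges s (set as)"

lemma F0_subset: "F0 \<subseteq> set as"
  by (auto simp: forward_edges_def)

lemma F0_bounds: "(x, y) \<in> F0 \<Longrightarrow> x < n \<and> y < n \<and> y \<noteq> s \<and> x \<noteq> y"
  using edges forward_edges_no_start[of x s "set as"] by (auto simp: forward_edges_def)

text \<open>
  The copies are numbered \<open>0, \<dots>, n\<close>; since \<open>n\<close> is not a vertex, copy \<open>n\<close> is \<open>G\<close> itself. The counter of
  \<open>s\<close> is the constant \<open>1\<close>, so that in every copy the positive counters mark the reachable vertices.
\<close>

definition counts :: "(nat \<times> nat \<times> nat) set \<Rightarrow> state \<Rightarrow> bool" where
  "counts P \<sigma> \<longleftrightarrow> (\<forall>w\<le>n. \<forall>y<n. \<sigma> ''K'' (w * n + y) =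
     (if y = w then 0 else if y = s then 1 else card {x. (w, x, y) \<in> P}))"

definition dead :: "(nat \<Rightarrow> nat) \<Rightarrow> state \<Rightarrow> (nat \<times> nat) set" where
  "dead K0 \<sigma> = {(w, y). w \<le> n \<and> y < n \<and> K0 (w * n + y) \<noteq> 0 \<and> \<sigma> ''K'' (w * n + y) = 0}"

text \<open>\<open>K0\<close> holds the counters from before the deletion, \<open>P\<close> the
  tokens still counted. The queue lists exactly the pairs that were positive then and are zero now;
  the last conjunct says that no counter is revived.\<close>

definition cascade_inv :: "(nat \<Rightarrow> nat) \<Rightarrow> (nat \<times> nat \<times> nat) set \<Rightarrow> state \<Rightarrow> bool" where
  "cascade_inv K0 P \<sigma> \<longleftrightarrow> counts P \<sigma> \<and> distinct (queue \<sigma>) \<and> set (queue \<sigma>) = dead K0 \<sigma> \<and>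
     (\<forall>w\<le>n. \<forall>y<n. \<sigma> ''K'' (w * n + y) \<noteq> 0 \<longrightarrow> K0 (w * n + y) \<noteq> 0)"

lemma dead_subset: "dead K0 \<sigma> \<subseteq> {..n} \<times> {..<n}"
  by (auto simp: dead_def)

lemma cascade_inv_agree:
  "cascade_inv K0 P \<sigma> \<Longrightarrow> agree X \<sigma> \<tau> \<Longrightarrow> X \<inter> {''K'', ''qw'', ''qx'', ''t''} = {} \<Longrightarrow> cascade_inv K0 P \<tau>"
  using queue_agree[of X \<sigma> \<tau>] agreeD[of X \<sigma> \<tau> "''K''"]
  by (auto simp: cascade_inv_def counts_def dead_def)

lemma queue_length_bound:
  assumes "distinct (queue \<sigma>)" "set (queue \<sigma>) \<subseteq> {..n} \<times> {..<n}"
  shows "\<sigma> ''t'' 0 \<le> (n + 1) * n"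
proof -
  have "\<sigma> ''t'' 0 = card (set (queue \<sigma>))" using distinct_card[OF assms(1)] by simp
  also have "\<dots> \<le> card ({..n} \<times> {..<n})" using assms(2) by (intro card_mono) auto
  finally show ?thesis by (simp add: card_cartesian_product)
qed

lemma writes_decrement [simp]: "writes decrement = {''K'', ''qw'', ''qx'', ''t''}"
  by (auto simp: decrement_def)

lemma decrement_correct:
  assumes inv: "cascade_inv K0 P \<sigma>" and bd: "bounded_state W \<sigma>" and nn: "\<sigma> ''n'' 0 = n"
    and w: "\<sigma> ''w'' 0 = w" "w \<le> n" and y: "\<sigma> ''y'' 0 = y" "y < n" "y \<noteq> s"
    and tok: "(w, x, y) \<in> P" and fin: "finite {x. (w, x, y) \<in> P}"
  shows "safe W decrement \<sigma>"
    and "\<exists>r. queue (eff decrement \<sigma>) = queue \<sigma> @ r \<and> set r \<subseteq> {(w, y)}"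
    and "cascade_inv K0 (P - {(w, x, y)}) (eff decrement \<sigma>)"
proof -
  define k where "k = \<sigma> ''K'' (w * n + y)"
  have cnt: "\<sigma> ''K'' (w' * n + y') =
      (if y' = w' then 0 else if y' = s then 1 else card {x. (w', x, y') \<in> P})" if "w' \<le> n" "y' < n" for w' y'
    using inv that by (simp add: cascade_inv_def counts_def)
  have pos: "card {x. (w, x, y) \<in> P} > 0" using tok fin by (auto simp: card_gt_0_iff)
  \<comment> \<open>The token at hand is still counted, so a zero can only come from the convention
    for \<open>y = w\<close>.\<close>
  have k0: "k = 0 \<longleftrightarrow> y = w" using cnt[OF w(2) y(2)] pos y(3) by (auto simp: k_def)
  have other: "{x'. (w', x', y') \<in> P - {(w, x, y)}} = {x'. (w', x', y') \<in> P}" if "(w', y') \<noteq> (w, y)" for w' y'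
    using that by auto
  have len: "\<sigma> ''t'' 0 + 1 < W"
    using queue_length_bound[of \<sigma>] inv dead_subset[of K0 \<sigma>] fits(9) by (simp add: cascade_inv_def)
  define \<sigma>1 where "\<sigma>1 = store \<sigma> ''K'' (w * n + y) (k - 1)"
  define \<tau> where "\<tau> = eff decrement \<sigma>"
  have \<tau>: "\<tau> = (if k = 0 then \<sigma> else if k - 1 = 0 then eff push \<sigma>1 else \<sigma>1)"
    by (simp add: \<tau>_def decrement_def w y nn k_def \<sigma>1_def store_apply)
  have bd1: "bounded_state W \<sigma>1" unfolding \<sigma>1_def
    using bounded_state_store[OF bd] bounded_stateD[OF bd, of "''K''" "w * n + y"]
    by (simp add: k_def less_imp_diff_less)
  have t1: "\<sigma>1 ''t'' = \<sigma> ''t''" by (simp add: \<sigma>1_def store_apply)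
  show "safe W decrement \<sigma>"
    using safe_push[OF bd1] len t1 bounded_stateD[OF bd] bounded_stateD[OF bd1] w y nn fits(1)
    by (simp add: decrement_def \<sigma>1_def[symmetric] k_def[symmetric] less_imp_diff_less)
      (auto simp: \<sigma>1_def k_def store_apply less_imp_diff_less)
  have q1: "queue \<sigma>1 = queue \<sigma>"
    by (rule queue_agree[of "{''K''}"]) (simp_all add: \<sigma>1_def agree_def store_apply)
  have wy1: "\<sigma>1 ''w'' 0 = w" "\<sigma>1 ''y'' 0 = y" by (simp_all add: \<sigma>1_def store_apply w y)
  have q\<tau>: "queue \<tau> = queue \<sigma> @ (if k = 1 then [(w, y)] else [])"
    using queue_push[of \<sigma>1] by (auto simp: \<tau> q1 wy1)
  then show "\<exists>r. queue (eff decrement \<sigma>) = queue \<sigma> @ r \<and> set r \<subseteq> {(w, y)}"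
    by (auto simp: \<tau>_def[symmetric])
  have "\<tau> ''K'' = (\<sigma> ''K'')(w * n + y := k - 1)"
    using agreeD[OF agree_push[of \<sigma>1], of "''K''"] by (auto simp: \<tau> \<sigma>1_def store_apply k_def)
  then have K\<tau>: "\<tau> ''K'' (w' * n + y') = (if w' = w \<and> y' = y then k - 1 else \<sigma> ''K'' (w' * n + y'))"
    if "y' < n" for w' y'
    using pair_code_inj[OF that y(2)] by simp
  have "counts (P - {(w, x, y)}) \<tau>"
    unfolding counts_def
  proof (intro allI impI)
    fix w' y' assume wy': "w' \<le> n" "y' < n"
    show "\<tau> ''K'' (w' * n + y') = (if y' = w' then 0 else if y' = s then 1
      else card {x'. (w', x', y') \<in> P - {(w, x, y)}})"
    proof (cases "(w', y') = (w, y)")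
      case True
      have "{x'. (w, x', y) \<in> P - {(w, x, y)}} = {x'. (w, x', y) \<in> P} - {x}" by auto
      then have "card {x'. (w, x', y) \<in> P - {(w, x, y)}} = card {x'. (w, x', y) \<in> P} - 1"
        using tok fin by simp
      then show ?thesis using True K\<tau>[OF wy'(2), of w'] cnt[OF wy'] y(3) by (auto simp: k_def)
    next
      case False
      then show ?thesis using K\<tau>[OF wy'(2), of w'] cnt[OF wy'] other[OF False] by auto
    qed
  qed
  moreover have "dead K0 \<tau> = set (queue \<tau>)"
  proof -
    have old: "set (queue \<sigma>) = dead K0 \<sigma>" and mono: "k \<noteq> 0 \<Longrightarrow> K0 (w * n + y) \<noteq> 0"
      using inv w y by (auto simp: cascade_inv_def k_def)
    have "dead K0 \<tau> = dead K0 \<sigma> \<union> (if k = 1 then {(w, y)} else {})"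
      using K\<tau> w(2) y(2) mono by (auto simp: dead_def k_def split: if_splits)
    then show ?thesis using old by (simp add: q\<tau>)
  qed
  moreover have "distinct (queue \<tau>)"
  proof -
    have "(w, y) \<notin> set (queue \<sigma>)" if "k = 1"
      using inv that by (auto simp: cascade_inv_def dead_def k_def)
    then show ?thesis using inv by (auto simp: q\<tau> cascade_inv_def)
  qed
  moreover have "\<forall>w\<le>n. \<forall>y<n. \<tau> ''K'' (w * n + y) \<noteq> 0 \<longrightarrow> K0 (w * n + y) \<noteq> 0"
    using inv K\<tau> w y by (auto simp: cascade_inv_def k_def split: if_splits)
  ultimately show "cascade_inv K0 (P - {(w, x, y)}) (eff decrement \<sigma>)"
    by (simp add: cascade_inv_def \<tau>_def[symmetric])
qed

text \<open>A vertex other than \<open>s\<close> and \<open>w\<close> is reachable iff one of its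
  predecessors is. Here the counted tails are known to be the reachable ones, so a single step
  suffices, in contrast to \<open>counts_consistent\<close>.\<close>

lemma counts_avoids:
  assumes "counts {(w, x, y). w \<le> n \<and> (x, y) \<in> F \<and> avoids s F w x} \<sigma>" "F \<subseteq> F0" "w \<le> n" "y < n"
  shows "\<sigma> ''K'' (w * n + y) \<noteq> 0 \<longleftrightarrow> avoids s F w y"
proof -
  have fin: "finite {x. w \<le> n \<and> (x, y) \<in> F \<and> avoids s F w x}"
    by (rule finite_subset[of _ "{..<n}"]) (use assms(2) F0_bounds in blast, simp)
  have k: "\<sigma> ''K'' (w * n + y) = (if y = w then 0 else if y = s then 1
      else card {x. w \<le> n \<and> (x, y) \<in> F \<and> avoids s F w x})"
    using assms(1,3,4) by (simp add: counts_def)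
  show ?thesis
  proof (cases "y = w \<or> y = s")
    case True
    then show ?thesis using k by auto
  next
    case False
    then have "\<sigma> ''K'' (w * n + y) \<noteq> 0 \<longleftrightarrow> (\<exists>x. (x, y) \<in> F \<and> avoids s F w x)"
      using k fin assms(3) by (auto simp: card_eq_0_iff)
    also have "\<dots> \<longleftrightarrow> avoids s F w y" using False by (auto intro: avoids_step elim: avoids_last)
    finally show ?thesis .
  qed
qed

text \<open>A self-consistent set of counters is correct because the forward edges are acyclic.\<close>

lemma counts_consistent:
  assumes c: "counts {(w, x, y). w \<le> n \<and> (x, y) \<in> F \<and> \<sigma> ''K'' (w * n + x) \<noteq> 0} \<sigma>" and F: "F \<subseteq> F0"
    and w: "w \<le> n"
  shows "y < n \<Longrightarrow> \<sigma> ''K'' (w * n + y) \<noteq> 0 \<longleftrightarrow> avoids s F w y"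
proof -
  have "finite F" using finite_subset[OF F finite_subset[OF F0_subset]] by simp
  moreover have "acyclic F" using acyclic_subset[OF forward_acyclic F] .
  ultimately have "wf F" by (rule finite_acyclic_wf)
  then show "y < n \<Longrightarrow> ?thesis"
  proof (induction y rule: wf_induct_rule)
    case (less y)
    have fin: "finite {x. w \<le> n \<and> (x, y) \<in> F \<and> \<sigma> ''K'' (w * n + x) \<noteq> 0}"
      by (rule finite_subset[of _ "{..<n}"]) (use F F0_bounds in blast, simp)
    have k: "\<sigma> ''K'' (w * n + y) = (if y = w then 0 else if y = s then 1
        else card {x. w \<le> n \<and> (x, y) \<in> F \<and> \<sigma> ''K'' (w * n + x) \<noteq> 0})"
      using c w less.prems by (simp add: counts_def)
    show ?case
    proof (cases "y = w \<or> y = s")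
      case True
      then show ?thesis using k by auto
    next
      case False
      then have "\<sigma> ''K'' (w * n + y) \<noteq> 0 \<longleftrightarrow> (\<exists>x. (x, y) \<in> F \<and> \<sigma> ''K'' (w * n + x) \<noteq> 0)"
        using k fin w by (auto simp: card_eq_0_iff)
      also have "\<dots> \<longleftrightarrow> (\<exists>x. (x, y) \<in> F \<and> avoids s F w x)"
        using less.IH F F0_bounds by blast
      also have "\<dots> \<longleftrightarrow> avoids s F w y" using False by (auto intro: avoids_step elim: avoids_last)
      finally show ?thesis .
    qed
  qed
qed

section \<open>Seeding the work list and running the cascade\<close>

lemma writes_seed_step [simp]: "writes seed_step = {''K'', ''qw'', ''qx'', ''t''}"
  by (simp add: seed_step_def)

lemma writes_cascade_step [simp]: "writes cascade_step = {''K'', ''qw'', ''qx'', ''t''}"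
  by (simp add: cascade_step_def)

lemma writes_event_step [simp]: "writes event_step = {''w'', ''x'', ''in_tree'', ''parent''}"
  by (auto simp: event_step_def)

lemma writes_worklist:
  "writes (worklist c) = {''h'', ''w'', ''x'', ''j'', ''y''} \<union> writes c"
  by (auto simp: worklist_def)

lemma seed_correct:
  fixes K0 :: "nat \<Rightarrow> nat"
  assumes bd: "bounded_state W \<sigma>0" and nn: "\<sigma>0 ''n'' 0 = n"
    and q: "\<sigma>0 ''t'' 0 = 0" and K0: "K0 = \<sigma>0 ''K''"
    and uv: "\<sigma>0 ''del_tail'' 0 = u" "\<sigma>0 ''y'' 0 = v" "(u, v) \<in> F" and F: "F \<subseteq> F0"
    and counts: "counts {(w, x, y). w \<le> n \<and> (x, y) \<in> F \<and> K0 (w * n + x) \<noteq> 0} \<sigma>0"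
  shows "\<exists>t \<tau>. exec W (For ''w'' (Bin Plus (Var ''n'') (Const 1)) seed_step) \<sigma>0 t \<tau> \<and>
    cascade_inv K0 {(w, x, y). w \<le> n \<and> (x, y) \<in> F - {(u, v)} \<and> K0 (w * n + x) \<noteq> 0} \<tau> \<and>
    t \<le> (cost_bound seed_step + 28) * (n + 1)"
proof -
  \<comment> \<open>When copy \<open>k\<close> is about to be visited, the deleted edge is still
    counted in the copies from \<open>k\<close> on.\<close>
  define P where "P k = {(w, x, y). w \<le> n \<and> K0 (w * n + x) \<noteq> 0 \<and>
    ((x, y) \<in> F - {(u, v)} \<or> k \<le> w \<and> (x, y) = (u, v))}" for k
  define I where "I k \<sigma> \<longleftrightarrow> cascade_inv K0 (P k) \<sigma> \<and> set (queue \<sigma>) \<subseteq> {..<k} \<times> UNIV" for k \<sigma>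
  have uvn: "u < n" "v < n" "v \<noteq> s" using F0_bounds uv(3) F by blast+
  have "\<exists>t \<tau>. exec W (For ''w'' (Bin Plus (Var ''n'') (Const 1)) seed_step) \<sigma>0 t \<tau> \<and> I (n + 1) \<tau> \<and>
    t \<le> (\<Sum>k<n + 1. cost_bound seed_step + (expr_cost (Bin Plus (Var ''n'') (Const 1)) + 10)) +
      (expr_cost (Bin Plus (Var ''n'') (Const 1)) + 10)"
  proof (rule For_rule[where I = I])
    show "bounded_state W \<sigma>0" "n + 1 < W" "1 < W" "''w'' \<notin> writes seed_step" using bd by simp_all
    have "queue \<sigma>0 = []" using q by (simp add: queue_def)
    moreover have "P 0 = {(w, x, y). w \<le> n \<and> (x, y) \<in> F \<and> K0 (w * n + x) \<noteq> 0}"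
      using uv(3) by (auto simp: P_def)
    ultimately show "I 0 \<sigma>0"
      using counts K0 by (auto simp: I_def cascade_inv_def dead_def)
  next
    fix k \<sigma> l assume I: "I k \<sigma>"
    have a: "agree {''w''} \<sigma> (store \<sigma> ''w'' 0 l)" by (simp add: agree_def store_apply)
    then have "queue (store \<sigma> ''w'' 0 l) = queue \<sigma>" by (rule queue_agree) simp
    with I cascade_inv_agree[OF _ a] show "I k (store \<sigma> ''w'' 0 l)" by (simp add: I_def)
  next
    fix k \<sigma> assume "agree (insert ''w'' (writes seed_step)) \<sigma>0 \<sigma>"
    from agreeD[OF this, of "''n''"] have "\<sigma> ''n'' 0 = n" using nn by simp
    then show "expr_fits W (Bin Plus (Var ''n'') (Const 1)) \<sigma> \<and>
      expr_val (Bin Plus (Var ''n'') (Const 1)) \<sigma> = n + 1" by simp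
  next
    fix k \<sigma> assume k: "k < n + 1" and I: "I k \<sigma>" and w: "\<sigma> ''w'' 0 = k"
      and ag: "agree (insert ''w'' (writes seed_step)) \<sigma>0 \<sigma>" and bd: "bounded_state W \<sigma>"
    have nn: "\<sigma> ''n'' 0 = n" and u: "\<sigma> ''del_tail'' 0 = u" and v: "\<sigma> ''y'' 0 = v"
      using agreeD[OF ag, of "''n''"] agreeD[OF ag, of "''del_tail''"] agreeD[OF ag, of "''y''"] nn uv
      by simp_all
    have inv: "cascade_inv K0 (P k) \<sigma>" using I by (simp add: I_def)
    have kn: "k \<le> n" using k by simp
    have ltW: "k < W" "u < W" using kn uvn fits(2) by linarith+
    \<comment> \<open>All entries so far belong to copies below \<open>k\<close>, so no counter of
      copy \<open>k\<close> has dropped to 0 yet and testing the current counter of the tail amounts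
      to testing the old one.\<close>
    have "\<sigma> ''K'' (k * n + u) \<noteq> 0" if "K0 (k * n + u) \<noteq> 0"
    proof
      assume "\<sigma> ''K'' (k * n + u) = 0"
      then have "(k, u) \<in> set (queue \<sigma>)" using inv that kn uvn by (simp add: cascade_inv_def dead_def)
      with I show False by (auto simp: I_def)
    qed
    then have ku: "\<sigma> ''K'' (k * n + u) \<noteq> 0 \<longleftrightarrow> K0 (k * n + u) \<noteq> 0"
      using inv kn uvn by (auto simp: cascade_inv_def)
    have "safe W seed_step \<sigma> \<and> I (Suc k) (eff seed_step \<sigma>)"
    proof (cases "K0 (k * n + u) = 0")
      case True
      have "P (Suc k) = P k" using True by (auto simp: P_def dest: Suc_leI[OF le_neq_implies_less])
      then have "I (Suc k) \<sigma>" using I by (auto simp: I_def)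
      then show ?thesis using True ku w u nn kn uvn ltW
        by (simp add: seed_step_def)
    next
      case False
      have tok: "(k, u, v) \<in> P k" using False kn by (simp add: P_def)
      have fin: "finite {x. (k, x, v) \<in> P k}"
        by (rule finite_subset[of _ "{..<n}"]) (use F F0_bounds uvn in \<open>auto simp: P_def\<close>)
      note d = decrement_correct[OF inv bd nn w kn v uvn(2,3) tok fin]
      have "P k - {(k, u, v)} = P (Suc k)" by (auto simp: P_def)
      moreover have "eff seed_step \<sigma> = eff decrement \<sigma>"
        using False ku w u nn by (simp add: seed_step_def)
      moreover have "safe W seed_step \<sigma>"
        using False ku w u nn d(1) kn uvn ltW bounded_stateD[OF bd, of "''K''"]
        by (simp add: seed_step_def)
      ultimately show ?thesis using d(2,3) I by (fastforce simp: I_def)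
    qed
    then show "\<exists>t \<tau>. exec W seed_step \<sigma> t \<tau> \<and> t \<le> cost_bound seed_step \<and> I (Suc k) \<tau>"
      using safe_exec by blast
  qed
  then obtain t \<tau> where t: "exec W (For ''w'' (Bin Plus (Var ''n'') (Const 1)) seed_step) \<sigma>0 t \<tau>"
    "I (n + 1) \<tau>" "t \<le> (\<Sum>k<n + 1. cost_bound seed_step + 14) + 14" by auto
  have "P (n + 1) = {(w, x, y). w \<le> n \<and> (x, y) \<in> F - {(u, v)} \<and> K0 (w * n + x) \<noteq> 0}"
    by (auto simp: P_def)
  moreover have "t \<le> (cost_bound seed_step + 28) * (n + 1)"
    using t(3) by (simp add: algebra_simps)
  ultimately show ?thesis using t(1,2) by (auto simp: I_def)
qed

definition forward_matrix :: "nat rel \<Rightarrow> state \<Rightarrow> bool" where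
  "forward_matrix F \<sigma> \<longleftrightarrow> (\<forall>u<n. \<forall>v<n. \<sigma> ''F'' (u * n + v) = of_bool ((u, v) \<in> F))"

text \<open>At the start the counters count the tails alive before the deletion, at the end those
  alive according to these very counters. That such a fixed point is true reachability is the
  content of \<open>counts_consistent\<close>.\<close>

lemma cascade_correct:
  fixes K0 :: "nat \<Rightarrow> nat"
  assumes bd: "bounded_state W \<sigma>0" and ly: "layout \<sigma>0" and fm: "forward_matrix F \<sigma>0"
    and F: "F \<subseteq> F0"
    and inv: "cascade_inv K0 {(w, x, y). w \<le> n \<and> (x, y) \<in> F \<and> K0 (w * n + x) \<noteq> 0} \<sigma>0"
  shows "\<exists>t \<tau>. exec W (worklist cascade_step) \<sigma>0 t \<tau> \<and>
    cascade_inv K0 {(w, x, y). w \<le> n \<and> (x, y) \<in> F \<and> \<tau> ''K'' (w * n + x) \<noteq> 0} \<tau> \<and>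
    t \<le> 9 + (\<Sum>p\<in>set (queue \<tau>). weight (cost_bound cascade_step) p)"
proof -
  define P where "P = {(w, x, y). w \<le> n \<and> (x, y) \<in> F \<and> K0 (w * n + x) \<noteq> 0}"
  have "\<exists>t \<tau>. exec W (worklist cascade_step) \<sigma>0 t \<tau> \<and>
    cascade_inv K0 (P - tokens (set (queue \<tau>))) \<tau> \<and>
    t \<le> 9 + (\<Sum>p\<in>set (queue \<tau>). weight (cost_bound cascade_step) p)"
  proof (rule worklist_rule[where Inv = "\<lambda>D. cascade_inv K0 (P - D)" and U = "{..n} \<times> {..<n}"])
    show "cascade_inv K0 (P - {}) \<sigma>0" using inv by (simp add: P_def)
  next
    fix D \<sigma> assume "cascade_inv K0 (P - D) \<sigma>"
    then show "distinct (queue \<sigma>) \<and> set (queue \<sigma>) \<subseteq> {..n} \<times> {..<n}"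
      using dead_subset by (simp add: cascade_inv_def)
  next
    fix D \<sigma> \<tau> assume "cascade_inv K0 (P - D) \<sigma>" "agree {''h'', ''j'', ''w'', ''x'', ''y''} \<sigma> \<tau>"
    then show "cascade_inv K0 (P - D) \<tau>" by (rule cascade_inv_agree) simp
  next
    fix D \<sigma> w x y
    assume inv: "cascade_inv K0 (P - D) \<sigma>" and bd: "bounded_state W \<sigma>" and ly: "layout \<sigma>"
      and ag: "agree ({''h'', ''j'', ''w'', ''x'', ''y''} \<union> writes cascade_step) \<sigma>0 \<sigma>"
      and wx: "(w, x) \<in> set (queue \<sigma>)" and xy: "(x, y) \<in> set as" and D: "(w, x, y) \<notin> D"
      and v: "\<sigma> ''w'' 0 = w" "\<sigma> ''x'' 0 = x" "\<sigma> ''y'' 0 = y"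
    have nn: "\<sigma> ''n'' 0 = n" using ly by (simp add: layout_def)
    have wx': "w \<le> n" "x < n" "K0 (w * n + x) \<noteq> 0"
      using inv wx by (auto simp: cascade_inv_def dead_def)
    have yn: "y < n" using xy edges by auto
    have Fxy: "\<sigma> ''F'' (x * n + y) = of_bool ((x, y) \<in> F)"
      using agreeD[OF ag, of "''F''"] fm wx' yn by (simp add: forward_matrix_def)
    have "safe W cascade_step \<sigma> \<and> (\<exists>r. queue (eff cascade_step \<sigma>) = queue \<sigma> @ r) \<and>
      cascade_inv K0 (P - insert (w, x, y) D) (eff cascade_step \<sigma>)"
    proof (cases "(x, y) \<in> F")
      case True
      have tok: "(w, x, y) \<in> P - D" using True wx' D by (simp add: P_def)
      have ys: "y \<noteq> s" using True F F0_bounds by blast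
      have fin: "finite {x. (w, x, y) \<in> P - D}"
        by (rule finite_subset[of _ "{..<n}"]) (use F F0_bounds in \<open>auto simp: P_def\<close>)
      note d = decrement_correct[OF inv bd nn v(1) wx'(1) v(3) yn ys tok fin]
      have "P - insert (w, x, y) D = P - D - {(w, x, y)}" by auto
      moreover have "eff cascade_step \<sigma> = eff decrement \<sigma>"
        using True v nn Fxy by (simp add: cascade_step_def)
      moreover have "safe W cascade_step \<sigma>"
        using True v nn Fxy d(1) wx' yn bounded_stateD[OF bd, of "''x''" 0]
          bounded_stateD[OF bd, of "''y''" 0] by (simp add: cascade_step_def)
      ultimately show ?thesis using d(2,3) by auto
    next
      case False
      have "P - insert (w, x, y) D = P - D" using False by (auto simp: P_def)
      then show ?thesis using False inv v nn Fxy wx' yn bounded_stateD[OF bd, of "''x''" 0]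
          bounded_stateD[OF bd, of "''y''" 0] by (simp add: cascade_step_def)
    qed
    then show "\<exists>t \<tau> r. exec W cascade_step \<sigma> t \<tau> \<and> t \<le> cost_bound cascade_step \<and>
      queue \<tau> = queue \<sigma> @ r \<and> cascade_inv K0 (P - insert (w, x, y) D) \<tau>"
      using safe_exec by blast
  qed (use bd ly in auto)
  then obtain t \<tau> where t: "exec W (worklist cascade_step) \<sigma>0 t \<tau>"
    "cascade_inv K0 (P - tokens (set (queue \<tau>))) \<tau>"
    "t \<le> 9 + (\<Sum>p\<in>set (queue \<tau>). weight (cost_bound cascade_step) p)" by blast
  \<comment> \<open>A tail that was alive before is alive now unless it is queued, and nothing is
    revived. So removing the tokens of all queued tails leaves exactly those of the tails alive
    now.\<close>
  have "w \<le> n \<and> (x, y) \<in> F \<and> K0 (w * n + x) \<noteq> 0 \<and> \<not> ((w, x) \<in> set (queue \<tau>) \<and> (x, y) \<in> set as) \<longleftrightarrow>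
    w \<le> n \<and> (x, y) \<in> F \<and> \<tau> ''K'' (w * n + x) \<noteq> 0" for w x y
    using t(2) F F0_bounds[of x y] F0_subset by (auto simp: cascade_inv_def dead_def)
  then have "P - tokens (set (queue \<tau>)) =
      {(w, x, y). w \<le> n \<and> (x, y) \<in> F \<and> \<tau> ''K'' (w * n + x) \<noteq> 0}"
    by (auto simp: P_def tokens_def set_adj_list)
  with t show ?thesis by auto
qed

section \<open>Repairing the parents from the list of deaths\<close>

definition tree_ok :: "nat rel \<Rightarrow> state \<Rightarrow> bool" where
  "tree_ok E \<sigma> \<longleftrightarrow> (\<forall>v<n. (\<sigma> ''in_tree'' v \<noteq> 0 \<longleftrightarrow> avoids s E n v) \<and> \<sigma> ''parent'' v < n \<and>
     (v \<noteq> s \<and> avoids s E n v \<longrightarrow> idom s E {..<n} (\<sigma> ''parent'' v) v))"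

lemma avoids_n: "E \<subseteq> set as \<Longrightarrow> avoids s E n v \<longleftrightarrow> (s, v) \<in> E\<^sup>*"
  using start edges by (intro avoids_fresh) auto

text \<open>For \<open>w < n\<close> an entry \<open>(w, x)\<close> says that \<open>w\<close> has
  begun to dominate \<open>x\<close>. The order of the entries tells nothing about depth, and
  \<open>idom_insert\<close> copes with any order by keeping the deepest candidate so far. Parents
  of vertices that became unreachable may be garbage, but they stay below \<open>n\<close> and
  remain valid row numbers.\<close>

lemma events_correct:
  assumes bd: "bounded_state W \<sigma>0" and nn: "\<sigma>0 ''n'' 0 = n"
    and E: "E' \<subseteq> E" "E \<subseteq> set as"
    and K: "\<And>w y. w \<le> n \<Longrightarrow> y < n \<Longrightarrow> \<sigma>0 ''K'' (w * n + y) \<noteq> 0 \<longleftrightarrow> avoids s E' w y"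
    and q: "set (queue \<sigma>0) = {(w, y). w \<le> n \<and> y < n \<and> avoids s E w y \<and> \<not> avoids s E' w y}"
    and tree: "tree_ok E \<sigma>0"
  shows "\<exists>t \<tau>. exec W (For ''i'' (Var ''t'') event_step) \<sigma>0 t \<tau> \<and> tree_ok E' \<tau> \<and>
    t \<le> (cost_bound event_step + 12) * \<sigma>0 ''t'' 0 + 12"
proof -
  define q0 where "q0 = queue \<sigma>0"
  \<comment> \<open>The competitors accounted for so far: the dominators of \<open>v\<close> in the
    old graph and those whose entry for \<open>v\<close> has been read.\<close>
  define S where "S k v = {w. w < n \<and> (\<not> avoids s E w v \<or> (w, v) \<in> set (take k q0))}" for k v
  define I where "I k \<sigma> \<longleftrightarrow> (\<forall>v<n.
    (\<sigma> ''in_tree'' v \<noteq> 0 \<longleftrightarrow> avoids s E n v \<and> (n, v) \<notin> set (take k q0)) \<and> \<sigma> ''parent'' v < n \<and>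
    (v \<noteq> s \<and> avoids s E' n v \<longrightarrow> idom s E' (S k v) (\<sigma> ''parent'' v) v))" for k and \<sigma> :: state
  have lq: "length q0 = \<sigma>0 ''t'' 0" by (simp add: q0_def)
  have "\<exists>t \<tau>. exec W (For ''i'' (Var ''t'') event_step) \<sigma>0 t \<tau> \<and> I (\<sigma>0 ''t'' 0) \<tau> \<and>
    t \<le> (\<Sum>k<\<sigma>0 ''t'' 0. cost_bound event_step + (expr_cost (Var ''t'') + 10)) +
      (expr_cost (Var ''t'') + 10)"
  proof (rule For_rule[where I = I])
    show "bounded_state W \<sigma>0" "\<sigma>0 ''t'' 0 < W" "1 < W" "''i'' \<notin> writes event_step"
      using bd by (simp_all add: bounded_stateD)
    \<comment> \<open>Before any entry is read only old dominators compete, and the old parent still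
      beats them.\<close>
    have "idom s E' (S 0 v) (\<sigma>0 ''parent'' v) v" if "v < n" "v \<noteq> s" "avoids s E' n v" for v
    proof (rule idom_antimono[OF _ E(1)])
      have "avoids s E n v" using avoids_mono[OF that(3) E(1)] .
      then show "idom s E {..<n} (\<sigma>0 ''parent'' v) v" using tree that by (simp add: tree_ok_def)
    qed (auto simp: S_def)
    then show "I 0 \<sigma>0" using tree by (simp add: I_def tree_ok_def)
  next
    fix k \<sigma> l assume "I k \<sigma>"
    then show "I k (store \<sigma> ''i'' 0 l)" by (simp add: I_def store_apply)
  next
    fix k \<sigma> assume "agree (insert ''i'' (writes event_step)) \<sigma>0 \<sigma>" "bounded_state W \<sigma>"
    then show "expr_fits W (Var ''t'') \<sigma> \<and> expr_val (Var ''t'') \<sigma> = \<sigma>0 ''t'' 0"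
      using agreeD[of "insert ''i'' (writes event_step)" \<sigma>0 \<sigma> "''t''"] bounded_stateD[OF bd, of "''t''" 0] by simp
  next
    fix k \<sigma> assume k: "k < \<sigma>0 ''t'' 0" and I: "I k \<sigma>" and i: "\<sigma> ''i'' 0 = k"
      and ag: "agree (insert ''i'' (writes event_step)) \<sigma>0 \<sigma>" and bd: "bounded_state W \<sigma>"
    define w where "w = \<sigma>0 ''qw'' k"
    define x where "x = \<sigma>0 ''qx'' k"
    define p where "p = \<sigma> ''parent'' x"
    define \<tau> where "\<tau> = eff event_step \<sigma>"
    have g: "\<sigma> ''n'' 0 = n" "\<sigma> ''qw'' k = w" "\<sigma> ''qx'' k = x" "\<sigma> ''K'' = \<sigma>0 ''K''"
      using agreeD[OF ag, of "''n''"] agreeD[OF ag, of "''qw''"] agreeD[OF ag, of "''qx''"]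
        agreeD[OF ag, of "''K''"] nn by (simp_all add: w_def x_def)
    have wx: "q0 ! k = (w, x)" using k by (simp add: q0_def nth_queue w_def x_def)
    then have "(w, x) \<in> set q0" using k lq by (metis nth_mem)
    then have wx': "w \<le> n" "x < n" "avoids s E w x" "\<not> avoids s E' w x" using q by (auto simp: q0_def)
    have wne: "w \<noteq> x" using wx' by auto
    have tk: "set (take (Suc k) q0) = insert (w, x) (set (take k q0))"
      using k lq wx by (simp add: take_Suc_conv_app_nth)
    have pn: "p < n" using I wx' by (simp add: I_def p_def)
    have Kp: "\<sigma> ''K'' (p * n + w) = 0 \<longleftrightarrow> \<not> avoids s E' p w" if "w < n"
      using K[of p w] pn that g(4) by auto
    have \<tau>: "\<tau> ''in_tree'' = (if w = n then (\<sigma> ''in_tree'')(x := 0) else \<sigma> ''in_tree'')"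
      "\<tau> ''parent'' = (if w \<noteq> n \<and> \<sigma> ''K'' (p * n + w) = 0 then (\<sigma> ''parent'')(x := w) else \<sigma> ''parent'')"
      by (simp_all add: \<tau>_def event_step_def store_apply i g p_def)
    have ltW: "x < W" "w < W" "p < W" using wx' pn fits(2) by linarith+
    have safe: "safe W event_step \<sigma>"
      using bounded_stateD[OF bd, of "''K''"] i g ltW pn wx' p_def[symmetric] bounded_stateD[OF bd, of "''i''" 0]
      by (simp add: event_step_def store_apply)
    have "I (Suc k) \<tau>"
      unfolding I_def
    proof (intro allI impI conjI)
      fix v assume v: "v < n"
      show "\<tau> ''in_tree'' v \<noteq> 0 \<longleftrightarrow> avoids s E n v \<and> (n, v) \<notin> set (take (Suc k) q0)"
        using I v by (auto simp: I_def \<tau> tk)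
      show "\<tau> ''parent'' v < n" using I v wx'(1) by (auto simp: I_def \<tau>)
      assume vr: "v \<noteq> s \<and> avoids s E' n v"
      then have id: "idom s E' (S k v) (\<sigma> ''parent'' v) v" using I v by (simp add: I_def)
      show "idom s E' (S (Suc k) v) (\<tau> ''parent'' v) v"
      proof (cases "v = x \<and> w \<noteq> n")
        case True
        then have "S (Suc k) v = insert w (S k v)" using wx' by (auto simp: S_def tk)
        moreover have "\<tau> ''parent'' v = (if avoids s E' p w then p else w)"
          using True Kp wx'(1) by (auto simp: \<tau> p_def)
        moreover have "(s, v) \<in> E'\<^sup>*" using vr avoids_n[of E' v] E by auto
        ultimately show ?thesis
          using idom_insert[of s E' "S k v" p v w] id True wne wx' by (simp add: p_def)
      next
        case False
        then have "S (Suc k) v = S k v" using wx' by (auto simp: S_def tk)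
        moreover have "\<tau> ''parent'' v = \<sigma> ''parent'' v" using False by (auto simp: \<tau>)
        ultimately show ?thesis using id by simp
      qed
    qed
    then show "\<exists>t \<tau>. exec W event_step \<sigma> t \<tau> \<and> t \<le> cost_bound event_step \<and> I (Suc k) \<tau>"
      using safe_exec[OF safe] \<tau>_def by blast
  qed
  then obtain t \<tau> where t: "exec W (For ''i'' (Var ''t'') event_step) \<sigma>0 t \<tau>" "I (\<sigma>0 ''t'' 0) \<tau>"
    "t \<le> (\<Sum>k<\<sigma>0 ''t'' 0. cost_bound event_step + 12) + 12" by auto
  have tq: "set (take (\<sigma>0 ''t'' 0) q0) = {(w, y). w \<le> n \<and> y < n \<and> avoids s E w y \<and> \<not> avoids s E' w y}"
    using q lq by (simp add: q0_def)
  have "tree_ok E' \<tau>"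
    unfolding tree_ok_def
  proof (intro allI impI conjI)
    fix v assume v: "v < n"
    show "\<tau> ''in_tree'' v \<noteq> 0 \<longleftrightarrow> avoids s E' n v"
      using t(2) v avoids_mono[OF _ E(1)] by (auto simp: I_def tq)
    show "\<tau> ''parent'' v < n" using t(2) v by (simp add: I_def)
    assume "v \<noteq> s \<and> avoids s E' n v"
    then have "idom s E' (S (\<sigma>0 ''t'' 0) v) (\<tau> ''parent'' v) v" using t(2) v by (simp add: I_def)
    \<comment> \<open>After the last entry nobody is missing: a vertex that dominates
      \<open>v\<close> now either did so before or occurs with \<open>v\<close> in the
      queue.\<close>
    then show "idom s E' {..<n} (\<tau> ''parent'' v) v"
      using v by (auto simp: idom_def S_def tq)
  qed
  then show ?thesis using t(1,3) by (auto simp: mult.commute)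
qed

section \<open>Amortised cost of one deletion\<close>

definition maintained :: "nat rel \<Rightarrow> state \<Rightarrow> bool" where
  "maintained E \<sigma> \<longleftrightarrow> bounded_state W \<sigma> \<and> layout \<sigma> \<and> forward_matrix (E \<inter> F0) \<sigma> \<and>
     counts {(w, x, y). w \<le> n \<and> (x, y) \<in> E \<inter> F0 \<and> avoids s (E \<inter> F0) w x} \<sigma> \<and> tree_ok E \<sigma>"

definition alive :: "nat rel \<Rightarrow> (nat \<times> nat) set" where
  "alive E = {(w, x). w \<le> n \<and> x < n \<and> avoids s E w x}"

text \<open>Prepaid cost of all deaths still to come: each alive pair stores its share of the
  cascade and, with the loop overhead \<open>12\<close>, one run of
  \<open>event_step\<close>.\<close>

definition potential :: "nat rel \<Rightarrow> nat" where
  "potential E = (\<Sum>p\<in>alive E. weight (cost_bound cascade_step) p + (cost_bound event_step + 12))"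

lemma finite_alive: "finite (alive E)"
  by (rule finite_subset[of _ "{..n} \<times> {..<n}"]) (auto simp: alive_def)

lemma update_correct:
  assumes M: "maintained E \<sigma>" and E: "E \<subseteq> set as" and e: "fst e < n" "snd e < n"
  shows "\<exists>t \<tau>. exec W upd_prog (request e \<sigma>) t \<tau> \<and> maintained (E - {e}) \<tau> \<and>
    t + potential (E - {e}) \<le> potential E + (cost_bound seed_step + 100) * (n + 1)"
proof -
  obtain u v where uv: "e = (u, v)" by (cases e)
  have uvn: "u < n" "v < n" using e uv by auto
  define F where "F = E \<inter> F0"
  define E' where "E' = E - {e}"
  define F' where "F' = E' \<inter> F0"
  define \<sigma>1 where "\<sigma>1 = store (request e \<sigma>) ''t'' 0 0"
  have bd: "bounded_state W \<sigma>" and ly: "layout \<sigma>" and fm: "forward_matrix F \<sigma>"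
    and cnt: "counts {(w, x, y). w \<le> n \<and> (x, y) \<in> F \<and> avoids s F w x} \<sigma>" and tr: "tree_ok E \<sigma>"
    using M by (auto simp: maintained_def F_def)
  have FF0: "F \<subseteq> F0" "F' \<subseteq> F0" by (auto simp: F_def F'_def)
  have avF: "avoids s F w x \<longleftrightarrow> avoids s E w x" for w x
    unfolding F_def by (rule avoids_forward_edges[OF E])
  have avF': "avoids s F' w x \<longleftrightarrow> avoids s E' w x" for w x
    unfolding F'_def by (rule avoids_forward_edges) (use E in \<open>auto simp: E'_def\<close>)
  have uW: "u < W" "v < W" using uvn fits(2) by linarith+
  have bdr: "bounded_state W (request e \<sigma>)"
    using bd uW by (simp add: request_def bounded_state_store uv)
  have e1: "exec W (Put ''t'' (Const 0)) (request e \<sigma>) 3 \<sigma>1"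
    using exec.Assign[of W "Const 0" "request e \<sigma>" "Const 0" "''t''"]
    by (simp add: \<sigma>1_def eval_nat_numeral)
  have bd1: "bounded_state W \<sigma>1" using exec_bounded[OF e1 bdr] .
  have a1: "agree {''del_tail'', ''del_head'', ''t''} \<sigma> \<sigma>1"
    by (simp add: \<sigma>1_def request_def agree_def store_apply)
  have v1: "\<sigma>1 ''del_tail'' 0 = u" "\<sigma>1 ''del_head'' 0 = v" "\<sigma>1 ''t'' 0 = 0"
    by (simp_all add: \<sigma>1_def request_def store_apply uv)
  have ly1: "layout \<sigma>1" using ly a1 by (rule layout_agree) simp
  have n1: "\<sigma>1 ''n'' 0 = n" using ly1 by (simp add: layout_def)
  have s1: "\<sigma>1 ''F'' = \<sigma> ''F''" "\<sigma>1 ''K'' = \<sigma> ''K''" "\<sigma>1 ''parent'' = \<sigma> ''parent''"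
    "\<sigma>1 ''in_tree'' = \<sigma> ''in_tree''"
    using a1 by (simp_all add: agree_def)
  define b where "b = Equal (Cell ''F'' (index (Var ''del_tail'') (Var ''del_head''))) (Const 1)"
  have bfit: "cond_fits W b \<sigma>1"
    using n1 v1 uvn uW bounded_stateD[OF bd1, of "''F''"] by (simp add: b_def)
  have bval: "cond_val b \<sigma>1 \<longleftrightarrow> e \<in> F"
    using n1 v1 uvn fm by (simp add: b_def s1 forward_matrix_def uv)
  show ?thesis
  proof (cases "e \<in> F")
    case False
    \<comment> \<open>Deleting an edge that is not forward, or already absent, changes reachability
      in no copy, so counters, tree and potential remain valid.\<close>
    have F': "F' = F" using False by (auto simp: F_def F'_def E'_def)
    have av: "avoids s E' = avoids s E" using avF avF' F' by (intro ext) auto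
    have "maintained E' \<sigma>1"
      using bd1 ly1 fm cnt tr
      by (simp add: maintained_def F'_def[symmetric] F' tree_ok_def idom_def av forward_matrix_def counts_def s1)
    moreover have "potential E' = potential E" by (simp add: potential_def alive_def av)
    moreover have "exec W upd_prog (request e \<sigma>) (3 + (1 + cond_cost b + 1)) \<sigma>1"
      unfolding upd_prog_def b_def[symmetric]
      by (rule exec.Seq[OF e1 exec.IfFalse[OF bfit _ exec.Skip]]) (use bval False in simp)
    ultimately show ?thesis
      by (intro exI[of _ "3 + (1 + cond_cost b + 1)"] exI[of _ \<sigma>1]) (simp add: E'_def b_def)
  next
    case True
    define prep where "prep = Seq (Assign ''F'' (index (Var ''del_tail'') (Var ''del_head'')) (Const 0))
      (Put ''y'' (Var ''del_head''))"
    define \<sigma>2 where "\<sigma>2 = eff prep \<sigma>1"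
    have "safe W prep \<sigma>1" using n1 v1 uvn uW by (simp add: prep_def store_apply)
    then obtain t2 where t2: "exec W prep \<sigma>1 t2 \<sigma>2" "t2 \<le> cost_bound prep"
      using safe_exec \<sigma>2_def by blast
    have bd2: "bounded_state W \<sigma>2" using exec_bounded[OF t2(1) bd1] .
    have a2: "agree {''F'', ''y''} \<sigma>1 \<sigma>2" by (simp add: \<sigma>2_def prep_def agree_def store_apply)
    have ly2: "layout \<sigma>2" using ly1 a2 by (rule layout_agree) simp
    have y2: "\<sigma>2 ''y'' 0 = v" by (simp add: \<sigma>2_def prep_def store_apply v1)
    have F2: "\<sigma>2 ''F'' = (\<sigma> ''F'')(u * n + v := 0)"
      by (simp add: \<sigma>2_def prep_def store_apply v1 n1 s1)
    have F'F: "F' = F - {(u, v)}" by (auto simp: F_def F'_def E'_def uv)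
    have fm2: "forward_matrix F' \<sigma>2"
      using fm pair_code_inj[OF _ uvn(2)] by (auto simp: forward_matrix_def F2 F'F)
    have n2: "\<sigma>2 ''n'' 0 = n" using ly2 by (simp add: layout_def)
    have s2: "\<sigma>2 ''K'' = \<sigma> ''K''" "\<sigma>2 ''parent'' = \<sigma> ''parent''" "\<sigma>2 ''in_tree'' = \<sigma> ''in_tree''"
      "\<sigma>2 ''t'' 0 = 0" "\<sigma>2 ''del_tail'' 0 = u"
      using a2 s1 v1 by (simp_all add: agree_def)
    define K0 where "K0 = \<sigma>2 ''K''"
    have K0: "K0 (w * n + y) \<noteq> 0 \<longleftrightarrow> avoids s E w y" if "w \<le> n" "y < n" for w y
      using counts_avoids[OF cnt FF0(1) that] by (simp add: K0_def s2 avF)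
    have "(w \<le> n \<and> (x, y) \<in> F \<and> avoids s F w x) = (w \<le> n \<and> (x, y) \<in> F \<and> K0 (w * n + x) \<noteq> 0)" for w x y
      using K0[of w x] F0_bounds[of x y] FF0(1) by (auto simp: avF)
    then have "counts {(w, x, y). w \<le> n \<and> (x, y) \<in> F \<and> K0 (w * n + x) \<noteq> 0} \<sigma>2"
      using cnt by (simp add: counts_def s2)
    from seed_correct[OF bd2 n2 s2(4) K0_def s2(5) y2 True[unfolded uv] FF0(1) this]
    obtain t3 \<sigma>3 where t3: "exec W (For ''w'' (Bin Plus (Var ''n'') (Const 1)) seed_step) \<sigma>2 t3 \<sigma>3"
      "cascade_inv K0 {(w, x, y). w \<le> n \<and> (x, y) \<in> F' \<and> K0 (w * n + x) \<noteq> 0} \<sigma>3"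
      "t3 \<le> (cost_bound seed_step + 28) * (n + 1)"
      unfolding F'F by blast
    have a3: "agree {''w'', ''K'', ''qw'', ''qx'', ''t''} \<sigma>2 \<sigma>3" using exec_agree[OF t3(1)] by simp
    have bd3: "bounded_state W \<sigma>3" using exec_bounded[OF t3(1) bd2] .
    have ly3: "layout \<sigma>3" using ly2 a3 by (rule layout_agree) simp
    have fm3: "forward_matrix F' \<sigma>3" using fm2 agreeD[OF a3, of "''F''"] by (simp add: forward_matrix_def)
    from cascade_correct[OF bd3 ly3 fm3 FF0(2) t3(2)]
    obtain t4 \<sigma>4 where t4: "exec W (worklist cascade_step) \<sigma>3 t4 \<sigma>4"
      "cascade_inv K0 {(w, x, y). w \<le> n \<and> (x, y) \<in> F' \<and> \<sigma>4 ''K'' (w * n + x) \<noteq> 0} \<sigma>4"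
      "t4 \<le> 9 + (\<Sum>p\<in>set (queue \<sigma>4). weight (cost_bound cascade_step) p)" by blast
    have a4: "agree {''h'', ''w'', ''x'', ''j'', ''y'', ''K'', ''qw'', ''qx'', ''t''} \<sigma>3 \<sigma>4"
      using exec_agree[OF t4(1)] by (simp add: writes_worklist insert_commute)
    have bd4: "bounded_state W \<sigma>4" using exec_bounded[OF t4(1) bd3] .
    have ly4: "layout \<sigma>4" using ly3 a4 by (rule layout_agree) simp
    have fm4: "forward_matrix F' \<sigma>4" using fm3 agreeD[OF a4, of "''F''"] by (simp add: forward_matrix_def)
    have K4: "\<sigma>4 ''K'' (w * n + y) \<noteq> 0 \<longleftrightarrow> avoids s E' w y" if "w \<le> n" "y < n" for w y
      using counts_consistent[OF _ FF0(2) that] t4(2) by (simp add: cascade_inv_def avF')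
    have "set (queue \<sigma>4) = {(w, y). w \<le> n \<and> y < n \<and> avoids s E w y \<and> \<not> avoids s E' w y}"
    proof -
      have "set (queue \<sigma>4) = dead K0 \<sigma>4" using t4(2) by (simp add: cascade_inv_def)
      then show ?thesis using K0 K4 unfolding dead_def by blast
    qed
    note q4 = this
    have tr4: "tree_ok E \<sigma>4"
      using tr s2 agreeD[OF a3, of "''parent''"] agreeD[OF a3, of "''in_tree''"]
        agreeD[OF a4, of "''parent''"] agreeD[OF a4, of "''in_tree''"]
      by (simp add: tree_ok_def)
    have n4: "\<sigma>4 ''n'' 0 = n" using ly4 by (simp add: layout_def)
    have E'E: "E' \<subseteq> E" by (auto simp: E'_def)
    from events_correct[OF bd4 n4 E'E E K4 q4 tr4]
    obtain t5 \<tau> where t5: "exec W (For ''i'' (Var ''t'') event_step) \<sigma>4 t5 \<tau>" "tree_ok E' \<tau>"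
      "t5 \<le> (cost_bound event_step + 12) * \<sigma>4 ''t'' 0 + 12" by blast
    have a5: "agree {''i'', ''w'', ''x'', ''in_tree'', ''parent''} \<sigma>4 \<tau>" using exec_agree[OF t5(1)] by simp
    have "(w \<le> n \<and> (x, y) \<in> F' \<and> avoids s F' w x) = (w \<le> n \<and> (x, y) \<in> F' \<and> \<sigma>4 ''K'' (w * n + x) \<noteq> 0)" for w x y
      using K4[of w x] F0_bounds[of x y] FF0(2) by (auto simp: avF')
    then have "counts {(w, x, y). w \<le> n \<and> (x, y) \<in> F' \<and> avoids s F' w x} \<tau>"
      using t4(2) agreeD[OF a5, of "''K''"] by (simp add: cascade_inv_def counts_def)
    moreover have "layout \<tau>" using ly4 a5 by (rule layout_agree) simp
    moreover have "forward_matrix F' \<tau>" using fm4 agreeD[OF a5, of "''F''"] by (simp add: forward_matrix_def)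
    ultimately have mt: "maintained E' \<tau>"
      using t5(2) exec_bounded[OF t5(1) bd4] by (simp add: maintained_def F'_def[symmetric])
    have "exec W upd_prog (request e \<sigma>) (3 + (1 + cond_cost b + (t2 + (t3 + (t4 + t5))))) \<tau>"
      unfolding upd_prog_def b_def[symmetric] prep_def[symmetric]
      by (rule exec.Seq[OF e1 exec.IfTrue[OF bfit _ exec.Seq[OF t2(1) exec.Seq[OF t3(1) exec.Seq[OF t4(1) t5(1)]]]]])
        (use bval True in simp)
    note ex = this
    define A where "A = (cost_bound seed_step + 28) * (n + 1)"
    \<comment> \<open>The queue lists exactly the pairs killed by this deletion, so the drop of the
      potential pays for the cascade and the parent tests.\<close>
    have "alive E = alive E' \<union> set (queue \<sigma>4)" "alive E' \<inter> set (queue \<sigma>4) = {}"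
      using q4 avoids_mono[OF _ E'E] by (auto simp: alive_def)
    then have "potential E = potential E' +
        (\<Sum>p\<in>set (queue \<sigma>4). weight (cost_bound cascade_step) p + (cost_bound event_step + 12))"
      unfolding potential_def by (simp add: sum.union_disjoint finite_alive)
    also have "(\<Sum>p\<in>set (queue \<sigma>4). weight (cost_bound cascade_step) p + (cost_bound event_step + 12)) =
        (\<Sum>p\<in>set (queue \<sigma>4). weight (cost_bound cascade_step) p) + (cost_bound event_step + 12) * \<sigma>4 ''t'' 0"
      using t4(2) distinct_card[of "queue \<sigma>4"] by (simp add: sum.distrib cascade_inv_def)
    finally have "t4 + t5 + potential E' \<le> potential E + 21" using t4(3) t5(3) by linarith
    moreover have "t3 \<le> A" using t3(3) by (simp add: A_def)
    moreover have "t2 \<le> 14" using t2(2) by (simp add: prep_def)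
    moreover have "cond_cost b = 11" by (simp add: b_def)
    \<comment> \<open>Besides \<open>A\<close> there remain \<open>3 + 1 + 11 + 14 + 21 = 50\<close>
      steps, covered by \<open>72 * (n + 1)\<close>; the \<open>100\<close> of the statement is
      \<open>28 + 72\<close>.\<close>
    ultimately have "3 + (1 + cond_cost b + (t2 + (t3 + (t4 + t5)))) + potential E' \<le>
        potential E + (A + 72 * (n + 1))"
      by simp
    also have "A + 72 * (n + 1) = (cost_bound seed_step + 100) * (n + 1)"
      by (simp add: A_def algebra_simps)
    finally have "3 + (1 + cond_cost b + (t2 + (t3 + (t4 + t5)))) + potential E' \<le>
        potential E + (cost_bound seed_step + 100) * (n + 1)" .
    then show ?thesis using ex mt unfolding E'_def by blast
  qed
qed

end


section \<open>Initialisation\<close>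

definition adj_step :: com where
  "adj_step =
     Seq (Assign ''adj'' (Bin Plus (Bin Times (Cell ''tail'' (Var ''i'')) (Var ''m''))
                                   (Cell ''deg'' (Cell ''tail'' (Var ''i''))))
           (Cell ''head'' (Var ''i'')))
         (Assign ''deg'' (Cell ''tail'' (Var ''i''))
           (Bin Plus (Cell ''deg'' (Cell ''tail'' (Var ''i''))) (Const 1)))"

text \<open>The test \<open>y \<noteq> w\<close> is the removal of \<open>w\<close> from its copy,
  and the mark in \<open>R\<close> keeps a pair from being queued twice.\<close>

definition search_step :: com where
  "search_step =
     If (Conj (Neg (Equal (Var ''y'') (Var ''w'')))
              (Equal (Cell ''R'' (index (Var ''w'') (Var ''y''))) (Const 0)))
       (Seq (Assign ''R'' (index (Var ''w'') (Var ''y'')) (Const 1)) push)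
       Skip"

text \<open>An edge is forward iff its tail is reached without its head, and this is literally the
  entry of \<open>R\<close> in the row of the head and the column of the tail.\<close>

definition forward_step :: com where
  "forward_step =
     Assign ''F'' (index (Cell ''tail'' (Var ''i'')) (Cell ''head'' (Var ''i'')))
       (Cell ''R'' (index (Cell ''head'' (Var ''i'')) (Cell ''tail'' (Var ''i''))))"

definition count_step :: com where
  "count_step =
     If (Conj (Equal (Cell ''F'' (index (Cell ''tail'' (Var ''i'')) (Cell ''head'' (Var ''i'')))) (Const 1))
        (Conj (Equal (Cell ''R'' (index (Var ''w'') (Cell ''tail'' (Var ''i'')))) (Const 1))
              (Neg (Equal (Cell ''head'' (Var ''i'')) (Var ''w'')))))
       (Assign ''K'' (index (Var ''w'') (Cell ''head'' (Var ''i'')))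
          (Bin Plus (Cell ''K'' (index (Var ''w'') (Cell ''head'' (Var ''i'')))) (Const 1)))
       Skip"

definition count_start :: com where
  "count_start =
     If (Equal (Var ''w'') (Var ''s'')) Skip (Assign ''K'' (index (Var ''w'') (Var ''s'')) (Const 1))"

definition tree_step :: com where
  "tree_step =
     If (Conj (Neg (Equal (Var ''w'') (Var ''v'')))
        (Conj (Equal (Cell ''R'' (index (Var ''w'') (Var ''v''))) (Const 0))
              (Equal (Cell ''R'' (index (Cell ''parent'' (Var ''v'')) (Var ''w''))) (Const 0))))
       (Assign ''parent'' (Var ''v'') (Var ''w''))
       Skip"

text \<open>The loop over all candidates runs for reachable vertices only; for every vertex it would
  cost \<open>n * n\<close>, too much if there are few edges.\<close>

definition tree_body :: com where
  "tree_body =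
     Seq (Assign ''in_tree'' (Var ''v'') (Cell ''R'' (index (Var ''n'') (Var ''v''))))
         (If (Equal (Cell ''in_tree'' (Var ''v'')) (Const 1))
           (Seq (Assign ''parent'' (Var ''v'') (Var ''s'')) (For ''w'' (Var ''n'') tree_step))
           Skip)"

definition init_prog :: com where
  "init_prog =
     Seq (For ''i'' (Var ''m'') adj_step)
    (Seq (Put ''y'' (Var ''s''))
    (Seq (For ''w'' (Bin Plus (Var ''n'') (Const 1)) search_step)
    (Seq (worklist search_step)
    (Seq (For ''i'' (Var ''m'') forward_step)
    (Seq (For ''w'' (Bin Plus (Var ''n'') (Const 1)) (Seq count_start (For ''i'' (Var ''m'') count_step)))
         (For ''v'' (Var ''n'') tree_body))))))"

context problem
begin

lemma writes_init_steps [simp]: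
  "writes adj_step = {''adj'', ''deg''}"
  "writes search_step = {''R'', ''qw'', ''qx'', ''t''}"
  "writes forward_step = {''F''}"
  "writes count_step = {''K''}"
  "writes count_start = {''K''}"
  "writes tree_step = {''parent''}"
  "writes tree_body = {''in_tree'', ''parent'', ''w''}"
  by (auto simp: adj_step_def search_step_def forward_step_def count_step_def count_start_def
      tree_step_def tree_body_def)

section \<open>Reading the input edge list\<close>

definition inputs :: "state \<Rightarrow> bool" where
  "inputs \<sigma> \<longleftrightarrow> \<sigma> ''n'' 0 = n \<and> \<sigma> ''m'' 0 = m \<and> \<sigma> ''s'' 0 = s \<and>
     (\<forall>i<m. \<sigma> ''tail'' i = fst (as ! i) \<and> \<sigma> ''head'' i = snd (as ! i))"

lemma inputs_agree:
  "inputs \<sigma> \<Longrightarrow> agree X \<sigma> \<tau> \<Longrightarrow> X \<inter> {''n'', ''m'', ''s'', ''tail'', ''head''} = {} \<Longrightarrow> inputs \<tau>"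
  by (auto simp: agree_def inputs_def)

lemma edge_nth: "i < m \<Longrightarrow> fst (as ! i) < n \<and> snd (as ! i) < n"
  using edges len nth_mem[of i as] by (metis SigmaE fst_conv lessThan_iff snd_conv subsetD)

lemma take_edges: "i < m \<Longrightarrow> set (take (Suc i) as) = insert (as ! i) (set (take i as))"
  using len by (simp add: take_Suc_conv_app_nth)

lemma lt_W: "x \<le> n \<Longrightarrow> x < W"
  using fits(2) by linarith

lemma lt_W': "x < n \<Longrightarrow> x < W"
  using fits(2) by linarith

lemma For_m_rule:
  assumes bd: "bounded_state W \<sigma>0" and m: "\<sigma>0 ''m'' 0 = m" and c: "writes c \<inter> {''i'', ''m''} = {}"
    and init: "I 0 \<sigma>0" and indep: "\<And>k \<sigma> l. I k \<sigma> \<Longrightarrow> I k (store \<sigma> ''i'' 0 l)"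
    and step: "\<And>k \<sigma>. k < m \<Longrightarrow> I k \<sigma> \<Longrightarrow> \<sigma> ''i'' 0 = k \<Longrightarrow> agree (insert ''i'' (writes c)) \<sigma>0 \<sigma> \<Longrightarrow>
      bounded_state W \<sigma> \<Longrightarrow> safe W c \<sigma> \<and> I (Suc k) (eff c \<sigma>)"
  shows "\<exists>t \<tau>. exec W (For ''i'' (Var ''m'') c) \<sigma>0 t \<tau> \<and> I m \<tau> \<and> t \<le> (cost_bound c + 12) * (m + 1)"
proof -
  have "\<exists>t \<tau>. exec W (For ''i'' (Var ''m'') c) \<sigma>0 t \<tau> \<and> I m \<tau> \<and>
    t \<le> (\<Sum>k<m. cost_bound c + (expr_cost (Var ''m'') + 10)) + (expr_cost (Var ''m'') + 10)"
  proof (rule For_rule[where I = I])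
    show "bounded_state W \<sigma>0" "m < W" "1 < W" "''i'' \<notin> writes c" "I 0 \<sigma>0" using bd c init by auto
    show "\<And>k \<sigma> l. I k \<sigma> \<Longrightarrow> I k (store \<sigma> ''i'' 0 l)" by (rule indep)
  next
    fix k \<sigma> assume "agree (insert ''i'' (writes c)) \<sigma>0 \<sigma>" "bounded_state W \<sigma>"
    then show "expr_fits W (Var ''m'') \<sigma> \<and> expr_val (Var ''m'') \<sigma> = m"
      using agreeD[of "insert ''i'' (writes c)" \<sigma>0 \<sigma> "''m''"] c m by simp
  next
    fix k \<sigma> assume "k < m" "I k \<sigma>" "\<sigma> ''i'' 0 = k" "agree (insert ''i'' (writes c)) \<sigma>0 \<sigma>" "bounded_state W \<sigma>"
    from step[OF this] show "\<exists>t \<tau>. exec W c \<sigma> t \<tau> \<and> t \<le> cost_bound c \<and> I (Suc k) \<tau>"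
      using safe_exec by blast
  qed
  then obtain t \<tau> where t: "exec W (For ''i'' (Var ''m'') c) \<sigma>0 t \<tau>" "I m \<tau>"
    "t \<le> (\<Sum>k<m. cost_bound c + 12) + 12" by auto
  from t(3) have "t \<le> (cost_bound c + 12) * (m + 1)" by (simp add: algebra_simps)
  with t show ?thesis by blast
qed

lemma adj_correct:
  assumes bd: "bounded_state W \<sigma>0" and inp: "inputs \<sigma>0" and deg: "\<And>u. \<sigma>0 ''deg'' u = 0"
  shows "\<exists>t \<tau>. exec W (For ''i'' (Var ''m'') adj_step) \<sigma>0 t \<tau> \<and> layout \<tau> \<and>
    t \<le> (cost_bound adj_step + 12) * (m + 1)"
proof -
  define al where "al k u = map snd (filter (\<lambda>e. fst e = u) (take k as))" for k u
  define I where "I k \<sigma> \<longleftrightarrow> (\<forall>u<n. \<sigma> ''deg'' u = length (al k u) \<and>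
    (\<forall>j<length (al k u). \<sigma> ''adj'' (u * m + j) = al k u ! j))" for k and \<sigma> :: state
  have lal: "length (al k u) \<le> k" for k u
    using length_filter_le[of "\<lambda>e. fst e = u" "take k as"] by (simp add: al_def)
  have alS: "al (Suc k) u = al k u @ (if fst (as ! k) = u then [snd (as ! k)] else [])" if "k < m" for k u
    using that len by (simp add: al_def take_Suc_conv_app_nth)
  have "\<exists>t \<tau>. exec W (For ''i'' (Var ''m'') adj_step) \<sigma>0 t \<tau> \<and> I m \<tau> \<and>
    t \<le> (cost_bound adj_step + 12) * (m + 1)"
  proof (rule For_m_rule)
    show "\<sigma>0 ''m'' 0 = m" using inp by (simp add: inputs_def)
    show "I 0 \<sigma>0" using deg by (simp add: I_def al_def)
    show "\<And>k \<sigma> l. I k \<sigma> \<Longrightarrow> I k (store \<sigma> ''i'' 0 l)" by (simp add: I_def store_apply)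
  next
    fix k \<sigma> assume k: "k < m" and I: "I k \<sigma>" and i: "\<sigma> ''i'' 0 = k"
      and ag: "agree (insert ''i'' (writes adj_step)) \<sigma>0 \<sigma>" and bd: "bounded_state W \<sigma>"
    define a where "a = fst (as ! k)"
    define b where "b = snd (as ! k)"
    have inp: "inputs \<sigma>" using inp ag by (rule inputs_agree) simp
    have ab: "a < n" "b < n" using edge_nth[OF k] by (auto simp: a_def b_def)
    have g: "\<sigma> ''tail'' k = a" "\<sigma> ''head'' k = b" "\<sigma> ''m'' 0 = m" "\<sigma> ''deg'' a = length (al k a)"
      using inp k I ab by (auto simp: inputs_def a_def b_def I_def)
    define l where "l = length (al k a)"
    have l: "l < m" using lal[of k a] k by (simp add: l_def)
    have lW: "Suc l < W" "k < W" "l < W" using l k fits(3) by linarith+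
    have \<tau>: "eff adj_step \<sigma> ''deg'' = (\<sigma> ''deg'')(a := Suc l)"
      "eff adj_step \<sigma> ''adj'' = (\<sigma> ''adj'')(a * m + l := b)"
      by (simp_all add: adj_step_def store_apply i g l_def)
    have "safe W adj_step \<sigma>"
      using i g(1-3) g(4)[folded l_def] lW l lt_W'[OF ab(1)] lt_W'[OF ab(2)] ab
      by (simp add: adj_step_def store_apply)
    moreover have "I (Suc k) (eff adj_step \<sigma>)"
      unfolding I_def
    proof (intro allI impI conjI)
      fix u assume u: "u < n"
      show "eff adj_step \<sigma> ''deg'' u = length (al (Suc k) u)"
        using I u by (auto simp: I_def \<tau> alS[OF k] a_def[symmetric] l_def)
      fix j assume j: "j < length (al (Suc k) u)"
      \<comment> \<open>A row holds at most \<open>m\<close> entries, which makes the cell codes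
        \<open>u * m + j\<close> injective.\<close>
      then have jm: "j < m" using lal[of "Suc k" u] k by linarith
      show "eff adj_step \<sigma> ''adj'' (u * m + j) = al (Suc k) u ! j"
        using j I u pair_code_inj[OF jm l, of u a]
        by (auto simp: I_def \<tau> alS[OF k] a_def[symmetric] b_def[symmetric] l_def nth_append split: if_splits)
    qed
    ultimately show "safe W adj_step \<sigma> \<and> I (Suc k) (eff adj_step \<sigma>)" by simp
  qed (use bd in auto)
  then obtain t \<tau> where t: "exec W (For ''i'' (Var ''m'') adj_step) \<sigma>0 t \<tau>" "I m \<tau>"
    "t \<le> (cost_bound adj_step + 12) * (m + 1)" by blast
  have "inputs \<tau>" using inp exec_agree[OF t(1)] by (rule inputs_agree) simp
  moreover have "al m u = adj_list u" for u by (simp add: al_def adj_list_def len[symmetric])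
  ultimately have "layout \<tau>" using t(2) by (simp add: layout_def inputs_def I_def)
  with t show ?thesis by blast
qed

section \<open>Searching all copies at once\<close>

definition reach_matrix :: "state \<Rightarrow> bool" where
  "reach_matrix \<sigma> \<longleftrightarrow> (\<forall>w\<le>n. \<forall>y<n. \<sigma> ''R'' (w * n + y) = of_bool (avoids s (set as) w y))"

text \<open>Soundness only; that nothing is missed follows at the end of the search. Reachability is
  taken along all edges, as the forward ones are not known yet: being forward is itself a query to
  \<open>R\<close>.\<close>

definition search_inv :: "state \<Rightarrow> bool" where
  "search_inv \<sigma> \<longleftrightarrow> distinct (queue \<sigma>) \<and> set (queue \<sigma>) \<subseteq> alive (set as) \<and>
     (\<forall>w\<le>n. \<forall>y<n. \<sigma> ''R'' (w * n + y) = of_bool ((w, y) \<in> set (queue \<sigma>)))"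

lemma search_inv_agree:
  "search_inv \<sigma> \<Longrightarrow> agree X \<sigma> \<tau> \<Longrightarrow> X \<inter> {''R'', ''qw'', ''qx'', ''t''} = {} \<Longrightarrow> search_inv \<tau>"
  using queue_agree[of X \<sigma> \<tau>] agreeD[of X \<sigma> \<tau> "''R''"] by (auto simp: search_inv_def)

lemma alive_subset: "alive E \<subseteq> {..n} \<times> {..<n}"
  by (auto simp: alive_def)

lemma search_step_correct:
  assumes inv: "search_inv \<sigma>" and bd: "bounded_state W \<sigma>" and nn: "\<sigma> ''n'' 0 = n"
    and w: "\<sigma> ''w'' 0 = w" "w \<le> n" and y: "\<sigma> ''y'' 0 = y" "y < n"
    and av: "y \<noteq> w \<Longrightarrow> avoids s (set as) w y"
  shows "safe W search_step \<sigma>"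
    and "search_inv (eff search_step \<sigma>)"
    and "\<exists>r. queue (eff search_step \<sigma>) = queue \<sigma> @ r"
    and "y \<noteq> w \<Longrightarrow> (w, y) \<in> set (queue (eff search_step \<sigma>))"
proof -
  have Rwy: "\<sigma> ''R'' (w * n + y) = of_bool ((w, y) \<in> set (queue \<sigma>))"
    using inv w y by (simp add: search_inv_def)
  have len: "\<sigma> ''t'' 0 + 1 < W"
  proof -
    have "distinct (queue \<sigma>)" "set (queue \<sigma>) \<subseteq> {..n} \<times> {..<n}"
      using inv alive_subset[of "set as"] unfolding search_inv_def by blast+
    from queue_length_bound[OF this] show ?thesis using fits(9) by linarith
  qed
  define \<sigma>1 where "\<sigma>1 = store \<sigma> ''R'' (w * n + y) 1"
  define \<tau> where "\<tau> = eff search_step \<sigma>"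
  define new where "new \<longleftrightarrow> y \<noteq> w \<and> (w, y) \<notin> set (queue \<sigma>)"
  have \<tau>: "\<tau> = (if new then eff push \<sigma>1 else \<sigma>)"
    by (simp add: \<tau>_def search_step_def w y nn Rwy \<sigma>1_def new_def)
  have bd1: "bounded_state W \<sigma>1" unfolding \<sigma>1_def using bounded_state_store[OF bd] by simp
  have t1: "\<sigma>1 ''t'' = \<sigma> ''t''" by (simp add: \<sigma>1_def store_apply)
  show "safe W search_step \<sigma>"
    using safe_push[OF bd1, unfolded \<sigma>1_def] len w y nn lt_W[OF w(2)] lt_W'[OF y(2)] Rwy
    by (simp add: search_step_def store_apply)
  have q1: "queue \<sigma>1 = queue \<sigma>"
    by (rule queue_agree[of "{''R''}"]) (simp_all add: \<sigma>1_def agree_def store_apply)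
  have wy1: "\<sigma>1 ''w'' 0 = w" "\<sigma>1 ''y'' 0 = y" by (simp_all add: \<sigma>1_def store_apply w y)
  have q\<tau>: "queue \<tau> = queue \<sigma> @ (if new then [(w, y)] else [])"
    using queue_push[of \<sigma>1] by (auto simp: \<tau> q1 wy1)
  then show "\<exists>r. queue (eff search_step \<sigma>) = queue \<sigma> @ r" by (auto simp: \<tau>_def[symmetric])
  show "y \<noteq> w \<Longrightarrow> (w, y) \<in> set (queue (eff search_step \<sigma>))"
    by (auto simp: \<tau>_def[symmetric] q\<tau> new_def)
  have R: "\<tau> ''R'' = (if new then (\<sigma> ''R'')(w * n + y := 1) else \<sigma> ''R'')"
    using agreeD[OF agree_push[of \<sigma>1], of "''R''"] by (auto simp: \<tau> \<sigma>1_def store_apply)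
  have "\<tau> ''R'' (w' * n + y') = of_bool ((w', y') \<in> set (queue \<tau>))" if "w' \<le> n" "y' < n" for w' y'
    using inv that pair_code_inj[OF that(2) y(2), of w' w] by (auto simp: search_inv_def R q\<tau>)
  moreover have "distinct (queue \<tau>)" using inv by (auto simp: search_inv_def q\<tau> new_def)
  moreover have "set (queue \<tau>) \<subseteq> alive (set as)"
    using inv w y av by (auto simp: search_inv_def q\<tau> new_def alive_def)
  ultimately show "search_inv (eff search_step \<sigma>)" by (simp add: search_inv_def \<tau>_def[symmetric])
qed

lemma search_seed_correct:
  assumes bd: "bounded_state W \<sigma>0" and nn: "\<sigma>0 ''n'' 0 = n" and y: "\<sigma>0 ''y'' 0 = s"
    and inv: "search_inv \<sigma>0"
  shows "\<exists>t \<tau>. exec W (For ''w'' (Bin Plus (Var ''n'') (Const 1)) search_step) \<sigma>0 t \<tau> \<and> search_inv \<tau> \<and>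
    (\<forall>w\<le>n. w \<noteq> s \<longrightarrow> (w, s) \<in> set (queue \<tau>)) \<and> t \<le> (cost_bound search_step + 28) * (n + 1)"
proof -
  define I where "I k \<sigma> \<longleftrightarrow> search_inv \<sigma> \<and> (\<forall>w<k. w \<noteq> s \<longrightarrow> (w, s) \<in> set (queue \<sigma>))" for k \<sigma>
  have "\<exists>t \<tau>. exec W (For ''w'' (Bin Plus (Var ''n'') (Const 1)) search_step) \<sigma>0 t \<tau> \<and> I (n + 1) \<tau> \<and>
    t \<le> (\<Sum>k<n + 1. cost_bound search_step + (expr_cost (Bin Plus (Var ''n'') (Const 1)) + 10)) +
      (expr_cost (Bin Plus (Var ''n'') (Const 1)) + 10)"
  proof (rule For_rule[where I = I])
    show "bounded_state W \<sigma>0" "n + 1 < W" "1 < W" "''w'' \<notin> writes search_step" "I 0 \<sigma>0"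
      using bd inv by (simp_all add: I_def)
  next
    fix k \<sigma> l assume I: "I k \<sigma>"
    have a: "agree {''w''} \<sigma> (store \<sigma> ''w'' 0 l)" by (simp add: agree_def store_apply)
    then have "queue (store \<sigma> ''w'' 0 l) = queue \<sigma>" by (rule queue_agree) simp
    with I search_inv_agree[OF _ a] show "I k (store \<sigma> ''w'' 0 l)" by (simp add: I_def)
  next
    fix k \<sigma> assume "agree (insert ''w'' (writes search_step)) \<sigma>0 \<sigma>"
    from agreeD[OF this, of "''n''"] have "\<sigma> ''n'' 0 = n" using nn by simp
    then show "expr_fits W (Bin Plus (Var ''n'') (Const 1)) \<sigma> \<and>
      expr_val (Bin Plus (Var ''n'') (Const 1)) \<sigma> = n + 1" by simp
  next
    fix k \<sigma> assume k: "k < n + 1" and I: "I k \<sigma>" and w: "\<sigma> ''w'' 0 = k"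
      and ag: "agree (insert ''w'' (writes search_step)) \<sigma>0 \<sigma>" and bd: "bounded_state W \<sigma>"
    have nn: "\<sigma> ''n'' 0 = n" and y: "\<sigma> ''y'' 0 = s"
      using agreeD[OF ag, of "''n''"] agreeD[OF ag, of "''y''"] nn y by simp_all
    have inv: "search_inv \<sigma>" and kn: "k \<le> n" using I k by (simp_all add: I_def)
    note d = search_step_correct[OF inv bd nn w kn y start]
    have "I (Suc k) (eff search_step \<sigma>)" using d(2-4) I by (auto simp: I_def less_Suc_eq)
    then show "\<exists>t \<tau>. exec W search_step \<sigma> t \<tau> \<and> t \<le> cost_bound search_step \<and> I (Suc k) \<tau>"
      using safe_exec[OF d(1)] by auto
  qed
  then obtain t \<tau> where t: "exec W (For ''w'' (Bin Plus (Var ''n'') (Const 1)) search_step) \<sigma>0 t \<tau>"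
    "I (n + 1) \<tau>" "t \<le> (\<Sum>k<n + 1. cost_bound search_step + 14) + 14" by auto
  from t(3) have "t \<le> (cost_bound search_step + 28) * (n + 1)" by (simp add: algebra_simps)
  moreover have "search_inv \<tau> \<and> (\<forall>w\<le>n. w \<noteq> s \<longrightarrow> (w, s) \<in> set (queue \<tau>))"
    using t(2) by (simp add: I_def less_Suc_eq_le)
  ultimately show ?thesis using t(1) by blast
qed

lemma search_correct:
  assumes bd: "bounded_state W \<sigma>0" and ly: "layout \<sigma>0" and inv: "search_inv \<sigma>0"
    and seeds: "\<And>w. w \<le> n \<Longrightarrow> w \<noteq> s \<Longrightarrow> (w, s) \<in> set (queue \<sigma>0)"
  shows "\<exists>t \<tau>. exec W (worklist search_step) \<sigma>0 t \<tau> \<and> reach_matrix \<tau> \<and>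
    t \<le> 9 + (\<Sum>p\<in>alive (set as). weight (cost_bound search_step) p)"
proof -
  define Inv where "Inv D \<sigma> \<longleftrightarrow> search_inv \<sigma> \<and> (\<forall>w\<le>n. w \<noteq> s \<longrightarrow> (w, s) \<in> set (queue \<sigma>)) \<and>
    (\<forall>(w, x, y)\<in>D. y \<noteq> w \<longrightarrow> (w, y) \<in> set (queue \<sigma>))" for D :: "(nat \<times> nat \<times> nat) set" and \<sigma>
  have "\<exists>t \<tau>. exec W (worklist search_step) \<sigma>0 t \<tau> \<and> Inv (tokens (set (queue \<tau>))) \<tau> \<and>
    t \<le> 9 + (\<Sum>p\<in>set (queue \<tau>). weight (cost_bound search_step) p)"
  proof (rule worklist_rule[where Inv = Inv and U = "alive (set as)"])
    show "Inv {} \<sigma>0" using inv seeds by (simp add: Inv_def)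
    show "alive (set as) \<subseteq> {..n} \<times> {..<n}" by (rule alive_subset)
    show "\<And>D \<sigma>. Inv D \<sigma> \<Longrightarrow> distinct (queue \<sigma>) \<and> set (queue \<sigma>) \<subseteq> alive (set as)"
      by (simp add: Inv_def search_inv_def)
  next
    fix D \<sigma> \<tau> assume I: "Inv D \<sigma>" and a: "agree {''h'', ''j'', ''w'', ''x'', ''y''} \<sigma> \<tau>"
    have "queue \<tau> = queue \<sigma>" using a by (rule queue_agree) simp
    then show "Inv D \<tau>" using I search_inv_agree[OF _ a] by (simp add: Inv_def)
  next
    fix D \<sigma> w x y
    assume I: "Inv D \<sigma>" and bd: "bounded_state W \<sigma>" and ly: "layout \<sigma>"
      and wx: "(w, x) \<in> set (queue \<sigma>)" and xy: "(x, y) \<in> set as"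
      and v: "\<sigma> ''w'' 0 = w" "\<sigma> ''x'' 0 = x" "\<sigma> ''y'' 0 = y"
    have inv: "search_inv \<sigma>" and nn: "\<sigma> ''n'' 0 = n" using I ly by (simp_all add: Inv_def layout_def)
    have wx': "w \<le> n" "avoids s (set as) w x"
      using inv wx by (auto simp: search_inv_def alive_def)
    have yn: "y < n" using xy edges by auto
    have av: "y \<noteq> w \<Longrightarrow> avoids s (set as) w y" using avoids_step[OF wx'(2) xy] .
    note d = search_step_correct[OF inv bd nn v(1) wx'(1) v(3) yn av]
    obtain r where r: "queue (eff search_step \<sigma>) = queue \<sigma> @ r" using d(3) by blast
    have "Inv (insert (w, x, y) D) (eff search_step \<sigma>)"
      using d(2,4) I by (auto simp: Inv_def r)
    then show "\<exists>t \<tau> r. exec W search_step \<sigma> t \<tau> \<and> t \<le> cost_bound search_step \<and>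
      queue \<tau> = queue \<sigma> @ r \<and> Inv (insert (w, x, y) D) \<tau>"
      using safe_exec[OF d(1)] r by blast
  qed (use bd ly in auto)
  then obtain t \<tau> where t: "exec W (worklist search_step) \<sigma>0 t \<tau>" "Inv (tokens (set (queue \<tau>))) \<tau>"
    "t \<le> 9 + (\<Sum>p\<in>set (queue \<tau>). weight (cost_bound search_step) p)" by blast
  \<comment> \<open>Completeness: the vertices queued for copy \<open>w\<close> contain
    \<open>s\<close> and, all tokens being processed, are closed under edges that do not enter
    \<open>w\<close>.\<close>
  have "(w, y) \<in> set (queue \<tau>)" if "w \<le> n" "avoids s (set as) w y" for w y
    using that(2)
  proof (induction rule: avoids_induct)
    case start
    then show ?case using t(2) that(1) by (simp add: Inv_def)
  next
    case (step x y)
    then have "(w, x, y) \<in> tokens (set (queue \<tau>))" by (simp add: tokens_def set_adj_list)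
    then show ?case using t(2) step.hyps by (auto simp: Inv_def)
  qed
  then have q: "set (queue \<tau>) = alive (set as)"
    using t(2) by (auto simp: Inv_def search_inv_def alive_def)
  have "reach_matrix \<tau>"
    using t(2) by (auto simp: Inv_def search_inv_def q reach_matrix_def alive_def)
  with t(1,3) q show ?thesis by auto
qed

section \<open>Forward bits and initial counters\<close>

lemma forward_correct:
  assumes bd: "bounded_state W \<sigma>0" and inp: "inputs \<sigma>0" and R: "reach_matrix \<sigma>0"
    and F: "\<And>i. \<sigma>0 ''F'' i = 0"
  shows "\<exists>t \<tau>. exec W (For ''i'' (Var ''m'') forward_step) \<sigma>0 t \<tau> \<and> forward_matrix F0 \<tau> \<and>
    t \<le> (cost_bound forward_step + 12) * (m + 1)"
proof -
  define I where "I k \<sigma> \<longleftrightarrow> forward_matrix (set (take k as) \<inter> F0) \<sigma>" for k \<sigma>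
  have "\<exists>t \<tau>. exec W (For ''i'' (Var ''m'') forward_step) \<sigma>0 t \<tau> \<and> I m \<tau> \<and>
    t \<le> (cost_bound forward_step + 12) * (m + 1)"
  proof (rule For_m_rule)
    show "\<sigma>0 ''m'' 0 = m" using inp by (simp add: inputs_def)
    show "I 0 \<sigma>0" using F by (simp add: I_def forward_matrix_def)
    show "\<And>k \<sigma> l. I k \<sigma> \<Longrightarrow> I k (store \<sigma> ''i'' 0 l)" by (simp add: I_def forward_matrix_def store_apply)
  next
    fix k \<sigma> assume k: "k < m" and I: "I k \<sigma>" and i: "\<sigma> ''i'' 0 = k"
      and ag: "agree (insert ''i'' (writes forward_step)) \<sigma>0 \<sigma>" and bd: "bounded_state W \<sigma>"
    define a where "a = fst (as ! k)"
    define b where "b = snd (as ! k)"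
    have inp: "inputs \<sigma>" using inp ag by (rule inputs_agree) simp
    have ab: "a < n" "b < n" using edge_nth[OF k] by (auto simp: a_def b_def)
    have g: "\<sigma> ''tail'' k = a" "\<sigma> ''head'' k = b" "\<sigma> ''n'' 0 = n"
      using inp k by (auto simp: inputs_def a_def b_def)
    have ask: "as ! k = (a, b)" by (simp add: a_def b_def)
    then have E: "(a, b) \<in> set as" using k len by (metis nth_mem)
    have "\<sigma> ''R'' (b * n + a) = of_bool (avoids s (set as) b a)"
      using R agreeD[OF ag, of "''R''"] ab by (simp add: reach_matrix_def)
    also have "avoids s (set as) b a \<longleftrightarrow> (a, b) \<in> F0" using E by (simp add: forward_edges_def)
    finally have Rba: "\<sigma> ''R'' (b * n + a) = of_bool ((a, b) \<in> F0)" .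
    have kW: "k < W" using k fits(3) by linarith
    have \<tau>: "eff forward_step \<sigma> ''F'' = (\<sigma> ''F'')(a * n + b := of_bool ((a, b) \<in> F0))"
      by (simp add: forward_step_def store_apply i g Rba)
    have "safe W forward_step \<sigma>"
      using i g kW lt_W'[OF ab(1)] lt_W'[OF ab(2)] ab Rba by (simp add: forward_step_def)
    moreover have "I (Suc k) (eff forward_step \<sigma>)"
      using I pair_code_inj[OF _ ab(2)]
      by (auto simp: I_def forward_matrix_def \<tau> take_edges[OF k, unfolded ask])
    ultimately show "safe W forward_step \<sigma> \<and> I (Suc k) (eff forward_step \<sigma>)" by simp
  qed (use bd in auto)
  moreover have "set (take m as) \<inter> F0 = F0" using F0_subset len by auto
  ultimately show ?thesis by (simp add: I_def)
qed

text \<open>The counter after the edges in \<open>A\<close> have been looked at. Reachability of the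
  tails refers to the complete edge set from the outset.\<close>

definition edge_count :: "nat rel \<Rightarrow> nat \<Rightarrow> nat \<Rightarrow> nat" where
  "edge_count A w y = (if y = w then 0 else if y = s then 1
     else card {x. (x, y) \<in> A \<and> (x, y) \<in> F0 \<and> avoids s (set as) w x})"

lemma count_row_correct:
  assumes bd: "bounded_state W \<sigma>0" and inp: "inputs \<sigma>0" and R: "reach_matrix \<sigma>0"
    and fm: "forward_matrix F0 \<sigma>0" and w: "\<sigma>0 ''w'' 0 = w" "w \<le> n"
    and K: "\<And>w' y. y < n \<Longrightarrow> \<sigma>0 ''K'' (w' * n + y) = (if w' = w then edge_count {} w y else K0 w' y)"
  shows "\<exists>t \<tau>. exec W (For ''i'' (Var ''m'') count_step) \<sigma>0 t \<tau> \<and>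
    (\<forall>w'. \<forall>y<n. \<tau> ''K'' (w' * n + y) = (if w' = w then edge_count (set as) w y else K0 w' y)) \<and>
    t \<le> (cost_bound count_step + 12) * (m + 1)"
proof -
  define I where "I k \<sigma> \<longleftrightarrow> (\<forall>w'. \<forall>y<n. \<sigma> ''K'' (w' * n + y) =
    (if w' = w then edge_count (set (take k as)) w y else K0 w' y))" for k and \<sigma> :: state
  have "\<exists>t \<tau>. exec W (For ''i'' (Var ''m'') count_step) \<sigma>0 t \<tau> \<and> I m \<tau> \<and>
    t \<le> (cost_bound count_step + 12) * (m + 1)"
  proof (rule For_m_rule)
    show "\<sigma>0 ''m'' 0 = m" using inp by (simp add: inputs_def)
    show "I 0 \<sigma>0" using K by (simp add: I_def)
    show "\<And>k \<sigma> l. I k \<sigma> \<Longrightarrow> I k (store \<sigma> ''i'' 0 l)" by (simp add: I_def store_apply)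
  next
    fix k \<sigma> assume k: "k < m" and I: "I k \<sigma>" and i: "\<sigma> ''i'' 0 = k"
      and ag: "agree (insert ''i'' (writes count_step)) \<sigma>0 \<sigma>" and bd: "bounded_state W \<sigma>"
    define a where "a = fst (as ! k)"
    define b where "b = snd (as ! k)"
    have ask: "as ! k = (a, b)" by (simp add: a_def b_def)
    have inp: "inputs \<sigma>" using inp ag by (rule inputs_agree) simp
    have ab: "a < n" "b < n" using edge_nth[OF k] by (auto simp: a_def b_def)
    have g: "\<sigma> ''tail'' k = a" "\<sigma> ''head'' k = b" "\<sigma> ''n'' 0 = n" "\<sigma> ''w'' 0 = w"
      using inp k agreeD[OF ag, of "''w''"] w by (auto simp: inputs_def a_def b_def)
    have Rwa: "\<sigma> ''R'' (w * n + a) = of_bool (avoids s (set as) w a)"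
      using R agreeD[OF ag, of "''R''"] ab w by (simp add: reach_matrix_def)
    have Fab: "\<sigma> ''F'' (a * n + b) = of_bool ((a, b) \<in> F0)"
      using fm agreeD[OF ag, of "''F''"] ab by (simp add: forward_matrix_def)
    have kW: "k < W" using k fits(3) by linarith
    define hit where "hit \<longleftrightarrow> (a, b) \<in> F0 \<and> avoids s (set as) w a \<and> b \<noteq> w"
    define c where "c = edge_count (set (take k as)) w b"
    have Kwb: "\<sigma> ''K'' (w * n + b) = c" using I ab by (simp add: I_def c_def)
    have \<tau>: "eff count_step \<sigma> ''K'' = (if hit then (\<sigma> ''K'')(w * n + b := Suc c) else \<sigma> ''K'')"
      by (simp add: count_step_def store_apply i g Rwa Fab hit_def Kwb)
    \<comment> \<open>A counter counts distinct vertices, so it fits into a word even after the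
      increment.\<close>
    have cn: "c \<le> n"
    proof -
      have "card {x. (x, b) \<in> set (take k as) \<and> (x, b) \<in> F0 \<and> avoids s (set as) w x} \<le> card {..<n}"
        by (rule card_mono) (use F0_bounds in auto)
      then show ?thesis using start by (auto simp: c_def edge_count_def)
    qed
    then have cW: "c < W" "Suc c < W" using fits_Suc(3) by linarith+
    have "safe W count_step \<sigma>"
      using i g kW lt_W'[OF ab(1)] lt_W'[OF ab(2)] lt_W[OF w(2)] ab w Rwa Fab Kwb cW
      by (simp add: count_step_def)
    moreover have "I (Suc k) (eff count_step \<sigma>)"
      unfolding I_def
    proof (intro allI impI)
      fix w' y assume y: "y < n"
      show "eff count_step \<sigma> ''K'' (w' * n + y) =
        (if w' = w then edge_count (set (take (Suc k) as)) w y else K0 w' y)"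
      proof (cases "w' = w \<and> y = b \<and> hit")
        case True
        \<comment> \<open>The edge list has no repetitions, so counting list positions amounts to
          counting predecessors.\<close>
        have new: "(a, b) \<notin> set (take k as)"
        proof
          assume "(a, b) \<in> set (take k as)"
          then obtain j where "j < k" "as ! j = as ! k"
            using k len by (auto simp: in_set_conv_nth ask)
          with dist k len show False by (simp add: nth_eq_iff_index_eq)
        qed
        have bs: "b \<noteq> s" "b \<noteq> w" using True F0_bounds by (auto simp: hit_def)
        define X where "X = {x. (x, b) \<in> set (take k as) \<and> (x, b) \<in> F0 \<and> avoids s (set as) w x}"
        have "finite X" by (rule finite_subset[of _ "{..<n}"]) (use F0_bounds in \<open>auto simp: X_def\<close>)
        moreover have "a \<notin> X" using new by (simp add: X_def)
        moreover have "{x. (x, b) \<in> set (take (Suc k) as) \<and> (x, b) \<in> F0 \<and> avoids s (set as) w x} = insert a X"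
          using True by (auto simp: X_def hit_def take_edges[OF k, unfolded ask])
        ultimately have "edge_count (set (take (Suc k) as)) w b = Suc c"
          using bs by (simp add: edge_count_def c_def X_def[symmetric])
        then show ?thesis using True by (simp add: \<tau>)
      next
        case False
        have "eff count_step \<sigma> ''K'' (w' * n + y) = \<sigma> ''K'' (w' * n + y)"
          using False pair_code_inj[OF y ab(2), of w' w] by (auto simp: \<tau>)
        moreover have "edge_count (set (take (Suc k) as)) w y = edge_count (set (take k as)) w y" if "w' = w"
        proof -
          have "y = w \<or> {x. (x, y) \<in> set (take (Suc k) as) \<and> (x, y) \<in> F0 \<and> avoids s (set as) w x} =
            {x. (x, y) \<in> set (take k as) \<and> (x, y) \<in> F0 \<and> avoids s (set as) w x}"
            using False that by (auto simp: hit_def take_edges[OF k, unfolded ask])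
          then show ?thesis by (auto simp: edge_count_def)
        qed
        ultimately show ?thesis using I y by (simp add: I_def)
      qed
    qed
    ultimately show "safe W count_step \<sigma> \<and> I (Suc k) (eff count_step \<sigma>)" by simp
  qed (use bd in auto)
  moreover have "take m as = as" by (simp add: len[symmetric])
  ultimately show ?thesis by (simp only: I_def)
qed

lemma count_correct:
  assumes bd: "bounded_state W \<sigma>0" and inp: "inputs \<sigma>0" and R: "reach_matrix \<sigma>0"
    and fm: "forward_matrix F0 \<sigma>0" and K: "\<And>i. \<sigma>0 ''K'' i = 0"
  shows "\<exists>t \<tau>. exec W (For ''w'' (Bin Plus (Var ''n'') (Const 1))
      (Seq count_start (For ''i'' (Var ''m'') count_step))) \<sigma>0 t \<tau> \<and>
    counts {(w, x, y). w \<le> n \<and> (x, y) \<in> F0 \<and> avoids s F0 w x} \<tau> \<and>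
    t \<le> (cost_bound count_start + cost_bound count_step + 40) * ((n + 1) * (m + 1))"
proof -
  define body where "body = Seq count_start (For ''i'' (Var ''m'') count_step)"
  define I where "I k \<sigma> \<longleftrightarrow> (\<forall>w'. \<forall>y<n. \<sigma> ''K'' (w' * n + y) =
    (if w' < k then edge_count (set as) w' y else 0))" for k and \<sigma> :: state
  define B where "B = cost_bound count_start + (cost_bound count_step + 12) * (m + 1)"
  have "\<exists>t \<tau>. exec W (For ''w'' (Bin Plus (Var ''n'') (Const 1)) body) \<sigma>0 t \<tau> \<and> I (n + 1) \<tau> \<and>
    t \<le> (\<Sum>k<n + 1. B + (expr_cost (Bin Plus (Var ''n'') (Const 1)) + 10)) +
      (expr_cost (Bin Plus (Var ''n'') (Const 1)) + 10)"
  proof (rule For_rule[where I = I])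
    show "bounded_state W \<sigma>0" "n + 1 < W" "1 < W" "''w'' \<notin> writes body" using bd by (simp_all add: body_def)
    show "I 0 \<sigma>0" using K by (simp add: I_def)
    show "\<And>k \<sigma> l. I k \<sigma> \<Longrightarrow> I k (store \<sigma> ''w'' 0 l)" by (simp add: I_def store_apply)
  next
    fix k \<sigma> assume "agree (insert ''w'' (writes body)) \<sigma>0 \<sigma>"
    from agreeD[OF this, of "''n''"] have "\<sigma> ''n'' 0 = n" using inp by (simp add: inputs_def body_def)
    then show "expr_fits W (Bin Plus (Var ''n'') (Const 1)) \<sigma> \<and>
      expr_val (Bin Plus (Var ''n'') (Const 1)) \<sigma> = n + 1" by simp
  next
    fix k \<sigma> assume k: "k < n + 1" and I: "I k \<sigma>" and w: "\<sigma> ''w'' 0 = k"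
      and ag': "agree (insert ''w'' (writes body)) \<sigma>0 \<sigma>" and bd: "bounded_state W \<sigma>"
    have ag: "agree {''w'', ''i'', ''K''} \<sigma>0 \<sigma>" using ag' by (rule agree_mono) (auto simp: body_def)
    have kn: "k \<le> n" using k by simp
    have inp1: "inputs \<sigma>" using inp ag by (rule inputs_agree) simp
    have g: "\<sigma> ''n'' 0 = n" "\<sigma> ''s'' 0 = s" using inp1 by (simp_all add: inputs_def)
    define \<sigma>1 where "\<sigma>1 = eff count_start \<sigma>"
    have "safe W count_start \<sigma>"
      using w g kn start lt_W[OF kn] lt_W'[OF start] by (simp add: count_start_def)
    then obtain t1 where t1: "exec W count_start \<sigma> t1 \<sigma>1" "t1 \<le> cost_bound count_start"
      using safe_exec \<sigma>1_def by blast
    have a1: "agree {''K''} \<sigma> \<sigma>1" using exec_agree[OF t1(1)] by simp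
    have a01: "agree {''w'', ''i'', ''K''} \<sigma>0 \<sigma>1" using ag a1 by (rule agree_trans) auto
    have K1: "\<sigma>1 ''K'' = (if k = s then \<sigma> ''K'' else (\<sigma> ''K'')(k * n + s := 1))"
      by (simp add: \<sigma>1_def count_start_def w g store_apply)
    have "\<exists>t \<tau>. exec W (For ''i'' (Var ''m'') count_step) \<sigma>1 t \<tau> \<and>
      (\<forall>w'. \<forall>y<n. \<tau> ''K'' (w' * n + y) = (if w' = k then edge_count (set as) k y
        else if w' < k then edge_count (set as) w' y else 0)) \<and>
      t \<le> (cost_bound count_step + 12) * (m + 1)"
    proof (rule count_row_correct)
      show "bounded_state W \<sigma>1" using exec_bounded[OF t1(1) bd] .
      show "inputs \<sigma>1" using inp1 a1 by (rule inputs_agree) simp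
      show "reach_matrix \<sigma>1" using R agreeD[OF a01, of "''R''"] by (simp add: reach_matrix_def)
      show "forward_matrix F0 \<sigma>1" using fm agreeD[OF a01, of "''F''"] by (simp add: forward_matrix_def)
      show "\<sigma>1 ''w'' 0 = k" using agreeD[OF a1, of "''w''"] w by simp
      show "k \<le> n" using kn .
      fix w' y assume y: "y < n"
      show "\<sigma>1 ''K'' (w' * n + y) = (if w' = k then edge_count {} k y
        else if w' < k then edge_count (set as) w' y else 0)"
      proof -
        have "\<sigma>1 ''K'' (w' * n + y) = (if k \<noteq> s \<and> w' = k \<and> y = s then 1 else \<sigma> ''K'' (w' * n + y))"
          using pair_code_inj[OF y start, of w' k] by (simp add: K1)
        moreover have "\<sigma> ''K'' (w' * n + y) = (if w' < k then edge_count (set as) w' y else 0)"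
          using I y by (simp add: I_def)
        moreover have "edge_count {} k y = (if k \<noteq> s \<and> y = s then 1 else 0)"
          by (simp add: edge_count_def)
        ultimately show ?thesis by (cases "w' = k"; cases "k = s") simp_all
      qed
    qed
    then obtain t2 \<tau> where t2: "exec W (For ''i'' (Var ''m'') count_step) \<sigma>1 t2 \<tau>"
      "\<forall>w'. \<forall>y<n. \<tau> ''K'' (w' * n + y) = (if w' = k then edge_count (set as) k y
        else if w' < k then edge_count (set as) w' y else 0)"
      "t2 \<le> (cost_bound count_step + 12) * (m + 1)" by blast
    have "I (Suc k) \<tau>" using t2(2) by (auto simp: I_def)
    moreover have "exec W body \<sigma> (t1 + t2) \<tau>" unfolding body_def by (rule exec.Seq[OF t1(1) t2(1)])
    ultimately show "\<exists>t \<tau>. exec W body \<sigma> t \<tau> \<and> t \<le> B \<and> I (Suc k) \<tau>"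
      using t1(2) t2(3) by (intro exI[of _ "t1 + t2"] exI[of _ \<tau>]) (simp add: B_def)
  qed
  then obtain t \<tau> where t: "exec W (For ''w'' (Bin Plus (Var ''n'') (Const 1)) body) \<sigma>0 t \<tau>"
    "I (n + 1) \<tau>" "t \<le> (\<Sum>k<n + 1. B + 14) + 14" by auto
  \<comment> \<open>The search followed all edges, while the counters refer to forward edges; both
    reach the same vertices in every copy.\<close>
  have av: "avoids s F0 w x \<longleftrightarrow> avoids s (set as) w x" for w x
    using avoids_forward_edges[of "set as" "set as" s w x] F0_subset by (simp add: Int_absorb1)
  have "counts {(w, x, y). w \<le> n \<and> (x, y) \<in> F0 \<and> avoids s F0 w x} \<tau>"
    unfolding counts_def
  proof (intro allI impI)
    fix w y assume wy: "w \<le> n" "y < n"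
    have "{x. (x, y) \<in> set as \<and> (x, y) \<in> F0 \<and> avoids s (set as) w x} =
      {x. (w, x, y) \<in> {(w, x, y). w \<le> n \<and> (x, y) \<in> F0 \<and> avoids s F0 w x}}"
      using F0_subset wy by (auto simp: av)
    then show "\<tau> ''K'' (w * n + y) = (if y = w then 0 else if y = s then 1
      else card {x. (w, x, y) \<in> {(w, x, y). w \<le> n \<and> (x, y) \<in> F0 \<and> avoids s F0 w x}})"
      using t(2) wy by (simp add: I_def edge_count_def)
  qed
  moreover have "t \<le> (cost_bound count_start + cost_bound count_step + 40) * ((n + 1) * (m + 1))"
    using t(3) by (simp add: B_def algebra_simps)
  ultimately show ?thesis using t(1) unfolding body_def by blast
qed

section \<open>The initial dominator tree\<close>

lemma tree_row_correct:
  assumes bd: "bounded_state W \<sigma>0" and nn: "\<sigma>0 ''n'' 0 = n" and R: "reach_matrix \<sigma>0"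
    and v: "\<sigma>0 ''v'' 0 = v" "v < n" "avoids s (set as) n v" and p: "\<sigma>0 ''parent'' v = s"
  shows "\<exists>t \<tau>. exec W (For ''w'' (Var ''n'') tree_step) \<sigma>0 t \<tau> \<and>
    (\<forall>v'. v' \<noteq> v \<longrightarrow> \<tau> ''parent'' v' = \<sigma>0 ''parent'' v') \<and> \<tau> ''parent'' v < n \<and>
    (v \<noteq> s \<longrightarrow> idom s (set as) {..<n} (\<tau> ''parent'' v) v) \<and>
    t \<le> (cost_bound tree_step + 12) * (n + 1)"
proof -
  define I where "I k \<sigma> \<longleftrightarrow> (\<forall>v'. v' \<noteq> v \<longrightarrow> \<sigma> ''parent'' v' = \<sigma>0 ''parent'' v') \<and> \<sigma> ''parent'' v < n \<and>
    (v \<noteq> s \<longrightarrow> idom s (set as) {..<k} (\<sigma> ''parent'' v) v)" for k and \<sigma> :: state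
  have vr: "(s, v) \<in> (set as)\<^sup>*" using v(3) avoids_n[of "set as" v] by simp
  have "\<exists>t \<tau>. exec W (For ''w'' (Var ''n'') tree_step) \<sigma>0 t \<tau> \<and> I n \<tau> \<and>
    t \<le> (\<Sum>k<n. cost_bound tree_step + (expr_cost (Var ''n'') + 10)) + (expr_cost (Var ''n'') + 10)"
  proof (rule For_rule[where I = I])
    show "bounded_state W \<sigma>0" "n < W" "1 < W" "''w'' \<notin> writes tree_step" using bd by simp_all
    \<comment> \<open>Without competitors, \<open>s\<close> is a valid first candidate because it
      dominates every vertex.\<close>
    show "I 0 \<sigma>0" using p start idom_start by (simp add: I_def)
    show "\<And>k \<sigma> l. I k \<sigma> \<Longrightarrow> I k (store \<sigma> ''w'' 0 l)" by (simp add: I_def store_apply)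
  next
    fix k \<sigma> assume "agree (insert ''w'' (writes tree_step)) \<sigma>0 \<sigma>"
    from agreeD[OF this, of "''n''"] show "expr_fits W (Var ''n'') \<sigma> \<and> expr_val (Var ''n'') \<sigma> = n"
      using nn by simp
  next
    fix k \<sigma> assume k: "k < n" and I: "I k \<sigma>" and w: "\<sigma> ''w'' 0 = k"
      and ag: "agree (insert ''w'' (writes tree_step)) \<sigma>0 \<sigma>" and bd: "bounded_state W \<sigma>"
    define p where "p = \<sigma> ''parent'' v"
    have pn: "p < n" using I by (simp add: I_def p_def)
    have g: "\<sigma> ''n'' 0 = n" "\<sigma> ''v'' 0 = v"
      using agreeD[OF ag, of "''n''"] agreeD[OF ag, of "''v''"] nn v by simp_all
    have Rk: "\<sigma> ''R'' (k * n + v) = of_bool (avoids s (set as) k v)"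
      "\<sigma> ''R'' (p * n + k) = of_bool (avoids s (set as) p k)"
      using R agreeD[OF ag, of "''R''"] k v pn by (simp_all add: reach_matrix_def)
    define hit where "hit \<longleftrightarrow> k \<noteq> v \<and> \<not> avoids s (set as) k v"
    have \<tau>: "eff tree_step \<sigma> ''parent'' =
      (if hit \<and> \<not> avoids s (set as) p k then (\<sigma> ''parent'')(v := k) else \<sigma> ''parent'')"
      by (simp add: tree_step_def store_apply w g Rk p_def[symmetric] hit_def)
    have "safe W tree_step \<sigma>"
      using w g k v pn Rk lt_W'[OF k] lt_W'[OF v(2)] lt_W'[OF pn] p_def[symmetric]
      by (simp add: tree_step_def)
    moreover have "I (Suc k) (eff tree_step \<sigma>)"
    proof -
      have "idom s (set as) {..<Suc k} (eff tree_step \<sigma> ''parent'' v) v" if "v \<noteq> s"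
      proof (cases hit)
        case True
        have "eff tree_step \<sigma> ''parent'' v = (if avoids s (set as) p k then p else k)"
          using True by (simp add: \<tau> p_def)
        then show ?thesis using idom_insert[OF _ vr, of "{..<k}" p k] I True that
          by (simp add: I_def p_def hit_def lessThan_Suc)
      next
        case False
        then have "eff tree_step \<sigma> ''parent'' v = p" by (simp add: \<tau> p_def)
        then show ?thesis using idom_skip[of s "set as" "{..<k}" p v k] I False that
          by (auto simp: I_def p_def hit_def lessThan_Suc)
      qed
      then show ?thesis using I k by (auto simp: I_def \<tau>)
    qed
    ultimately show "\<exists>t \<tau>. exec W tree_step \<sigma> t \<tau> \<and> t \<le> cost_bound tree_step \<and> I (Suc k) \<tau>"
      using safe_exec by blast
  qed
  then obtain t \<tau> where t: "exec W (For ''w'' (Var ''n'') tree_step) \<sigma>0 t \<tau>" "I n \<tau>"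
    "t \<le> (\<Sum>k<n. cost_bound tree_step + 12) + 12" by auto
  from t(3) have "t \<le> (cost_bound tree_step + 12) * (n + 1)" by (simp add: algebra_simps)
  with t show ?thesis by (auto simp: I_def)
qed

text \<open>A reached vertex other than \<open>s\<close> is the head of an edge. This is what turns
  bounds of order \<open>n * n\<close> into bounds of order \<open>m * n\<close> when most vertices
  are isolated.\<close>

lemma card_reached: "card {x. x < n \<and> avoids s E w x} \<le> m + 1" if "E \<subseteq> set as"
proof -
  have "{x. x < n \<and> avoids s E w x} \<subseteq> insert s (snd ` set as)"
  proof
    fix x assume "x \<in> {x. x < n \<and> avoids s E w x}"
    then have x: "avoids s E w x" by simp
    show "x \<in> insert s (snd ` set as)"
    proof (cases "x = s")
      case False
      then obtain y where "(y, x) \<in> E" using avoids_last[OF x] by blast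
      with that show ?thesis by force
    qed simp
  qed
  then have "card {x. x < n \<and> avoids s E w x} \<le> card (insert s (snd ` set as))"
    by (rule card_mono[rotated]) simp
  also have "\<dots> \<le> Suc (card (snd ` set as))" by (rule card_insert_le_m1) simp_all
  also have "card (snd ` set as) \<le> m"
    using card_image_le[of "set as" snd] card_length[of as] len by simp
  finally show ?thesis by simp
qed

lemma tree_correct:
  assumes bd: "bounded_state W \<sigma>0" and nn: "\<sigma>0 ''n'' 0 = n" "\<sigma>0 ''s'' 0 = s" and R: "reach_matrix \<sigma>0"
    and p: "\<And>v. \<sigma>0 ''parent'' v = 0"
  shows "\<exists>t \<tau>. exec W (For ''v'' (Var ''n'') tree_body) \<sigma>0 t \<tau> \<and> tree_ok (set as) \<tau> \<and>
    t \<le> (cost_bound tree_step + 100) * ((n + 1) * (m + 1))"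
proof -
  define I where "I k \<sigma> \<longleftrightarrow> (\<forall>v<n. \<sigma> ''parent'' v < n) \<and> (\<forall>v<k. (\<sigma> ''in_tree'' v \<noteq> 0 \<longleftrightarrow> avoids s (set as) n v) \<and>
    (v \<noteq> s \<and> avoids s (set as) n v \<longrightarrow> idom s (set as) {..<n} (\<sigma> ''parent'' v) v))" for k and \<sigma> :: state
  \<comment> \<open>A cost depending on the vertex, so that the sum over all rounds contains the
    expensive part at most \<open>m + 1\<close> times.\<close>
  define B where "B v = 30 + (if avoids s (set as) n v then (cost_bound tree_step + 12) * (n + 1) else 0)" for v
  have "\<exists>t \<tau>. exec W (For ''v'' (Var ''n'') tree_body) \<sigma>0 t \<tau> \<and> I n \<tau> \<and>
    t \<le> (\<Sum>k<n. B k + (expr_cost (Var ''n'') + 10)) + (expr_cost (Var ''n'') + 10)"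
  proof (rule For_rule[where I = I])
    show "bounded_state W \<sigma>0" "n < W" "1 < W" "''v'' \<notin> writes tree_body" using bd by simp_all
    show "I 0 \<sigma>0" using p start by (simp add: I_def)
    show "\<And>k \<sigma> l. I k \<sigma> \<Longrightarrow> I k (store \<sigma> ''v'' 0 l)" by (simp add: I_def store_apply)
  next
    fix k \<sigma> assume "agree (insert ''v'' (writes tree_body)) \<sigma>0 \<sigma>"
    from agreeD[OF this, of "''n''"] show "expr_fits W (Var ''n'') \<sigma> \<and> expr_val (Var ''n'') \<sigma> = n"
      using nn by simp
  next
    fix k \<sigma> assume k: "k < n" and I: "I k \<sigma>" and v: "\<sigma> ''v'' 0 = k"
      and ag: "agree (insert ''v'' (writes tree_body)) \<sigma>0 \<sigma>" and bd: "bounded_state W \<sigma>"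
    have g: "\<sigma> ''n'' 0 = n" "\<sigma> ''s'' 0 = s"
      using agreeD[OF ag, of "''n''"] agreeD[OF ag, of "''s''"] nn by simp_all
    define c1 where "c1 = Assign ''in_tree'' (Var ''v'') (Cell ''R'' (index (Var ''n'') (Var ''v'')))"
    define b where "b = Equal (Cell ''in_tree'' (Var ''v'')) (Const 1)"
    define c2 where "c2 = Assign ''parent'' (Var ''v'') (Var ''s'')"
    have body: "tree_body = Seq c1 (If b (Seq c2 (For ''w'' (Var ''n'') tree_step)) Skip)"
      by (simp add: tree_body_def c1_def b_def c2_def)
    have Rk: "\<sigma> ''R'' (n * n + k) = of_bool (avoids s (set as) n k)"
      using R agreeD[OF ag, of "''R''"] k by (simp add: reach_matrix_def)
    define \<sigma>1 where "\<sigma>1 = eff c1 \<sigma>"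
    have kW: "k < W" using lt_W'[OF k] .
    have "safe W c1 \<sigma>" using v g k kW Rk by (simp add: c1_def)
    then obtain t1 where t1: "exec W c1 \<sigma> t1 \<sigma>1" "t1 \<le> cost_bound c1"
      using safe_exec \<sigma>1_def by blast
    have s1: "\<sigma>1 ''in_tree'' = (\<sigma> ''in_tree'')(k := of_bool (avoids s (set as) n k))"
      by (simp add: \<sigma>1_def c1_def store_apply v g Rk)
    have a1: "agree {''in_tree''} \<sigma> \<sigma>1" using exec_agree[OF t1(1)] by (simp add: c1_def)
    have g1: "\<sigma>1 ''n'' 0 = n" "\<sigma>1 ''s'' 0 = s" "\<sigma>1 ''v'' 0 = k" "\<sigma>1 ''parent'' = \<sigma> ''parent''" "\<sigma>1 ''R'' = \<sigma>0 ''R''"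
      using a1 g v agreeD[OF ag, of "''R''"] by (simp_all add: agree_def)
    have bfit: "cond_fits W b \<sigma>1" using g1 kW s1 by (simp add: b_def)
    have bval: "cond_val b \<sigma>1 \<longleftrightarrow> avoids s (set as) n k" using g1 s1 by (simp add: b_def)
    have bd1: "bounded_state W \<sigma>1" using exec_bounded[OF t1(1) bd] .
    have cb: "cost_bound c1 = 12" "cost_bound c2 = 5" "cond_cost b = 5"
      by (simp_all add: c1_def c2_def b_def)
    show "\<exists>t \<tau>. exec W tree_body \<sigma> t \<tau> \<and> t \<le> B k \<and> I (Suc k) \<tau>"
    proof (cases "avoids s (set as) n k")
      case False
      have "exec W tree_body \<sigma> (t1 + (1 + cond_cost b + 1)) \<sigma>1"
        unfolding body by (rule exec.Seq[OF t1(1) exec.IfFalse[OF bfit _ exec.Skip]]) (use bval False in simp)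
      moreover have "I (Suc k) \<sigma>1" using I False s1 g1 by (auto simp: I_def less_Suc_eq)
      ultimately show ?thesis using t1(2) cb by (intro exI[of _ "t1 + (1 + cond_cost b + 1)"] exI[of _ \<sigma>1]) (simp add: B_def)
    next
      case True
      define \<sigma>2 where "\<sigma>2 = eff c2 \<sigma>1"
      have "safe W c2 \<sigma>1" using g1 kW lt_W'[OF start] by (simp add: c2_def)
      then obtain t2 where t2: "exec W c2 \<sigma>1 t2 \<sigma>2" "t2 \<le> cost_bound c2"
        using safe_exec \<sigma>2_def by blast
      have a2: "agree {''parent''} \<sigma>1 \<sigma>2" using exec_agree[OF t2(1)] by (simp add: c2_def)
      have s2: "\<sigma>2 ''parent'' = (\<sigma> ''parent'')(k := s)"
        by (simp add: \<sigma>2_def c2_def store_apply g1)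
      have g2: "\<sigma>2 ''n'' 0 = n" "\<sigma>2 ''v'' 0 = k" "\<sigma>2 ''in_tree'' = \<sigma>1 ''in_tree''" "\<sigma>2 ''R'' = \<sigma>0 ''R''"
        using a2 g1 by (simp_all add: agree_def)
      have bd2: "bounded_state W \<sigma>2" using exec_bounded[OF t2(1) bd1] .
      have R2: "reach_matrix \<sigma>2" using R g2 by (simp add: reach_matrix_def)
      have p2: "\<sigma>2 ''parent'' k = s" by (simp add: s2)
      from tree_row_correct[OF bd2 g2(1) R2 g2(2) k True p2]
      obtain t3 \<tau> where t3: "exec W (For ''w'' (Var ''n'') tree_step) \<sigma>2 t3 \<tau>"
        "\<forall>v'. v' \<noteq> k \<longrightarrow> \<tau> ''parent'' v' = \<sigma>2 ''parent'' v'" "\<tau> ''parent'' k < n"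
        "k \<noteq> s \<longrightarrow> idom s (set as) {..<n} (\<tau> ''parent'' k) k"
        "t3 \<le> (cost_bound tree_step + 12) * (n + 1)" by blast
      have a3: "\<tau> ''in_tree'' = \<sigma>1 ''in_tree''" using agreeD[OF exec_agree[OF t3(1)], of "''in_tree''"] g2 by simp
      have p3: "\<tau> ''parent'' v = (if v = k then \<tau> ''parent'' k else \<sigma> ''parent'' v)" for v
        using t3(2) s2 by simp
      have "exec W tree_body \<sigma> (t1 + (1 + cond_cost b + (t2 + t3))) \<tau>"
        unfolding body
        by (rule exec.Seq[OF t1(1) exec.IfTrue[OF bfit _ exec.Seq[OF t2(1) t3(1)]]]) (use bval True in simp)
      moreover have "I (Suc k) \<tau>"
        unfolding I_def
      proof (intro conjI allI impI)
        fix v assume "v < n"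
        then show "\<tau> ''parent'' v < n" using I t3(3) p3[of v] by (auto simp: I_def)
      next
        fix v assume v: "v < Suc k"
        then show "\<tau> ''in_tree'' v \<noteq> 0 \<longleftrightarrow> avoids s (set as) n v"
          using I True by (auto simp: I_def a3 s1 less_Suc_eq)
        assume "v \<noteq> s \<and> avoids s (set as) n v"
        then show "idom s (set as) {..<n} (\<tau> ''parent'' v) v"
          using I t3(4) v p3[of v] by (auto simp: I_def less_Suc_eq)
      qed
      ultimately show ?thesis using t1(2) t2(2) t3(5) cb True
        by (intro exI[of _ "t1 + (1 + cond_cost b + (t2 + t3))"] exI[of _ \<tau>]) (simp add: B_def)
    qed
  qed
  then obtain t \<tau> where t: "exec W (For ''v'' (Var ''n'') tree_body) \<sigma>0 t \<tau>" "I n \<tau>"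
    "t \<le> (\<Sum>k<n. B k + 12) + 12" by auto
  have "(\<Sum>k<n. B k + 12) = 42 * n + (\<Sum>k\<in>{..<n} \<inter> {v. avoids s (set as) n v}. (cost_bound tree_step + 12) * (n + 1))"
    unfolding B_def by (simp add: sum.distrib sum.If_cases)
  also have "{..<n} \<inter> {v. avoids s (set as) n v} = {v. v < n \<and> avoids s (set as) n v}" by auto
  also have "(\<Sum>k\<in>{v. v < n \<and> avoids s (set as) n v}. (cost_bound tree_step + 12) * (n + 1)) \<le>
      (m + 1) * ((cost_bound tree_step + 12) * (n + 1))"
    unfolding sum_constant of_nat_id by (rule mult_le_mono1[OF card_reached]) simp
  finally have "t \<le> 42 * n + (m + 1) * ((cost_bound tree_step + 12) * (n + 1)) + 12" using t(3) by linarith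
  also have "\<dots> \<le> (cost_bound tree_step + 100) * ((n + 1) * (m + 1))" by (simp add: algebra_simps)
  finally have "t \<le> (cost_bound tree_step + 100) * ((n + 1) * (m + 1))" .
  moreover have "tree_ok (set as) \<tau>" using t(2) by (simp add: I_def tree_ok_def)
  ultimately show ?thesis using t(1) by blast
qed

section \<open>Summing the weights over all copies\<close>

lemma sum_length_filter: "(\<Sum>x<k. length (filter (\<lambda>e. fst e = x) l)) \<le> length l" for l :: "(nat \<times> 'b) list"
proof (induction l)
  case (Cons e l)
  have "(\<Sum>x<k. length (filter (\<lambda>e. fst e = x) (e # l))) =
    (\<Sum>x<k. (if fst e = x then 1 else 0) + length (filter (\<lambda>e. fst e = x) l))"
    by (rule sum.cong) auto
  also have "\<dots> = (if fst e < k then 1 else 0) + (\<Sum>x<k. length (filter (\<lambda>e. fst e = x) l))"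
    by (simp add: sum.distrib)
  finally show ?case using Cons by simp
qed simp

text \<open>Each of the \<open>n + 1\<close> copies has at most \<open>m + 1\<close> alive vertices,
  which pay the constant part of the weight, and their out-degrees add up to at most
  \<open>m\<close>.\<close>

lemma sum_alive:
  assumes "E \<subseteq> set as"
  shows "(\<Sum>p\<in>alive E. weight B p + c) \<le> (100 + B + c) * ((n + 1) * (m + 1))"
proof -
  have al: "alive E = Sigma {..n} (\<lambda>w. {x. x < n \<and> avoids s E w x})" by (auto simp: alive_def)
  have row: "(\<Sum>x\<in>{x. x < n \<and> avoids s E w x}. weight B (w, x) + c) \<le> (100 + B + c) * (m + 1)" for w
  proof -
    define X where "X = {x. x < n \<and> avoids s E w x}"
    have X: "X \<subseteq> {..<n}" by (auto simp: X_def)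
    have "(\<Sum>x\<in>X. weight B (w, x) + c) = (60 + c) * card X + (B + 40) * (\<Sum>x\<in>X. length (adj_list x))"
      by (simp add: weight_def sum.distrib sum_distrib_left[symmetric] sum_distrib_right[symmetric]
          algebra_simps)
    also have "(\<Sum>x\<in>X. length (adj_list x)) \<le> (\<Sum>x<n. length (adj_list x))"
      by (rule sum_mono2[OF _ X]) auto
    also have "\<dots> \<le> m" using sum_length_filter[where l = as and k = n] len by (simp add: adj_list_def)
    also have "card X \<le> m + 1" using card_reached[OF assms] by (simp add: X_def)
    finally have "(\<Sum>x\<in>X. weight B (w, x) + c) \<le> (60 + c) * (m + 1) + (B + 40) * m" by simp
    also have "\<dots> \<le> (100 + B + c) * (m + 1)" by (simp add: algebra_simps)
    finally show ?thesis by (simp add: X_def)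
  qed
  have "(\<Sum>p\<in>alive E. weight B p + c) =
      (\<Sum>w\<le>n. \<Sum>x\<in>{x. x < n \<and> avoids s E w x}. weight B (w, x) + c)"
    unfolding al by (subst sum.Sigma) auto
  also have "\<dots> \<le> (\<Sum>w\<le>n. (100 + B + c) * (m + 1))" by (rule sum_mono) (rule row)
  finally show ?thesis by (simp add: algebra_simps)
qed

end


section \<open>The total running time\<close>

definition init_factor :: nat where
  "init_factor = cost_bound adj_step + 2 * cost_bound search_step + cost_bound forward_step +
     cost_bound count_start + cost_bound count_step + cost_bound tree_step + 400"

definition upd_factor :: nat where
  "upd_factor = cost_bound seed_step + cost_bound cascade_step + cost_bound event_step + 300"

context problem
begin

lemma bounded_input: "bounded_state W (input_state n s as)"
proof -
  have "fst (as ! i) < W" "snd (as ! i) < W" if "i < length as" for i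
    using edge_nth[of i] that len fits(2) by (auto intro: less_trans)
  moreover have "s < W" using start fits(2) by linarith
  ultimately show ?thesis by (simp add: bounded_state_def input_state_def len)
qed

lemma inputs_input: "inputs (input_state n s as)"
  by (simp add: inputs_def input_state_def len)

lemma init_correct:
  "\<exists>t \<tau>. exec W init_prog (input_state n s as) t \<tau> \<and> maintained (set as) \<tau> \<and>
    t \<le> init_factor * ((n + 1) * (m + 1))"
proof -
  define \<sigma>0 where "\<sigma>0 = input_state n s as"
  have bd0: "bounded_state W \<sigma>0" and inp0: "inputs \<sigma>0"
    unfolding \<sigma>0_def by (rule bounded_input, rule inputs_input)
  have z: "\<sigma>0 ''deg'' = (\<lambda>_. 0)" "\<sigma>0 ''R'' = (\<lambda>_. 0)" "\<sigma>0 ''F'' = (\<lambda>_. 0)" "\<sigma>0 ''K'' = (\<lambda>_. 0)"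
    "\<sigma>0 ''parent'' = (\<lambda>_. 0)" "\<sigma>0 ''t'' = (\<lambda>_. 0)"
    by (simp_all add: \<sigma>0_def input_state_def)
  from adj_correct[OF bd0 inp0] z(1)
  obtain t1 \<sigma>1 where t1: "exec W (For ''i'' (Var ''m'') adj_step) \<sigma>0 t1 \<sigma>1" "layout \<sigma>1"
    "t1 \<le> (cost_bound adj_step + 12) * (m + 1)" by auto
  have bd1: "bounded_state W \<sigma>1" using exec_bounded[OF t1(1) bd0] .
  have a1: "agree {''i'', ''adj'', ''deg''} \<sigma>0 \<sigma>1" using exec_agree[OF t1(1)] by simp
  define \<sigma>2 where "\<sigma>2 = store \<sigma>1 ''y'' 0 s"
  have s1: "\<sigma>1 ''s'' 0 = s" using t1(2) by (simp add: layout_def)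
  have t2: "exec W (Put ''y'' (Var ''s'')) \<sigma>1 4 \<sigma>2"
    using exec.Assign[of W "Const 0" \<sigma>1 "Var ''s''" "''y''"] s1 lt_W'[OF start]
    by (simp add: \<sigma>2_def eval_nat_numeral)
  have bd2: "bounded_state W \<sigma>2" using exec_bounded[OF t2 bd1] .
  have a12: "agree {''y''} \<sigma>1 \<sigma>2" using exec_agree[OF t2] by simp
  have a2: "agree {''i'', ''adj'', ''deg'', ''y''} \<sigma>0 \<sigma>2" using a1 a12 by (rule agree_trans) auto
  have ly2: "layout \<sigma>2" using t1(2) a12 by (rule layout_agree) simp
  have n2: "\<sigma>2 ''n'' 0 = n" using ly2 by (simp add: layout_def)
  have "queue \<sigma>2 = []" using agreeD[OF a2, of "''t''"] z(6) by (simp add: queue_def)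
  then have si: "search_inv \<sigma>2" using agreeD[OF a2, of "''R''"] z(2) by (simp add: search_inv_def)
  from search_seed_correct[OF bd2 n2 _ si]
  obtain t3 \<sigma>3 where t3: "exec W (For ''w'' (Bin Plus (Var ''n'') (Const 1)) search_step) \<sigma>2 t3 \<sigma>3"
    "search_inv \<sigma>3" "\<forall>w\<le>n. w \<noteq> s \<longrightarrow> (w, s) \<in> set (queue \<sigma>3)"
    "t3 \<le> (cost_bound search_step + 28) * (n + 1)" by (auto simp: \<sigma>2_def store_apply)
  have bd3: "bounded_state W \<sigma>3" using exec_bounded[OF t3(1) bd2] .
  have a23: "agree {''w'', ''R'', ''qw'', ''qx'', ''t''} \<sigma>2 \<sigma>3" using exec_agree[OF t3(1)] by simp
  have ly3: "layout \<sigma>3" using ly2 a23 by (rule layout_agree) simp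
  from search_correct[OF bd3 ly3 t3(2)] t3(3)
  obtain t4 \<sigma>4 where t4: "exec W (worklist search_step) \<sigma>3 t4 \<sigma>4" "reach_matrix \<sigma>4"
    "t4 \<le> 9 + (\<Sum>p\<in>alive (set as). weight (cost_bound search_step) p)" by auto
  have bd4: "bounded_state W \<sigma>4" using exec_bounded[OF t4(1) bd3] .
  have a34: "agree {''h'', ''w'', ''x'', ''j'', ''y'', ''R'', ''qw'', ''qx'', ''t''} \<sigma>3 \<sigma>4"
    using exec_agree[OF t4(1)] by (rule agree_mono) (auto simp: writes_worklist)
  have ly4: "layout \<sigma>4" using ly3 a34 by (rule layout_agree) simp
  have a04: "agree {''i'', ''adj'', ''deg'', ''y'', ''h'', ''w'', ''x'', ''j'', ''R'', ''qw'', ''qx'', ''t''} \<sigma>0 \<sigma>4"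
    by (rule agree_trans[OF agree_trans[OF a2 a23 Un_upper1 Un_upper2] a34]) auto
  have inp4: "inputs \<sigma>4" using inp0 a04 by (rule inputs_agree) simp
  from forward_correct[OF bd4 inp4 t4(2)] agreeD[OF a04, of "''F''"] z(3)
  obtain t5 \<sigma>5 where t5: "exec W (For ''i'' (Var ''m'') forward_step) \<sigma>4 t5 \<sigma>5" "forward_matrix F0 \<sigma>5"
    "t5 \<le> (cost_bound forward_step + 12) * (m + 1)" by auto
  have bd5: "bounded_state W \<sigma>5" using exec_bounded[OF t5(1) bd4] .
  have a45: "agree {''i'', ''F''} \<sigma>4 \<sigma>5" using exec_agree[OF t5(1)] by simp
  have inp5: "inputs \<sigma>5" using inp4 a45 by (rule inputs_agree) simp
  have ly5: "layout \<sigma>5" using ly4 a45 by (rule layout_agree) simp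
  have R5: "reach_matrix \<sigma>5" using t4(2) agreeD[OF a45, of "''R''"] by (simp add: reach_matrix_def)
  from count_correct[OF bd5 inp5 R5 t5(2)] agreeD[OF a04, of "''K''"] agreeD[OF a45, of "''K''"] z(4)
  obtain t6 \<sigma>6 where t6: "exec W (For ''w'' (Bin Plus (Var ''n'') (Const 1))
      (Seq count_start (For ''i'' (Var ''m'') count_step))) \<sigma>5 t6 \<sigma>6"
    "counts {(w, x, y). w \<le> n \<and> (x, y) \<in> F0 \<and> avoids s F0 w x} \<sigma>6"
    "t6 \<le> (cost_bound count_start + cost_bound count_step + 40) * ((n + 1) * (m + 1))" by auto
  have bd6: "bounded_state W \<sigma>6" using exec_bounded[OF t6(1) bd5] .
  have a56: "agree {''w'', ''K'', ''i''} \<sigma>5 \<sigma>6" using exec_agree[OF t6(1)] by (rule agree_mono) auto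
  have ly6: "layout \<sigma>6" using ly5 a56 by (rule layout_agree) simp
  have R6: "reach_matrix \<sigma>6" using R5 agreeD[OF a56, of "''R''"] by (simp add: reach_matrix_def)
  have n6: "\<sigma>6 ''n'' 0 = n" "\<sigma>6 ''s'' 0 = s" using ly6 by (simp_all add: layout_def)
  from tree_correct[OF bd6 n6 R6] agreeD[OF a04, of "''parent''"] agreeD[OF a45, of "''parent''"]
    agreeD[OF a56, of "''parent''"] z(5)
  obtain t7 \<tau> where t7: "exec W (For ''v'' (Var ''n'') tree_body) \<sigma>6 t7 \<tau>" "tree_ok (set as) \<tau>"
    "t7 \<le> (cost_bound tree_step + 100) * ((n + 1) * (m + 1))" by auto
  have a67: "agree {''v'', ''in_tree'', ''parent'', ''w''} \<sigma>6 \<tau>" using exec_agree[OF t7(1)] by simp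
  have "layout \<tau>" using ly6 a67 by (rule layout_agree) simp
  moreover have "forward_matrix F0 \<tau>"
    using t5(2) agreeD[OF a56, of "''F''"] agreeD[OF a67, of "''F''"] by (simp add: forward_matrix_def)
  moreover have "counts {(w, x, y). w \<le> n \<and> (x, y) \<in> F0 \<and> avoids s F0 w x} \<tau>"
    using t6(2) agreeD[OF a67, of "''K''"] by (simp add: counts_def)
  moreover have "set as \<inter> F0 = F0" using F0_subset by auto
  ultimately have mt: "maintained (set as) \<tau>"
    using t7(2) exec_bounded[OF t7(1) bd6] by (simp add: maintained_def)
  define X where "X = (n + 1) * (m + 1)"
  have X: "m + 1 \<le> X" "n + 1 \<le> X" "1 \<le> X" by (simp_all add: X_def)
  have "t1 \<le> (cost_bound adj_step + 12) * X" using t1(3) mult_le_mono2[OF X(1)] le_trans by blast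
  moreover have "t3 \<le> (cost_bound search_step + 28) * X" using t3(4) mult_le_mono2[OF X(2)] le_trans by blast
  moreover have "t4 \<le> 9 + (100 + cost_bound search_step) * X"
    using t4(3) sum_alive[of "set as" "cost_bound search_step" 0] by (simp add: X_def)
  moreover have "t5 \<le> (cost_bound forward_step + 12) * X" using t5(3) mult_le_mono2[OF X(1)] le_trans by blast
  \<comment> \<open>\<open>108\<close> is what \<open>400\<close> leaves after
    \<open>12 + 28 + 100 + 12 + 40 + 100\<close>; it absorbs the \<open>4\<close> steps of the
    assignment to \<open>y\<close> and the \<open>9\<close> of the search.\<close>
  moreover have "init_factor * X = (cost_bound adj_step + 12) * X + (cost_bound search_step + 28) * X +
    (100 + cost_bound search_step) * X + (cost_bound forward_step + 12) * X +
    (cost_bound count_start + cost_bound count_step + 40) * X + (cost_bound tree_step + 100) * X + 108 * X"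
    by (simp add: init_factor_def algebra_simps)
  ultimately have "t1 + (4 + (t3 + (t4 + (t5 + (t6 + t7))))) \<le> init_factor * X"
    using t6(3) t7(3) X(3) unfolding X_def[symmetric] by simp
  moreover have "exec W init_prog \<sigma>0 (t1 + (4 + (t3 + (t4 + (t5 + (t6 + t7)))))) \<tau>"
    unfolding init_prog_def
    by (rule exec.Seq[OF t1(1) exec.Seq[OF t2 exec.Seq[OF t3(1) exec.Seq[OF t4(1)
      exec.Seq[OF t5(1) exec.Seq[OF t6(1) t7(1)]]]]]])
  ultimately show ?thesis using mt unfolding \<sigma>0_def X_def by blast
qed

text \<open>The stored parent is an immediate dominator by \<open>tree_ok\<close>. It is the only
  one because two immediate dominators of \<open>v\<close> dominate each other, and dominance is
  antisymmetric on reachable vertices.\<close>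

lemma stored_tree_correct:
  assumes G: "flow_graph G s" "pverts G = {..<n}" "parcs G = E" and E: "E \<subseteq> set as"
    and M: "maintained E \<sigma>"
  shows "stored_tree n s \<sigma> = dominator_tree G s"
proof -
  interpret flow_graph G s by fact
  have tr: "tree_ok E \<sigma>" using M by (simp add: maintained_def)
  have arcs: "arcs_ends (with_proj G) = E"
    using G(3) by (simp add: arcs_ends_def arc_to_ends_def)
  have reach: "s \<rightarrow>\<^sup>*\<^bsub>with_proj G\<^esub> v \<longleftrightarrow> (s, v) \<in> E\<^sup>*" for v
  proof
    assume "s \<rightarrow>\<^sup>*\<^bsub>with_proj G\<^esub> v"
    then show "(s, v) \<in> E\<^sup>*" using reachable_rtranclI arcs by metis
  next
    assume "(s, v) \<in> E\<^sup>*"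
    then show "s \<rightarrow>\<^sup>*\<^bsub>with_proj G\<^esub> v"
    proof (induction rule: rtrancl_induct)
      case base
      show ?case using start_in_verts by simp
    next
      case (step y z)
      then show ?case using reachable_adj_trans[of s y z] arcs by simp
    qed
  qed
  have lt: "v < n" if "s \<rightarrow>\<^sup>*\<^bsub>with_proj G\<^esub> v" for v
    using reachable_in_verts(2)[OF that] G(2) by simp
  have av: "avoids s E n v \<longleftrightarrow> s \<rightarrow>\<^sup>*\<^bsub>with_proj G\<^esub> v" for v
    using avoids_n[OF E] reach by simp
  have dom: "dominates G s w v \<longleftrightarrow> \<not> avoids s E w v" for w v
    using dominates_iff_avoids[OF G(1)] G(3) by simp
  have idm: "immediate_dominator G s d v \<longleftrightarrow> d = \<sigma> ''parent'' v"
    if v: "s \<rightarrow>\<^sup>*\<^bsub>with_proj G\<^esub> v" "v \<noteq> s" for d v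
  proof -
    define p where "p = \<sigma> ''parent'' v"
    have p: "idom s E {..<n} p v"
      using tr v lt av by (simp add: tree_ok_def p_def)
    \<comment> \<open>\<open>tree_ok\<close> compares with vertices only; a number that is not a
      vertex cannot dominate the reachable \<open>v\<close>.\<close>
    have small: "w < n" if "\<not> avoids s E w v" for w
    proof (rule ccontr)
      assume "\<not> w < n"
      then have "w \<noteq> s" "w \<notin> Range E" using start E edges by auto
      from avoids_fresh[OF this] that reach v show False by simp
    qed
    have pd: "\<not> avoids s E w p" if "\<not> avoids s E w v" "w \<noteq> v" for w
      using p that small[OF that(1)] by (simp add: idom_def)
    have pv: "p \<noteq> v" "\<not> avoids s E p v" using p by (simp_all add: idom_def)
    show ?thesis
    proof
      assume "d = \<sigma> ''parent'' v"
      then show "immediate_dominator G s d v"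
        using pv pd by (auto simp: immediate_dominator_def dom p_def)
    next
      assume d: "immediate_dominator G s d v"
      show "d = \<sigma> ''parent'' v"
      proof (rule ccontr)
        assume ne: "d \<noteq> \<sigma> ''parent'' v"
        have dv: "\<not> avoids s E d v" "d \<noteq> v" using d by (simp_all add: immediate_dominator_def dom)
        have 1: "\<not> avoids s E p d"
          using d pv ne by (auto simp: immediate_dominator_def dom p_def)
        have 2: "\<not> avoids s E d p" using pd dv by blast
        \<comment> \<open>Antisymmetry requires \<open>d\<close> to be reachable: a path to
          \<open>v\<close> in copy \<open>n\<close>, which is the graph itself, passes through its
          dominator \<open>d\<close>.\<close>
        have "avoids s E n d" using avoids_split[of s E n v d] av v dv by blast
        then have "(s, d) \<in> E\<^sup>*" using avoids_n[OF E] by simp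
        from dominators_antisym[OF this 1 2] ne show False by (simp add: p_def)
      qed
    qed
  qed
  have in_tree: "v < n \<and> \<sigma> ''in_tree'' v \<noteq> 0 \<longleftrightarrow> s \<rightarrow>\<^sup>*\<^bsub>with_proj G\<^esub> v" for v
    using tr av lt by (auto simp: tree_ok_def)
  have "{v. v < n \<and> \<sigma> ''in_tree'' v \<noteq> 0} = {v. s \<rightarrow>\<^sup>*\<^bsub>with_proj G\<^esub> v}"
    using in_tree by blast
  moreover have "{(\<sigma> ''parent'' v, v) |v. v < n \<and> \<sigma> ''in_tree'' v \<noteq> 0 \<and> v \<noteq> s} =
      {(d, v). s \<rightarrow>\<^sup>*\<^bsub>with_proj G\<^esub> v \<and> v \<noteq> s \<and> immediate_dominator G s d v}"
    using in_tree idm by blast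
  ultimately show ?thesis unfolding stored_tree_def dominator_tree_def by (simp only:)
qed

text \<open>The potentials of consecutive graphs telescope, leaving the initial potential and one
  term of order \<open>n\<close> per deletion.\<close>

lemma maintains_correct:
  assumes "maintained E \<sigma>" "E \<subseteq> set as" "set es \<subseteq> {..<n} \<times> {..<n}"
    "flow_graph G s" "pverts G = {..<n}" "parcs G = E"
  shows "\<exists>t. maintains W upd_prog n G s \<sigma> es t \<and>
    t \<le> potential E + length es * ((cost_bound seed_step + 100) * (n + 1))"
  using assms
proof (induction es arbitrary: E \<sigma> G)
  case Nil
  then show ?case using stored_tree_correct[of G E \<sigma>] by simp
next
  case (Cons e es)
  have e: "fst e < n" "snd e < n" using Cons.prems(3) by auto
  from update_correct[OF Cons.prems(1,2) e]
  obtain t1 \<tau> where t1: "exec W upd_prog (request e \<sigma>) t1 \<tau>" "maintained (E - {e}) \<tau>"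
    "t1 + potential (E - {e}) \<le> potential E + (cost_bound seed_step + 100) * (n + 1)" by blast
  interpret flow_graph G s by (rule Cons.prems(4))
  have "flow_graph (delete_edge G e) s"
    using start_in_verts pair_finite_verts pair_finite_arcs in_arcsD1 in_arcsD2
    by unfold_locales (auto simp: delete_edge_def)
  then obtain t2 where t2: "maintains W upd_prog n (delete_edge G e) s \<tau> es t2"
    "t2 \<le> potential (E - {e}) + length es * ((cost_bound seed_step + 100) * (n + 1))"
    using Cons.IH[OF t1(2), of "delete_edge G e"] Cons.prems by (auto simp: delete_edge_def)
  have "stored_tree n s \<sigma> = dominator_tree G s"
    using stored_tree_correct[of G E \<sigma>] Cons.prems by simp
  then have "maintains W upd_prog n G s \<sigma> (e # es) (t1 + t2)" using t1(1) t2(1) by auto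
  moreover have "t1 + t2 \<le> potential E + length (e # es) * ((cost_bound seed_step + 100) * (n + 1))"
    using t1(3) t2(2) by simp
  ultimately show ?case by blast
qed

lemma total_correct:
  assumes G: "flow_graph G s" "pverts G = {..<n}" "parcs G = set as"
    and es: "distinct es" "set es \<subseteq> set as"
  shows "\<exists>t0 \<sigma> t. exec W init_prog (input_state n s as) t0 \<sigma> \<and> maintains W upd_prog n G s \<sigma> es t \<and>
    t0 + t \<le> (init_factor + upd_factor) * ((n + 1) * (m + 1))"
proof -
  obtain t0 \<sigma> where i: "exec W init_prog (input_state n s as) t0 \<sigma>" "maintained (set as) \<sigma>"
    "t0 \<le> init_factor * ((n + 1) * (m + 1))" using init_correct by blast
  have "set es \<subseteq> {..<n} \<times> {..<n}" using es(2) edges by blast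
  from maintains_correct[OF i(2) subset_refl this G]
  obtain t where t: "maintains W upd_prog n G s \<sigma> es t"
    "t \<le> potential (set as) + length es * ((cost_bound seed_step + 100) * (n + 1))" by blast
  define X where "X = (n + 1) * (m + 1)"
  \<comment> \<open>Edges are deleted at most once, so there are at most \<open>m\<close> deletions,
    each with a term of order \<open>n\<close>.\<close>
  have "length es = card (set es)" using distinct_card[OF es(1)] by simp
  also have "\<dots> \<le> card (set as)" by (rule card_mono) (use es(2) in auto)
  also have "\<dots> = m" using distinct_card[OF dist] len by simp
  finally have "length es * ((cost_bound seed_step + 100) * (n + 1)) \<le>
      (m + 1) * ((cost_bound seed_step + 100) * (n + 1))" by (intro mult_le_mono1) simp
  also have "\<dots> = (cost_bound seed_step + 100) * X" by (simp only: X_def mult_ac)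
  finally have 1: "length es * ((cost_bound seed_step + 100) * (n + 1)) \<le> (cost_bound seed_step + 100) * X" .
  have 2: "potential (set as) \<le> (100 + cost_bound cascade_step + (cost_bound event_step + 12)) * X"
    unfolding potential_def X_def by (rule sum_alive) simp
  have "upd_factor * X = (cost_bound seed_step + 100) * X +
      (100 + cost_bound cascade_step + (cost_bound event_step + 12)) * X + 88 * X"
    by (simp add: upd_factor_def algebra_simps)
  then have "t \<le> upd_factor * X" using t(2) 1 2 by linarith
  then have "t0 + t \<le> (init_factor + upd_factor) * X"
    using i(3) unfolding X_def[symmetric] by (simp add: add_mult_distrib)
  then show ?thesis using i(1) t(1) unfolding X_def by blast
qed

end

text \<open>For \<open>m = 0\<close> the product \<open>m * n\<close> vanishes although
  initialisation takes time, hence the case \<open>m \<ge> 1\<close>. Then, as the start vertex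
  gives \<open>n \<ge> 1\<close>, \<open>(n + 1) * (m + 1)\<close> is at most
  \<open>4 * (m * n)\<close>, which explains the factor \<open>4\<close> in the witness for
  \<open>C\<close>.\<close>

theorem theorem4:
  shows "\<exists>(init :: com) (upd :: com) (C :: nat) (c :: nat).
    \<forall>(G :: nat pair_pre_digraph) (s :: nat) (n :: nat) (m :: nat)
      (as :: (nat \<times> nat) list) (es :: (nat \<times> nat) list).
      flow_graph G s \<and> reducible G s \<and>
      pverts G = {..<n} \<and> card (parcs G) = m \<and>
      distinct as \<and> set as = parcs G \<and>
      distinct es \<and> set es \<subseteq> parcs G \<longrightarrow>
      (\<exists>t0 \<sigma> t. exec ((n + m + 1) ^ c) init (input_state n s as) t0 \<sigma> \<and>
        maintains ((n + m + 1) ^ c) upd n G s \<sigma> es t \<and>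
        (m \<ge> 1 \<longrightarrow> t0 + t \<le> C * (m * n)))"
proof (rule exI[of _ init_prog], rule exI[of _ upd_prog], rule exI[of _ "4 * (init_factor + upd_factor)"],
    rule exI[of _ 5], intro allI impI, elim conjE)
  fix G :: "nat pair_pre_digraph" and s n m :: nat and as es :: "(nat \<times> nat) list"
  assume G: "flow_graph G s" "reducible G s" "pverts G = {..<n}" "card (parcs G) = m"
    and as: "distinct as" "set as = parcs G" and es: "distinct es" "set es \<subseteq> parcs G"
  interpret G: flow_graph G s by fact
  have sn: "s < n" using G.start_in_verts G(3) by simp
  define Y where "Y = n + m + 1"
  have Y: "2 \<le> Y" "n + 2 \<le> 2 * Y" "n + m + 2 \<le> 2 * Y" using sn by (simp_all add: Y_def)
  \<comment> \<open>Origin of the exponent \<open>5\<close>: with \<open>Y \<ge> 2\<close> each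
    factor \<open>2 * Y\<close> is at most \<open>Y * Y\<close>, so the product is at most
    \<open>Y ^ 4\<close>, and strictness costs one more factor.\<close>
  have "(n + 2) * (n + m + 2) \<le> (2 * Y) * (2 * Y)" using Y(2,3) by (rule mult_le_mono)
  also have "\<dots> \<le> (Y * Y) * (Y * Y)" using Y(1) by (intro mult_le_mono) auto
  also have "\<dots> = Y ^ 4" by (simp add: power4_eq_xxxx)
  also have "\<dots> < Y ^ 5" using Y(1) by (intro power_strict_increasing) auto
  finally have word: "(n + 2) * (n + m + 2) < (n + m + 1) ^ 5" by (simp add: Y_def)
  interpret problem n m s "(n + m + 1) ^ 5" as
  proof
    show "s < n" "distinct as" "(n + 2) * (n + m + 2) < (n + m + 1) ^ 5" by (fact sn as(1) word)+
    show "length as = m" using distinct_card[OF as(1)] as(2) G(4) by simp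
    show "set as \<subseteq> {..<n} \<times> {..<n}" using as(2) G(3) G.in_arcsD1 G.in_arcsD2 by auto
    show "acyclic (forward_edges s (set as))" using acyclic_forward_edges[OF G(1,2)] as(2) by simp
  qed
  obtain t0 \<sigma> t where t: "exec ((n + m + 1) ^ 5) init_prog (input_state n s as) t0 \<sigma>"
    "maintains ((n + m + 1) ^ 5) upd_prog n G s \<sigma> es t"
    "t0 + t \<le> (init_factor + upd_factor) * ((n + 1) * (m + 1))"
    using total_correct[OF G(1,3) as(2)[symmetric] es(1)] es(2) as(2) by auto
  have "t0 + t \<le> 4 * (init_factor + upd_factor) * (m * n)" if "m \<ge> 1"
  proof -
    have "(n + 1) * (m + 1) \<le> (2 * n) * (2 * m)" using sn that by (intro mult_le_mono) auto
    then have "(init_factor + upd_factor) * ((n + 1) * (m + 1)) \<le>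
        (init_factor + upd_factor) * ((2 * n) * (2 * m))" by (rule mult_le_mono2)
    also have "\<dots> = 4 * (init_factor + upd_factor) * (m * n)" by (simp add: algebra_simps)
    finally show ?thesis using t(3) by linarith
  qed
  with t(1,2) show "\<exists>t0 \<sigma> t. exec ((n + m + 1) ^ 5) init_prog (input_state n s as) t0 \<sigma> \<and>
      maintains ((n + m + 1) ^ 5) upd_prog n G s \<sigma> es t \<and>
      (m \<ge> 1 \<longrightarrow> t0 + t \<le> 4 * (init_factor + upd_factor) * (m * n))"
    by blast
qed

end
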